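(* Let $(R,\mathfrak m,\mathbb K=R/\mathfrak m)$ be a regular local ring with regular system of parameters $(x)=(x_1,\ldots,x_n)$, and let $\widehat R$ be its $\mathfrak m$-adic completion. Assume that the Newton polyhedron $\operatorname{NP}(f)$ (with respect to $(x)$) of $f\in R$ has a loose edge $\mathcal E$. If $f$ is irreducible in $\widehat R$, then $\mathcal E$ is the only compact edge of $\operatorname{NP}(f)$ and $$\operatorname{in}_{\mathcal E}(f)=\epsilon\cdot P^k$$ for some unit $\epsilon\in\mathbb K^\times$, some irreducible polynomial $P\in\mathbb K[X_1,\ldots,X_n]$ and some integer $k\ge1$. Moreover, if the residue field $\mathbb K$ is algebraically closed, then (for suitable such $\epsilon$ and $P$) $P=X^\alpha+\lambda X^\beta$ for some $\lambda\in\mathbb K^\times$ and some $\alpha,\beta\in\mathbb Z^n_{\ge0}$ such that $\alpha-\beta\in\mathbb Z^n$ is a primitive lattice vector.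
   Context: Multi-index notation: $x^A=x_1^{A_1}\cdots x_n^{A_n}$ for $A\in\mathbb Z_{\ge0}^n$, and similarly $X^A$. The ring $R$ need not be complete and may have mixed characteristic. A vector in $\mathbb Z^n$ is primitive if it is nonzero and the gcd of its entries is $1$. Newton polyhedron. Every $f\in R\setminus\{0\}$ has a finite expansion $f=\sum_A\rho_A x^A$ with $\rho_A\in R^\times\cup\{0\}$. The Newton polyhedron $\operatorname{NP}(f)\subset\mathbb R^n_{\ge0}$ is the smallest closed convex subset containing $\{A\in\mathbb Z^n_{\ge0}\mid\rho_A\ne0\}+\mathbb R^n_{\ge0}$ (it does not depend on the chosen expansion). Faces. A linear form $L:\mathbb R^n\to\mathbb R$ is a map $L(v)=\lambda_1v_1+\cdots+\lambda_nv_n$ with fixed coefficients $\lambda_i\ge0$; it is positive if all $\lambda_i>0$. A compact face of $\operatorname{NP}(f)$ is a set $\mathcal F$ of all points of $\operatorname{NP}(f)$ at which some positive linear form $L$ attains its minimum on $\operatorname{NP}(f)$; one says that $L$ determines $\mathcal F$. A vertex (resp. edge) is a compact face of dimension $0$ (resp. $1$). A loose edge is a compact edge that is not contained in any compact face of dimension $\ge2$. Initial form. Let $\mathcal F$ be a compact face of $\operatorname{NP}(f)$, determined by the positive linear form $L$, and let $f=\sum_A\rho_Ax^A$ be a finite expansion with $A\in\mathbb Z^n_{\ge0}$ and $\rho_A\in R^\times\cup\{0\}$. The initial form of $f$ along $\mathcal F$ is $\operatorname{in}_{\mathcal F}(f)=\sum_{A:\,L(A)=\nu_L(f)}\overline{\rho_A}\,X^A$,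 where $\nu_L(f)=\min\{L(A)\mid\rho_A\neq0\}$ and $\overline{\rho_A}=\rho_A\bmod\mathfrak m\in\mathbb K$; equivalently, the sum is over all $A\in\mathcal F$. It lies in the graded ring of $R$ associated to the monomial valuation $\nu_L$, which is identified with the polynomial ring $\mathbb K[X_1,\ldots,X_n]$ ($X_i$ being the image of $x_i$). It depends only on $f$, $(x)$ and $\mathcal F$. *)

theory Defs
  imports
    "HOL-Analysis.Analysis"
    "HOL-Computational_Algebra.Polynomial"
    "HOL-Library.Poly_Mapping"
    "HOL-Library.Extended_Nat"
begin

section \<open>Regular local rings\<close>

text \<open>Rings are commutative with 1 and are given by a type of class \<open>comm_ring_1\<close>, so that the
  library's divisibility theory (units, \<^const>\<open>irreducible\<close>) applies to them directly.\<close>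

definition (in comm_ring_1) is_ideal :: "'a set \<Rightarrow> bool" where
  "is_ideal I \<longleftrightarrow> 0 \<in> I \<and> (\<forall>a\<in>I. \<forall>b\<in>I. a + b \<in> I) \<and> (\<forall>r. \<forall>a\<in>I. r * a \<in> I)"

definition (in comm_ring_1) is_prime_ideal :: "'a set \<Rightarrow> bool" where
  "is_prime_ideal P \<longleftrightarrow> is_ideal P \<and> P \<noteq> UNIV \<and> (\<forall>a b. a * b \<in> P \<longrightarrow> a \<in> P \<or> b \<in> P)"

definition (in comm_ring_1) is_maximal_ideal :: "'a set \<Rightarrow> bool" where
  "is_maximal_ideal M \<longleftrightarrow>
     is_ideal M \<and> M \<noteq> UNIV \<and> (\<forall>I. is_ideal I \<and> M \<subseteq> I \<longrightarrow> I = M \<or> I = UNIV)"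

abbreviation (in comm_ring_1) ideal_generated :: "'a set \<Rightarrow> 'a set" where
  "ideal_generated S \<equiv> is_ideal hull S"

primrec (in comm_ring_1) ideal_power :: "'a set \<Rightarrow> nat \<Rightarrow> 'a set" where
  "ideal_power I 0 = UNIV"
| "ideal_power I (Suc k) = is_ideal hull {a * b | a b. a \<in> I \<and> b \<in> ideal_power I k}"

definition noetherian :: "'a::comm_ring_1 itself \<Rightarrow> bool" where
  "noetherian _ \<longleftrightarrow> (\<forall>I::'a set. is_ideal I \<longrightarrow> (\<exists>S. finite S \<and> I = ideal_generated S))"

definition krull_dim :: "'a::comm_ring_1 itself \<Rightarrow> enat" where
  "krull_dim _ =
     Sup {enat d | d. \<exists>P :: nat \<Rightarrow> 'a set.
            (\<forall>i\<le>d. is_prime_ideal (P i)) \<and> (\<forall>i<d. P i \<subset> P (Suc i))}"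

class local_ring = comm_ring_1 +
  assumes unique_maximal_ideal: "\<exists>!M. is_maximal_ideal M"

definition max_ideal :: "'a::local_ring set" where
  "max_ideal = (THE M. is_maximal_ideal M)"

definition regular_local_ring :: "'a::local_ring itself \<Rightarrow> bool" where
  "regular_local_ring _ \<longleftrightarrow> noetherian TYPE('a) \<and>
     (\<exists>S::'a set. finite S \<and> enat (card S) = krull_dim TYPE('a) \<and> ideal_generated S = max_ideal)"

text \<open>The finite type \<open>'n\<close> is the index set of the parameters, so \<open>n = CARD('n)\<close>. (The case
  \<open>n = 0\<close> of a field is thereby left out; there the Newton polyhedron is a point and has no edges.)\<close>

definition regular_system_of_parameters :: "('n::finite \<Rightarrow> 'a::local_ring) \<Rightarrow> bool" where
  "regular_system_of_parameters x \<longleftrightarrow>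
     krull_dim TYPE('a) = enat CARD('n) \<and> ideal_generated (range x) = max_ideal"


section \<open>The residue field\<close>

lemma (in comm_ring_1) is_ideal_diff: "is_ideal I \<Longrightarrow> a \<in> I \<Longrightarrow> b \<in> I \<Longrightarrow> a - b \<in> I"
proof -
  assume I: "is_ideal I" "a \<in> I" "b \<in> I"
  then have "(- 1) * b \<in> I" unfolding is_ideal_def by blast
  then have "a + (- 1) * b \<in> I" using I unfolding is_ideal_def by blast
  then show ?thesis by simp
qed

lemma (in comm_ring_1) is_ideal_hull: "is_ideal (is_ideal hull S)"
  by (rule hull_in) (auto simp: is_ideal_def)

lemma (in comm_ring_1) is_ideal_power: "is_ideal (ideal_power I k)"
  by (cases k) (simp_all add: is_ideal_hull, simp add: is_ideal_def)

lemma (in comm_ring_1) ideal_mult_mem: "is_ideal I \<Longrightarrow> a \<in> I \<Longrightarrow> r * a \<in> I"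
  by (auto simp: is_ideal_def)

lemma (in comm_ring_1) ideal_add_mem: "is_ideal I \<Longrightarrow> a \<in> I \<Longrightarrow> b \<in> I \<Longrightarrow> a + b \<in> I"
  by (auto simp: is_ideal_def)

lemma (in comm_ring_1) ideal_zero_mem: "is_ideal I \<Longrightarrow> 0 \<in> I"
  by (auto simp: is_ideal_def)

lemma (in comm_ring_1) ideal_cong_sym: "is_ideal I \<Longrightarrow> a - b \<in> I \<Longrightarrow> b - a \<in> I"
  using is_ideal_diff[of I 0 "a - b"] ideal_zero_mem by simp

lemma (in comm_ring_1) ideal_cong_trans:
  "is_ideal I \<Longrightarrow> a - b \<in> I \<Longrightarrow> b - c \<in> I \<Longrightarrow> a - c \<in> I"
  using ideal_add_mem[of I "a - b" "b - c"] by (simp add: algebra_simps)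

lemma (in comm_ring_1) ideal_cong_add:
  "is_ideal I \<Longrightarrow> a - a' \<in> I \<Longrightarrow> b - b' \<in> I \<Longrightarrow> (a + b) - (a' + b') \<in> I"
  using ideal_add_mem[of I "a - a'" "b - b'"] by (simp add: algebra_simps)

lemma (in comm_ring_1) ideal_cong_diff:
  "is_ideal I \<Longrightarrow> a - a' \<in> I \<Longrightarrow> b - b' \<in> I \<Longrightarrow> (a - b) - (a' - b') \<in> I"
  using is_ideal_diff[of I "a - a'" "b - b'"] by (simp add: algebra_simps)

lemma (in comm_ring_1) ideal_cong_uminus:
  "is_ideal I \<Longrightarrow> a - a' \<in> I \<Longrightarrow> (- a) - (- a') \<in> I"
  using ideal_cong_sym[of I a a'] by simp

lemma (in comm_ring_1) ideal_cong_mult: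
  assumes "is_ideal I" "a - a' \<in> I" "b - b' \<in> I"
  shows "a * b - a' * b' \<in> I"
proof -
  have "b * (a - a') + a' * (b - b') \<in> I"
    using assms by (intro ideal_add_mem ideal_mult_mem)
  then show ?thesis by (simp add: algebra_simps)
qed

lemma max_ideal: "is_maximal_ideal (max_ideal :: 'a::local_ring set)"
  unfolding max_ideal_def by (rule theI') (rule unique_maximal_ideal)

lemma is_ideal_max_ideal: "is_ideal (max_ideal :: 'a::local_ring set)"
  by (rule max_ideal[unfolded is_maximal_ideal_def, THEN conjunct1])

lemma one_notin_max_ideal: "(1::'a::local_ring) \<notin> max_ideal"
proof
  assume "(1::'a) \<in> max_ideal"
  then have "r \<in> max_ideal" for r :: 'a
    using ideal_mult_mem[OF is_ideal_max_ideal, of 1 r] by simp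
  then show False
    using max_ideal by (auto simp: is_maximal_ideal_def)
qed

lemma inverse_mod_max_ideal:
  fixes a :: "'a::local_ring"
  assumes "a \<notin> max_ideal"
  shows "\<exists>r. r * a - 1 \<in> max_ideal"
proof -
  define J where "J = {m + r * a | m r. m \<in> max_ideal}"
  have mJ: "max_ideal \<subseteq> J"
  proof
    fix m :: 'a assume "m \<in> max_ideal"
    then show "m \<in> J" unfolding J_def by (intro CollectI exI[of _ m] exI[of _ 0]) simp
  qed
  have aJ: "a \<in> J"
    unfolding J_def using ideal_zero_mem[OF is_ideal_max_ideal]
    by (intro CollectI exI[of _ 0] exI[of _ 1]) simp
  have "is_ideal J"
    unfolding is_ideal_def
  proof (intro conjI ballI allI)
    show "0 \<in> J" using mJ ideal_zero_mem[OF is_ideal_max_ideal] by blast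
  next
    fix u v assume "u \<in> J" "v \<in> J"
    then obtain m r m' r' where *: "u = m + r * a" "v = m' + r' * a" "m \<in> max_ideal" "m' \<in> max_ideal"
      unfolding J_def by blast
    then have "m + m' \<in> max_ideal" using ideal_add_mem is_ideal_max_ideal by blast
    moreover have "u + v = (m + m') + (r + r') * a" using * by (simp add: algebra_simps)
    ultimately show "u + v \<in> J" unfolding J_def by blast
  next
    fix s u assume "u \<in> J"
    then obtain m r where *: "u = m + r * a" "m \<in> max_ideal"
      unfolding J_def by blast
    then have "s * m \<in> max_ideal" using ideal_mult_mem is_ideal_max_ideal by blast
    moreover have "s * u = s * m + (s * r) * a" using * by (simp add: algebra_simps)
    ultimately show "s * u \<in> J" unfolding J_def by blast
  qed
  then have "J = UNIV"
    using mJ aJ assms max_ideal unfolding is_maximal_ideal_def by blast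
  then have "1 \<in> J" by simp
  then obtain m r where m: "1 = m + r * a" "m \<in> max_ideal" unfolding J_def by blast
  then have "1 - r * a = m" by (simp add: algebra_simps)
  then have "1 - r * a \<in> max_ideal" using m by simp
  then show ?thesis using ideal_cong_sym[OF is_ideal_max_ideal] by blast
qed

quotient_type (overloaded) 'a residue_field = "'a::local_ring" / "\<lambda>a b. a - b \<in> max_ideal"
  morphisms rep_residue residue
proof (rule equivpI)
  show "reflp (\<lambda>a b::'a. a - b \<in> max_ideal)"
    by (rule reflpI) (simp add: ideal_zero_mem is_ideal_max_ideal)
  show "symp (\<lambda>a b::'a. a - b \<in> max_ideal)"
    by (rule sympI) (rule ideal_cong_sym[OF is_ideal_max_ideal])
  show "transp (\<lambda>a b::'a. a - b \<in> max_ideal)"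
    by (rule transpI) (rule ideal_cong_trans[OF is_ideal_max_ideal])
qed

instantiation residue_field :: (local_ring) comm_ring_1
begin

lift_definition zero_residue_field :: "'a residue_field" is 0 .
lift_definition one_residue_field :: "'a residue_field" is 1 .
lift_definition plus_residue_field :: "'a residue_field \<Rightarrow> 'a residue_field \<Rightarrow> 'a residue_field"
  is "(+)" by (rule ideal_cong_add[OF is_ideal_max_ideal])
lift_definition minus_residue_field :: "'a residue_field \<Rightarrow> 'a residue_field \<Rightarrow> 'a residue_field"
  is "(-)" by (rule ideal_cong_diff[OF is_ideal_max_ideal])
lift_definition uminus_residue_field :: "'a residue_field \<Rightarrow> 'a residue_field"
  is uminus by (rule ideal_cong_uminus[OF is_ideal_max_ideal])
lift_definition times_residue_field :: "'a residue_field \<Rightarrow> 'a residue_field \<Rightarrow> 'a residue_field"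
  is "(*)" by (rule ideal_cong_mult[OF is_ideal_max_ideal])

instance
proof
  fix a b c :: "'a residue_field"
  have eqI: "s - t \<in> max_ideal" if "s = t" for s t :: 'a
    using that by (simp add: ideal_zero_mem is_ideal_max_ideal)
  show "a + b + c = a + (b + c)" by transfer (rule eqI, simp add: algebra_simps)
  show "a + b = b + a" by transfer (rule eqI, simp add: algebra_simps)
  show "0 + a = a" by transfer (rule eqI, simp)
  show "- a + a = 0" by transfer (rule eqI, simp)
  show "a - b = a + - b" by transfer (rule eqI, simp)
  show "a * b * c = a * (b * c)" by transfer (rule eqI, simp add: algebra_simps)
  show "a * b = b * a" by transfer (rule eqI, simp add: algebra_simps)
  show "1 * a = a" by transfer (rule eqI, simp)
  show "(a + b) * c = a * c + b * c" by transfer (rule eqI, simp add: algebra_simps)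
  have "(0::'a) - 1 \<notin> max_ideal"
    using one_notin_max_ideal ideal_cong_sym[OF is_ideal_max_ideal, of 0 1] by (metis diff_zero)
  then show "(0::'a residue_field) \<noteq> 1" by transfer
qed

end

instantiation residue_field :: (local_ring) field
begin

definition inverse_residue_field :: "'a residue_field \<Rightarrow> 'a residue_field" where
  "inverse_residue_field a = (if a = 0 then 0 else (SOME r. r * a = 1))"
definition divide_residue_field :: "'a residue_field \<Rightarrow> 'a residue_field \<Rightarrow> 'a residue_field" where
  "divide_residue_field a b = a * inverse b"

instance
proof
  fix a :: "'a residue_field"
  assume a: "a \<noteq> 0"
  then have "\<exists>r. r * a = 1"
    by transfer (simp add: inverse_mod_max_ideal)
  then have "(SOME r. r * a = 1) * a = 1" by (rule someI_ex)
  then show "inverse a * a = 1" using a by (simp add: inverse_residue_field_def)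
qed (simp_all add: divide_residue_field_def inverse_residue_field_def)

end

definition algebraically_closed :: "'k::field itself \<Rightarrow> bool" where
  "algebraically_closed _ \<longleftrightarrow> (\<forall>p::'k poly. degree p > 0 \<longrightarrow> (\<exists>z. poly p z = 0))"


section \<open>The completion\<close>

text \<open>The inverse limit of the rings \<open>R/\<mm>\<^sup>k\<close>: its elements are represented by sequences of
  representatives \<open>s k\<close> of compatible residue classes modulo \<open>\<mm>\<^sup>k\<close>.\<close>

definition compatible_seq :: "(nat \<Rightarrow> 'a::local_ring) \<Rightarrow> bool" where
  "compatible_seq s \<longleftrightarrow> (\<forall>k. s (Suc k) - s k \<in> ideal_power max_ideal k)"

definition completion_rel :: "(nat \<Rightarrow> 'a::local_ring) \<Rightarrow> (nat \<Rightarrow> 'a) \<Rightarrow> bool" where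
  "completion_rel s t \<longleftrightarrow>
     compatible_seq s \<and> compatible_seq t \<and> (\<forall>k. s k - t k \<in> ideal_power max_ideal k)"

lemma compatible_seq_const: "compatible_seq (\<lambda>_. a)"
  by (simp add: compatible_seq_def ideal_zero_mem is_ideal_power)

lemma completion_rel_refl: "compatible_seq s \<Longrightarrow> completion_rel s s"
  by (simp add: completion_rel_def ideal_zero_mem is_ideal_power)

quotient_type (overloaded) 'a completion = "nat \<Rightarrow> 'a::local_ring" / partial: completion_rel
proof (rule part_equivpI)
  show "\<exists>s::nat \<Rightarrow> 'a. completion_rel s s"
    using completion_rel_refl compatible_seq_const by blast
  show "symp (completion_rel :: (nat \<Rightarrow> 'a) \<Rightarrow> _)"
    by (rule sympI) (auto simp: completion_rel_def intro: ideal_cong_sym[OF is_ideal_power])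
  show "transp (completion_rel :: (nat \<Rightarrow> 'a) \<Rightarrow> _)"
    by (rule transpI) (auto simp: completion_rel_def intro: ideal_cong_trans[OF is_ideal_power])
qed

lemma one_notin_ideal_power_max_ideal: "(1::'a::local_ring) \<notin> ideal_power max_ideal (Suc k)"
proof -
  have "{a * b | a b::'a. a \<in> max_ideal \<and> b \<in> ideal_power max_ideal k} \<subseteq> max_ideal"
  proof clarify
    fix a b :: 'a assume "a \<in> max_ideal"
    then show "a * b \<in> max_ideal"
      using ideal_mult_mem[OF is_ideal_max_ideal, of a b] by (simp add: mult.commute)
  qed
  then have "ideal_power max_ideal (Suc k) \<subseteq> (max_ideal :: 'a set)"
    by (simp add: hull_minimal is_ideal_max_ideal)
  then show ?thesis using one_notin_max_ideal by blast
qed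

lemma compatible_seq_add: "compatible_seq s \<Longrightarrow> compatible_seq t \<Longrightarrow> compatible_seq (\<lambda>k. s k + t k)"
  unfolding compatible_seq_def using ideal_cong_add[OF is_ideal_power] by blast

lemma compatible_seq_uminus: "compatible_seq s \<Longrightarrow> compatible_seq (\<lambda>k. - s k)"
  unfolding compatible_seq_def using ideal_cong_uminus[OF is_ideal_power] by blast

lemma compatible_seq_mult: "compatible_seq s \<Longrightarrow> compatible_seq t \<Longrightarrow> compatible_seq (\<lambda>k. s k * t k)"
  unfolding compatible_seq_def using ideal_cong_mult[OF is_ideal_power] by blast

lemma compatible_seq_diff: "compatible_seq s \<Longrightarrow> compatible_seq t \<Longrightarrow> compatible_seq (\<lambda>k. s k - t k)"
  unfolding compatible_seq_def using ideal_cong_diff[OF is_ideal_power] by blast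

lemmas compatible_seq_intros = compatible_seq_const compatible_seq_add compatible_seq_uminus
  compatible_seq_mult compatible_seq_diff

lemma completion_rel_eqI: "s = t \<Longrightarrow> compatible_seq s \<Longrightarrow> completion_rel s t"
  by (simp add: completion_rel_refl)

instantiation completion :: (local_ring) comm_ring_1
begin

lift_definition zero_completion :: "'a completion" is "\<lambda>_. 0"
  by (intro completion_rel_refl compatible_seq_const)
lift_definition one_completion :: "'a completion" is "\<lambda>_. 1"
  by (intro completion_rel_refl compatible_seq_const)
lift_definition plus_completion :: "'a completion \<Rightarrow> 'a completion \<Rightarrow> 'a completion"
  is "\<lambda>s t k. s k + t k"
  by (auto simp: completion_rel_def compatible_seq_def intro: ideal_cong_add[OF is_ideal_power])
lift_definition minus_completion :: "'a completion \<Rightarrow> 'a completion \<Rightarrow> 'a completion"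
  is "\<lambda>s t k. s k - t k"
  by (auto simp: completion_rel_def compatible_seq_def intro: ideal_cong_diff[OF is_ideal_power])
lift_definition uminus_completion :: "'a completion \<Rightarrow> 'a completion"
  is "\<lambda>s k. - s k"
  unfolding completion_rel_def compatible_seq_def using ideal_cong_uminus[OF is_ideal_power] by blast
lift_definition times_completion :: "'a completion \<Rightarrow> 'a completion \<Rightarrow> 'a completion"
  is "\<lambda>s t k. s k * t k"
  by (auto simp: completion_rel_def compatible_seq_def intro: ideal_cong_mult[OF is_ideal_power])

instance
proof
  fix a b c :: "'a completion"
  show "a + b + c = a + (b + c)"
    by transfer (rule completion_rel_eqI; simp add: completion_rel_def compatible_seq_intros algebra_simps)
  show "a + b = b + a"
    by transfer (rule completion_rel_eqI; simp add: completion_rel_def compatible_seq_intros algebra_simps)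
  show "0 + a = a"
    by transfer (rule completion_rel_eqI; simp add: completion_rel_def)
  show "- a + a = 0"
    by transfer (rule completion_rel_eqI; simp add: completion_rel_def compatible_seq_intros)
  show "a - b = a + - b"
    by transfer (rule completion_rel_eqI; simp add: completion_rel_def compatible_seq_intros)
  show "a * b * c = a * (b * c)"
    by transfer (rule completion_rel_eqI; simp add: completion_rel_def compatible_seq_intros algebra_simps)
  show "a * b = b * a"
    by transfer (rule completion_rel_eqI; simp add: completion_rel_def compatible_seq_intros algebra_simps)
  show "1 * a = a"
    by transfer (rule completion_rel_eqI; simp add: completion_rel_def)
  show "(a + b) * c = a * c + b * c"
    by transfer (rule completion_rel_eqI; simp add: completion_rel_def compatible_seq_intros algebra_simps)
  have "(0::'a) - 1 \<notin> ideal_power max_ideal (Suc 0)"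
    using one_notin_ideal_power_max_ideal[of 0] ideal_cong_sym[OF is_ideal_power, of 0 1] by (metis diff_zero)
  then show "(0::'a completion) \<noteq> 1"
    by transfer (unfold completion_rel_def, blast)
qed

end

lift_definition to_completion :: "'a::local_ring \<Rightarrow> 'a completion" is "\<lambda>a _. a"
  by (intro completion_rel_refl compatible_seq_const)


section \<open>Newton polyhedra\<close>

text \<open>Exponents and polynomials are finitely supported functions: \<open>'n \<Rightarrow>\<^sub>0 nat\<close> is the monoid of
  exponents, and \<open>('n \<Rightarrow>\<^sub>0 nat) \<Rightarrow>\<^sub>0 'k\<close> with its convolution product is the polynomial ring over
  \<open>'k\<close> in the variables indexed by \<open>'n\<close>, in which \<open>single A c\<close> is the term \<open>c X\<^sup>A\<close>.\<close>

type_synonym ('n, 'k) mpoly = "('n \<Rightarrow>\<^sub>0 nat) \<Rightarrow>\<^sub>0 'k"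

definition eval_monomial :: "('n::finite \<Rightarrow> 'a::comm_ring_1) \<Rightarrow> ('n \<Rightarrow>\<^sub>0 nat) \<Rightarrow> 'a" where
  "eval_monomial x A = (\<Prod>i\<in>UNIV. x i ^ Poly_Mapping.lookup A i)"

definition is_expansion ::
    "('n::finite \<Rightarrow> 'a::comm_ring_1) \<Rightarrow> 'a \<Rightarrow> ('n, 'a) mpoly \<Rightarrow> bool" where
  "is_expansion x f \<rho> \<longleftrightarrow>
     (\<forall>A. Poly_Mapping.lookup \<rho> A dvd 1 \<or> Poly_Mapping.lookup \<rho> A = 0) \<and>
     f = (\<Sum>A\<in>Poly_Mapping.keys \<rho>. Poly_Mapping.lookup \<rho> A * eval_monomial x A)"

text \<open>In a regular local ring every \<open>f \<noteq> 0\<close> has an expansion with respect to a regular system of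
  parameters. Expansions are not unique, but the Newton polyhedron and the initial forms below do
  not depend on which one is chosen here.\<close>

definition expansion :: "('n::finite \<Rightarrow> 'a::comm_ring_1) \<Rightarrow> 'a \<Rightarrow> ('n, 'a) mpoly" where
  "expansion x f = (SOME \<rho>. is_expansion x f \<rho>)"

definition real_point :: "('n::finite \<Rightarrow>\<^sub>0 nat) \<Rightarrow> real ^ 'n" where
  "real_point A = (\<chi> i. real (Poly_Mapping.lookup A i))"

definition newton_polyhedron :: "('n::finite \<Rightarrow> 'a::comm_ring_1) \<Rightarrow> 'a \<Rightarrow> (real ^ 'n) set" where
  "newton_polyhedron x f = (\<lambda>C. closed C \<and> convex C) hull
     {real_point A + v | A v. A \<in> Poly_Mapping.keys (expansion x f) \<and> (\<forall>i. 0 \<le> v $ i)}"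

text \<open>The linear form with coefficient vector \<open>l\<close> is \<open>v \<mapsto> l \<bullet> v\<close>.\<close>

definition positive_form :: "real ^ 'n \<Rightarrow> bool" where
  "positive_form l \<longleftrightarrow> (\<forall>i. 0 < l $ i)"

definition determines_face :: "real ^ 'n::finite \<Rightarrow> (real ^ 'n) set \<Rightarrow> (real ^ 'n) set \<Rightarrow> bool" where
  "determines_face l N F \<longleftrightarrow> F = {v \<in> N. \<forall>w\<in>N. l \<bullet> v \<le> l \<bullet> w}"

definition compact_face :: "(real ^ 'n::finite) set \<Rightarrow> (real ^ 'n) set \<Rightarrow> bool" where
  "compact_face N F \<longleftrightarrow> (\<exists>l. positive_form l \<and> determines_face l N F)"

definition compact_edge :: "(real ^ 'n::finite) set \<Rightarrow> (real ^ 'n) set \<Rightarrow> bool" where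
  "compact_edge N F \<longleftrightarrow> compact_face N F \<and> aff_dim F = 1"

definition loose_edge :: "(real ^ 'n::finite) set \<Rightarrow> (real ^ 'n) set \<Rightarrow> bool" where
  "loose_edge N E \<longleftrightarrow> compact_edge N E \<and> \<not> (\<exists>F. compact_face N F \<and> aff_dim F \<ge> 2 \<and> E \<subseteq> F)"

definition initial_form ::
    "('n::finite \<Rightarrow> 'a::local_ring) \<Rightarrow> 'a \<Rightarrow> (real ^ 'n) set \<Rightarrow> ('n, 'a residue_field) mpoly" where
  "initial_form x f F =
     (\<Sum>A | A \<in> Poly_Mapping.keys (expansion x f) \<and> real_point A \<in> F.
        Poly_Mapping.single A (residue (Poly_Mapping.lookup (expansion x f) A)))"

text \<open>The terms on \<open>F\<close> are those on which a form \<open>l\<close> determining \<open>F\<close> attains its minimum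
  \<open>\<nu>\<^sub>l(f)\<close>; in particular their sum does not depend on \<open>l\<close>.\<close>

definition nu :: "real ^ 'n::finite \<Rightarrow> ('n \<Rightarrow> 'a::comm_ring_1) \<Rightarrow> 'a \<Rightarrow> real" where
  "nu l x f = Min ((\<lambda>A. l \<bullet> real_point A) ` Poly_Mapping.keys (expansion x f))"

lemma initial_form_eq_nu:
  fixes x :: "'n::finite \<Rightarrow> 'a::local_ring"
  assumes l: "positive_form l" and F: "determines_face l (newton_polyhedron x f) F"
  shows "initial_form x f F =
    (\<Sum>A | A \<in> Poly_Mapping.keys (expansion x f) \<and> l \<bullet> real_point A = nu l x f.
        Poly_Mapping.single A (residue (Poly_Mapping.lookup (expansion x f) A)))"
proof -
  let ?K = "Poly_Mapping.keys (expansion x f)"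
  let ?S = "{real_point A + v | A v. A \<in> ?K \<and> (\<forall>i. 0 \<le> v $ i)}"
  have nu_le: "nu l x f \<le> l \<bullet> real_point A" if "A \<in> ?K" for A
    unfolding nu_def using that by (intro Min_le) auto
  have "newton_polyhedron x f \<subseteq> {v. l \<bullet> v \<ge> nu l x f}"
    unfolding newton_polyhedron_def
  proof (rule hull_minimal)
    show "closed {v. l \<bullet> v \<ge> nu l x f} \<and> convex {v. l \<bullet> v \<ge> nu l x f}"
      by (simp add: closed_halfspace_ge convex_halfspace_ge)
    show "?S \<subseteq> {v. l \<bullet> v \<ge> nu l x f}"
    proof clarify
      fix A and v :: "real ^ 'n" assume A: "A \<in> ?K" and v: "\<forall>i. 0 \<le> v $ i"
      have "0 \<le> l \<bullet> v"
        unfolding inner_vec_def using v l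
        by (auto simp: positive_form_def less_imp_le intro!: sum_nonneg)
      then show "nu l x f \<le> l \<bullet> (real_point A + v)"
        using nu_le[OF A] by (simp add: inner_add_right)
    qed
  qed
  then have lower: "nu l x f \<le> l \<bullet> v" if "v \<in> newton_polyhedron x f" for v
    using that by auto
  have mem: "real_point A \<in> newton_polyhedron x f" if "A \<in> ?K" for A
  proof -
    have "real_point A \<in> ?S" using that by (intro CollectI exI[of _ A] exI[of _ 0]) auto
    then show ?thesis unfolding newton_polyhedron_def by (rule hull_inc)
  qed
  have "real_point A \<in> F \<longleftrightarrow> l \<bullet> real_point A = nu l x f" if A: "A \<in> ?K" for A
  proof
    assume "real_point A \<in> F"
    then have min: "l \<bullet> real_point A \<le> l \<bullet> w" if "w \<in> newton_polyhedron x f" for w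
      using F that unfolding determines_face_def by auto
    have "nu l x f \<in> (\<lambda>A. l \<bullet> real_point A) ` ?K"
      unfolding nu_def using A by (intro Min_in) auto
    then obtain B where "B \<in> ?K" "nu l x f = l \<bullet> real_point B" by auto
    then show "l \<bullet> real_point A = nu l x f"
      using min[OF mem, of B] nu_le[OF A] by simp
  next
    assume "l \<bullet> real_point A = nu l x f"
    then show "real_point A \<in> F"
      using F lower mem[OF A] unfolding determines_face_def by auto
  qed
  then show ?thesis
    unfolding initial_form_def by (intro sum.cong) auto
qed

definition primitive_vector :: "int ^ 'n \<Rightarrow> bool" where
  "primitive_vector v \<longleftrightarrow> v \<noteq> 0 \<and> Gcd (range (\<lambda>i. v $ i)) = 1"

definition exponent_diff :: "('n::finite \<Rightarrow>\<^sub>0 nat) \<Rightarrow> ('n \<Rightarrow>\<^sub>0 nat) \<Rightarrow> int ^ 'n" where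
  "exponent_diff A B = (\<chi> i. int (Poly_Mapping.lookup A i) - int (Poly_Mapping.lookup B i))"

end

theory Submission
  imports Defs
begin

text \<open>Let \<open>w\<close> be the primitive direction of the loose edge, with end points \<open>A\<^sub>0\<close> and \<open>A\<^sub>0 + d w\<close>.
  Looseness forces the whole support of \<open>f\<close> into \<open>A\<^sub>0 + \<real> w + \<real>\<^sub>\<ge>\<^sub>0\<^sup>n\<close>: otherwise a form determining
  the edge could be tilted, keeping it constant on the edge, until a face of dimension at least 2
  contains the edge. Write the initial form as \<open>X\<^sup>\<gamma> q(X\<^sup>\<alpha>, X\<^sup>\<beta>)\<close> with \<open>w = \<alpha> - \<beta>\<close> and \<open>q\<close> a binary
  form of degree \<open>d\<close>. Every lattice line parallel to \<open>w\<close> through the region above then has enough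
  points in \<open>\<nat>\<^sup>n\<close> to solve \<open>x\<^sup>A = G U + H V\<close> for coprime factors \<open>G\<close>, \<open>H\<close> of the initial form, so that
  Hensel's argument lifts such a factorization to the completion. Irreducibility of \<open>f\<close> therefore
  gives \<open>\<gamma> = 0\<close>, whence the edge is the only one, and makes \<open>q\<close> a power of an irreducible
  polynomial \<open>p\<close>. Since \<open>w\<close> is primitive, the homogenization of \<open>p\<close> in \<open>X\<^sup>\<alpha>\<close>, \<open>X\<^sup>\<beta>\<close> stays irreducible.\<close>

section \<open>Ideals of Noetherian local rings\<close>

text \<open>With negative exponents allowed, \<open>X^w\<close> would be a single invertible
  variable \<open>t\<close>, and lifting coprime factors would be the classical Hensel lemma. The
  obstacle is that exponents must stay non-negative: \<open>w\<close> has entries of both signs, so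
  a line in direction \<open>w\<close> meets the orthant in a finite segment only, and the cofactors
  in \<open>t^P = g u + h v\<close> must fit into it. Reducing \<open>u\<close> modulo
  \<open>h\<close> makes \<open>degree g + degree h\<close> consecutive points suffice, which is
  what the region above the edge provides. Moreover \<open>R\<close> need not contain a field, so
  identities between coefficients hold only modulo \<open>max_ideal\<close>; an integral positive
  form \<open>level\<close> vanishing on \<open>w\<close> turns each such defect into a gain of one
  level, and high level means high order with respect to \<open>max_ideal\<close>. The monomial
  \<open>X^\<gamma>\<close> is attached entirely to the factor \<open>g\<close>, so that
  \<open>g = 1\<close> covers the splitting off of \<open>X^\<gamma>\<close> alone. Since
  \<open>expansion\<close> is a mere choice and \<open>R\<close> need not be complete, the existence
  of finite expansions has to be proved first, through Krull's intersection theorem.\<close>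

lemma ideal_sum_mem:
  assumes "is_ideal I" "\<And>k. k \<in> K \<Longrightarrow> a k \<in> I"
  shows "sum a K \<in> I"
  using assms(2) by (induction K rule: infinite_finite_induct)
    (auto intro: ideal_zero_mem ideal_add_mem assms(1))

text \<open>Generators suffice because \<open>{u. u * v \<in> I}\<close> is an ideal; this is
  applied to one factor after the other.\<close>

lemma hull_mult_mem:
  fixes a b :: "'a::comm_ring_1"
  assumes "a \<in> is_ideal hull S" "b \<in> is_ideal hull T"
    and "\<And>s t. s \<in> S \<Longrightarrow> t \<in> T \<Longrightarrow> s * t \<in> I" and I: "is_ideal I"
  shows "a * b \<in> I"
proof -
  have ideal_colon: "is_ideal {u. u * v \<in> I}" for v
    using I by (auto simp: is_ideal_def distrib_right mult.assoc)
  have *: "a * t \<in> I" if "t \<in> T" for t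
    using assms(1) by (rule hull_induct) (use assms(3) that ideal_colon in auto)
  have "b \<in> {u. u * a \<in> I}"
    using hull_minimal[of T "{u. u * a \<in> I}" is_ideal] ideal_colon[of a] * assms(2)
    by (auto simp: mult.commute[of a])
  then show ?thesis by (simp add: mult.commute)
qed

text \<open>Used with \<open>M = UNIV\<close> to write elements of powers of the maximal ideal as
  combinations of power products, and with \<open>M = max_ideal\<close> to obtain coefficients that
  can be added to units without destroying them.\<close>

lemma ideal_hull_sum_repr:
  fixes e :: "'i \<Rightarrow> 'a::comm_ring_1"
  assumes I: "finite I" and M: "is_ideal M"
    and a: "a \<in> is_ideal hull {m * e i | m i. m \<in> M \<and> i \<in> I}"
  shows "\<exists>c. (\<forall>i. c i \<in> M) \<and> a = (\<Sum>i\<in>I. c i * e i)"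
proof -
  let ?X = "{a. \<exists>c. (\<forall>i. c i \<in> M) \<and> a = (\<Sum>i\<in>I. c i * e i)}"
  have "is_ideal ?X"
    unfolding is_ideal_def
  proof (intro conjI ballI allI)
    show "0 \<in> ?X" using ideal_zero_mem[OF M] by (intro CollectI exI[of _ "\<lambda>_. 0"]) auto
  next
    fix u v assume "u \<in> ?X" "v \<in> ?X"
    then obtain c d where c: "\<forall>i. c i \<in> M" "u = (\<Sum>i\<in>I. c i * e i)"
      and d: "\<forall>i. d i \<in> M" "v = (\<Sum>i\<in>I. d i * e i)" by blast
    then show "u + v \<in> ?X" using ideal_add_mem[OF M]
      by (intro CollectI exI[of _ "\<lambda>i. c i + d i"]) (auto simp: sum.distrib distrib_right)
  next
    fix r u assume "u \<in> ?X"
    then obtain c where c: "\<forall>i. c i \<in> M" "u = (\<Sum>i\<in>I. c i * e i)" by blast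
    then show "r * u \<in> ?X" using ideal_mult_mem[OF M]
      by (intro CollectI exI[of _ "\<lambda>i. r * c i"]) (auto simp: sum_distrib_left mult.assoc)
  qed
  moreover have "{m * e i | m i. m \<in> M \<and> i \<in> I} \<subseteq> ?X"
  proof clarify
    fix m i assume "m \<in> M" "i \<in> I"
    then show "\<exists>c. (\<forall>i. c i \<in> M) \<and> m * e i = (\<Sum>i\<in>I. c i * e i)"
      using ideal_zero_mem[OF M] I
      by (intro exI[of _ "\<lambda>j. if j = i then m else 0"])
         (auto simp: if_distrib[of "\<lambda>z. z * _"] cong: if_cong)
  qed
  ultimately show ?thesis using hull_minimal[of _ ?X is_ideal] a by blast
qed

text \<open>The union of a chain is generated by finitely many elements, and these already lie in
  one member of the chain, so Zorn's lemma applies.\<close>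

lemma noetherian_maximal:
  fixes \<F> :: "'a::comm_ring_1 set set"
  assumes noeth: "noetherian TYPE('a)" and ne: "\<F> \<noteq> {}" and id: "\<And>I. I \<in> \<F> \<Longrightarrow> is_ideal I"
  shows "\<exists>M\<in>\<F>. \<forall>I\<in>\<F>. M \<subseteq> I \<longrightarrow> I = M"
proof (rule subset_Zorn_nonempty[OF ne])
  fix \<C> assume C: "\<C> \<noteq> {}" "subset.chain \<F> \<C>"
  then have lin: "X \<subseteq> Y \<or> Y \<subseteq> X" if "X \<in> \<C>" "Y \<in> \<C>" for X Y
    using that unfolding subset.chain_def by blast+
  have sub: "\<C> \<subseteq> \<F>" using C unfolding subset.chain_def by blast
  have "is_ideal (\<Union>\<C>)"
    unfolding is_ideal_def
  proof (intro conjI ballI allI)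
    show "0 \<in> \<Union>\<C>" using C id sub ideal_zero_mem by blast
  next
    fix a b assume "a \<in> \<Union>\<C>" "b \<in> \<Union>\<C>"
    then obtain X Y where "X \<in> \<C>" "a \<in> X" "Y \<in> \<C>" "b \<in> Y" by blast
    then obtain Z where "Z \<in> \<C>" "a \<in> Z" "b \<in> Z" using lin by blast
    then show "a + b \<in> \<Union>\<C>" using id sub ideal_add_mem by blast
  next
    fix r a assume "a \<in> \<Union>\<C>"
    then show "r * a \<in> \<Union>\<C>" using id sub ideal_mult_mem by blast
  qed
  then obtain S where S: "finite S" "\<Union>\<C> = ideal_generated S"
    using noeth unfolding noetherian_def by blast
  have "S \<subseteq> \<Union>\<C>" using S by (simp add: hull_subset)
  from S(1) this have "\<exists>X\<in>\<C>. S \<subseteq> X"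
  proof (induction S)
    case empty
    then show ?case using C by blast
  next
    case (insert s S)
    then obtain X Y where "X \<in> \<C>" "S \<subseteq> X" "Y \<in> \<C>" "s \<in> Y" by auto
    then show ?case using lin[of X Y] by blast
  qed
  then obtain X where X: "X \<in> \<C>" "S \<subseteq> X" by blast
  then have "\<Union>\<C> \<subseteq> X" using S id sub hull_minimal[of S X is_ideal] by blast
  then have "\<Union>\<C> = X" using X by blast
  then show "\<Union>\<C> \<in> \<F>" using X sub by auto
qed

lemma ideal_principal_sum:
  fixes I :: "'a::comm_ring_1 set"
  assumes "is_ideal I"
  shows "is_ideal {i + r * y | i r. i \<in> I}"
  unfolding is_ideal_def
proof (intro conjI ballI allI)
  show "0 \<in> {i + r * y | i r. i \<in> I}"
    using ideal_zero_mem[OF assms] by (intro CollectI exI[of _ 0]) auto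
next
  fix a b assume "a \<in> {i + r * y | i r. i \<in> I}" "b \<in> {i + r * y | i r. i \<in> I}"
  then obtain i r j s where *: "a = i + r * y" "b = j + s * y" "i \<in> I" "j \<in> I" by blast
  then have "a + b = (i + j) + (r + s) * y" "i + j \<in> I"
    using ideal_add_mem[OF assms] by (auto simp: algebra_simps)
  then show "a + b \<in> {i + r * y | i r. i \<in> I}" by blast
next
  fix t a assume "a \<in> {i + r * y | i r. i \<in> I}"
  then obtain i r where *: "a = i + r * y" "i \<in> I" by blast
  then have "t * a = t * i + (t * r) * y" "t * i \<in> I"
    using ideal_mult_mem[OF assms] by (auto simp: algebra_simps)
  then show "t * a \<in> {i + r * y | i r. i \<in> I}" by blast
qed

lemma mem_ideal_principal_sum:
  fixes I :: "'a::comm_ring_1 set"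
  assumes "is_ideal I"
  shows "I \<subseteq> {i + r * y | i r. i \<in> I}" "y \<in> {i + r * y | i r. i \<in> I}"
proof
  fix i assume "i \<in> I"
  then show "i \<in> {i + r * y | i r. i \<in> I}" by (intro CollectI exI[of _ i] exI[of _ 0]) auto
next
  show "y \<in> {i + r * y | i r. i \<in> I}"
    using ideal_zero_mem[OF assms] by (intro CollectI exI[of _ 0] exI[of _ 1]) auto
qed

text \<open>The class \<open>local_ring\<close> only provides a unique maximal ideal. A non-unit
  \<open>a\<close> lies in it because an ideal maximal among those containing \<open>a\<close> but
  not 1 exists by \<open>noetherian_maximal\<close> and is a maximal ideal.\<close>

lemma unit_iff_notin_max_ideal:
  fixes a :: "'a::local_ring"
  assumes "noetherian TYPE('a)"
  shows "a dvd 1 \<longleftrightarrow> a \<notin> max_ideal"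
proof
  assume "a dvd 1"
  then obtain b where "1 = b * a" by (metis dvdE mult.commute)
  then show "a \<notin> max_ideal"
    using ideal_mult_mem[OF is_ideal_max_ideal, of a b] one_notin_max_ideal by auto
next
  assume a: "a \<notin> max_ideal"
  show "a dvd 1"
  proof (rule ccontr)
    assume nd: "\<not> a dvd 1"
    let ?F = "{I::'a set. is_ideal I \<and> a \<in> I \<and> 1 \<notin> I}"
    have "{b. a dvd b} \<in> ?F" using nd by (auto simp: is_ideal_def)
    then obtain M where M: "M \<in> ?F" "\<forall>I\<in>?F. M \<subseteq> I \<longrightarrow> I = M"
      using noetherian_maximal[OF assms, of ?F] by blast
    have "is_maximal_ideal M"
      unfolding is_maximal_ideal_def
    proof (intro conjI allI impI)
      fix I assume I: "is_ideal I \<and> M \<subseteq> I"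
      show "I = M \<or> I = UNIV"
      proof (cases "1 \<in> I")
        case True
        then have "r \<in> I" for r using I ideal_mult_mem[of I 1 r] by simp
        then show ?thesis by blast
      qed (use I M in blast)
    qed (use M in auto)
    then have "M = max_ideal" using unique_maximal_ideal max_ideal by blast
    then show False using a M by blast
  qed
qed

section \<open>Powers of an ideal in terms of monomials in its generators, and Krull's intersection
  theorem\<close>

lemma ideal_power_subset: "ideal_power (I :: 'a::comm_ring_1 set) (Suc k) \<subseteq> ideal_power I k"
  unfolding ideal_power.simps
  by (rule hull_minimal) (auto intro: ideal_mult_mem is_ideal_power)

lemma ideal_power_antimono: "j \<le> k \<Longrightarrow> ideal_power (I :: 'a::comm_ring_1 set) k \<subseteq> ideal_power I j"
  by (rule lift_Suc_antimono_le[of "ideal_power I"]) (rule ideal_power_subset)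

definition power_product :: "('n::finite \<Rightarrow> 'a::comm_ring_1) \<Rightarrow> ('n \<Rightarrow> nat) \<Rightarrow> 'a" where
  "power_product x a = (\<Prod>i\<in>UNIV. x i ^ a i)"

lemma power_product_add: "power_product x (\<lambda>i. a i + b i) = power_product x a * power_product x b"
  by (simp add: power_product_def power_add prod.distrib)

lemma power_product_unit: "power_product x (\<lambda>j. if j = i then 1 else 0) = x i"
  by (simp add: power_product_def if_distrib[of "\<lambda>n. _ ^ n"] cong: if_cong)

lemma sum_eq_Suc_decompose:
  fixes a :: "'n::finite \<Rightarrow> nat"
  assumes "sum a UNIV = Suc k"
  shows "\<exists>i b. a = (\<lambda>j. (if j = i then 1 else 0) + b j) \<and> sum b UNIV = k"
proof -
  obtain i where i: "a i > 0" using assms by (metis neq0_conv sum.neutral nat.simps(3))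
  let ?b = "\<lambda>j. a j - (if j = i then 1 else 0)"
  have eq: "a = (\<lambda>j. (if j = i then 1 else 0) + ?b j)" using i by auto
  have "sum a UNIV = sum (\<lambda>j. (if j = i then 1 else 0)) UNIV + sum ?b UNIV"
    by (subst eq) (simp only: sum.distrib)
  then have "sum ?b UNIV = k" using assms by simp
  then show ?thesis using eq by (intro exI[of _ i] exI[of _ ?b]) (rule conjI)
qed

lemma ideal_power_eq_power_products:
  fixes x :: "'n::finite \<Rightarrow> 'a::comm_ring_1"
  assumes I: "is_ideal hull (range x) = I"
  shows "ideal_power I k = is_ideal hull {power_product x a | a. sum a UNIV = k}"
proof (induction k)
  case 0
  have "{power_product x a | a :: 'n \<Rightarrow> nat. sum a UNIV = 0} = {1}"
    by (auto simp: power_product_def intro!: exI[of _ "\<lambda>_. 0"])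
  moreover have "is_ideal hull {1} = (UNIV :: 'a set)"
  proof -
    have "r \<in> is_ideal hull {1}" for r :: 'a
      using ideal_mult_mem[OF is_ideal_hull hull_inc, of 1 "{1}" r] by simp
    then show ?thesis by blast
  qed
  ultimately show ?case by simp
next
  case (Suc k)
  let ?P = "\<lambda>k. {power_product x a | a :: 'n \<Rightarrow> nat. sum a UNIV = k}"
  show ?case
  proof
    show "ideal_power I (Suc k) \<subseteq> is_ideal hull ?P (Suc k)"
      unfolding ideal_power.simps
    proof (rule hull_minimal)
      show "{a * b | a b. a \<in> I \<and> b \<in> ideal_power I k} \<subseteq> is_ideal hull ?P (Suc k)"
      proof clarify
        fix a b assume "a \<in> I" "b \<in> ideal_power I k"
        then have "a \<in> is_ideal hull range x" "b \<in> is_ideal hull ?P k" using Suc I by auto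
        then show "a * b \<in> is_ideal hull ?P (Suc k)"
        proof (rule hull_mult_mem)
          fix s t assume "s \<in> range x" "t \<in> ?P k"
          then obtain i c where "s = x i" "t = power_product x c" "sum c UNIV = k" by blast
          then have "s * t = power_product x (\<lambda>j. (if j = i then 1 else 0) + c j)"
            "sum (\<lambda>j. (if j = i then 1 else 0) + c j) UNIV = Suc k"
            by (simp_all add: power_product_add power_product_unit sum.distrib)
          then show "s * t \<in> is_ideal hull ?P (Suc k)" by (intro hull_inc) blast
        qed (rule is_ideal_hull)
      qed
    qed (rule is_ideal_hull)
    show "is_ideal hull ?P (Suc k) \<subseteq> ideal_power I (Suc k)"
    proof (rule hull_minimal)
      show "?P (Suc k) \<subseteq> ideal_power I (Suc k)"
      proof clarify
        fix a :: "'n \<Rightarrow> nat" assume "sum a UNIV = Suc k"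
        then obtain i b where ab: "a = (\<lambda>j. (if j = i then 1 else 0) + b j)" "sum b UNIV = k"
          using sum_eq_Suc_decompose by blast
        have "x i \<in> I" "power_product x b \<in> ideal_power I k"
          using I Suc ab by (auto intro!: hull_inc)
        then show "power_product x a \<in> ideal_power I (Suc k)"
          unfolding ab(1) power_product_add power_product_unit ideal_power.simps
          by (intro hull_inc) blast
      qed
    qed (rule is_ideal_power)
  qed
qed

text \<open>Pigeonhole: an exponent \<open>a\<close> of total degree \<open>Suc (sum j UNIV)\<close>
  has an entry with \<open>j i \<le> a i\<close>.\<close>

lemma ideal_power_subset_if_generators_nilpotent:
  fixes x :: "'n::finite \<Rightarrow> 'a::comm_ring_1"
  assumes "is_ideal hull (range x) = I" "is_ideal K" "\<And>i. \<exists>j. x i ^ j \<in> K"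
  shows "\<exists>k. ideal_power I k \<subseteq> K"
proof -
  obtain j where j: "x i ^ j i \<in> K" for i using assms(3) by metis
  have "power_product x a \<in> K" if "sum a UNIV = Suc (sum j UNIV)" for a
  proof -
    obtain i where "j i \<le> a i"
    proof (rule ccontr)
      assume "\<not> thesis"
      then have "a i \<le> j i" for i using that nat_le_linear by blast
      then have "sum a UNIV \<le> sum j UNIV" by (intro sum_mono)
      then show False using \<open>sum a UNIV = _\<close> by simp
    qed
    then have "x i ^ a i = x i ^ (a i - j i) * x i ^ j i" by (simp flip: power_add)
    then have "power_product x a = (x i ^ (a i - j i) * (\<Prod>i\<in>UNIV-{i}. x i ^ a i)) * x i ^ j i"
      unfolding power_product_def by (subst prod.remove[of _ i]) (simp_all add: mult_ac)
    then show ?thesis using ideal_mult_mem[OF assms(2) j] by simp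
  qed
  then show ?thesis
    unfolding ideal_power_eq_power_products[OF assms(1)]
    by (intro exI[of _ "Suc (sum j UNIV)"] hull_minimal assms(2)) blast
qed

text \<open>For \<open>K\<close> maximal among the ideals meeting \<open>D\<close> in \<open>E\<close>: the chain of ideals \<open>K : y\<^sup>j\<close> becomes
  stationary, and for such \<open>j\<close> the ideal \<open>K + (y\<^sup>j)\<close> still meets \<open>D\<close> in \<open>E\<close>.\<close>

lemma power_mem_of_maximal_intersection:
  fixes y :: "'a::comm_ring_1"
  assumes noeth: "noetherian TYPE('a)" and D: "is_ideal D" and K: "is_ideal K" "K \<inter> D = E"
    and max: "\<And>I. is_ideal I \<Longrightarrow> I \<inter> D = E \<Longrightarrow> K \<subseteq> I \<Longrightarrow> I = K"
    and y: "\<And>z. z \<in> D \<Longrightarrow> y * z \<in> E"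
  shows "\<exists>j. y ^ j \<in> K"
proof -
  have colon: "is_ideal {r. r * y ^ j \<in> K}" for j
    using K(1) by (auto simp: is_ideal_def distrib_right mult.assoc)
  let ?F = "range (\<lambda>j. {r. r * y ^ j \<in> K})"
  obtain M where M: "M \<in> ?F" and M_max: "\<forall>I\<in>?F. M \<subseteq> I \<longrightarrow> I = M"
    using noetherian_maximal[OF noeth, of ?F] colon by blast
  then obtain j where j: "M = {r. r * y ^ j \<in> K}" by blast
  have "r * y ^ Suc j \<in> K" if "r * y ^ j \<in> K" for r
    using ideal_mult_mem[OF K(1) that, of y] by (simp add: mult_ac)
  then have "{r. r * y ^ j \<in> K} \<subseteq> {r. r * y ^ Suc j \<in> K}" by blast
  then have "{r. r * y ^ Suc j \<in> K} = {r. r * y ^ j \<in> K}"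
    using M_max unfolding j by blast
  then have stable: "r * y ^ Suc j \<in> K \<Longrightarrow> r * y ^ j \<in> K" for r by blast
  let ?K = "{k + r * y ^ j | k r. k \<in> K}"
  have "?K \<inter> D = E"
  proof
    show "?K \<inter> D \<subseteq> E"
    proof clarify
      fix k r assume k: "k \<in> K" and z: "k + r * y ^ j \<in> D"
      have "y * (k + r * y ^ j) \<in> K" using y[OF z] K(2) by blast
      then have "y * (k + r * y ^ j) - y * k \<in> K" using k K(1) by (metis is_ideal_diff ideal_mult_mem)
      moreover have "y * (k + r * y ^ j) - y * k = r * y ^ Suc j" by (simp add: algebra_simps)
      ultimately have "r * y ^ j \<in> K" using stable by simp
      then have "k + r * y ^ j \<in> K" using k K(1) ideal_add_mem by blast
      then show "k + r * y ^ j \<in> E" using z K(2) by blast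
    qed
    show "E \<subseteq> ?K \<inter> D" using K(2) mem_ideal_principal_sum(1)[OF K(1)] by blast
  qed
  then have "?K = K"
    using max[OF ideal_principal_sum[OF K(1)] _ mem_ideal_principal_sum(1)[OF K(1)]] by blast
  then show ?thesis using mem_ideal_principal_sum(2)[OF K(1), of "y ^ j"] by blast
qed

text \<open>Choose \<open>I\<close> maximal among the ideals with
  \<open>J \<subseteq> I \<subset> D\<close>, and \<open>z\<close> in \<open>D\<close> outside
  \<open>I\<close>. Then \<open>D\<close> is \<open>I\<close> plus the multiples of
  \<open>z\<close>, so \<open>gen\<close> yields \<open>z = i + m * z\<close> with \<open>m\<close>
  in \<open>max_ideal\<close>; as \<open>1 - m\<close> is a unit, \<open>z\<close> lies in
  \<open>I\<close> after all.\<close>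

lemma nakayama:
  fixes D J :: "'a::local_ring set"
  assumes noeth: "noetherian TYPE('a)" and D: "is_ideal D" and J: "is_ideal J" "J \<subseteq> D"
    and gen: "D \<subseteq> is_ideal hull ({m * z | m z. m \<in> max_ideal \<and> z \<in> D} \<union> J)"
  shows "D = J"
proof (rule ccontr)
  assume "D \<noteq> J"
  let ?F = "{I. is_ideal I \<and> J \<subseteq> I \<and> I \<subset> D}"
  have ne: "?F \<noteq> {}" using J \<open>D \<noteq> J\<close> by blast
  have "\<exists>M\<in>?F. \<forall>X\<in>?F. M \<subseteq> X \<longrightarrow> X = M"
    by (rule noetherian_maximal[OF noeth ne]) simp
  then obtain I where I: "I \<in> ?F" and I_max: "\<forall>X\<in>?F. I \<subseteq> X \<longrightarrow> X = I" ..
  have Ii: "is_ideal I" and JI: "J \<subseteq> I" and "I \<subset> D" using I by simp_all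
  then obtain z where z: "z \<in> D" "z \<notin> I" by auto
  let ?X = "{i + r * z | i r. i \<in> I}"
  have "i + r * z \<in> D" if "i \<in> I" for i r
    using \<open>I \<subset> D\<close> z(1) that by (intro ideal_add_mem[OF D] ideal_mult_mem[OF D]) auto
  then have XD: "?X \<subseteq> D" by blast
  have IX: "I \<subseteq> ?X" and zX: "z \<in> ?X" using mem_ideal_principal_sum[OF Ii] .
  have XD: "?X = D"
  proof (rule ccontr)
    assume "?X \<noteq> D"
    with XD have "?X \<subset> D" by (rule psubsetI)
    then have "?X \<in> ?F" using JI IX ideal_principal_sum[OF Ii] by (intro CollectI conjI) auto
    then have "I \<subseteq> ?X \<longrightarrow> ?X = I" by (rule bspec[OF I_max])
    then have "?X = I" using IX by (rule mp)
    then show False using z(2) zX by simp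
  qed
  let ?Y = "{d. \<exists>m i. m \<in> max_ideal \<and> i \<in> I \<and> d = i + m * z}"
  have "is_ideal ?Y"
    unfolding is_ideal_def
  proof (intro conjI ballI allI)
    show "0 \<in> ?Y" using ideal_zero_mem[OF Ii] ideal_zero_mem[OF is_ideal_max_ideal]
      by (intro CollectI exI[of _ 0]) auto
  next
    fix a b assume "a \<in> ?Y" "b \<in> ?Y"
    then obtain m i n j where *: "a = i + m * z" "b = j + n * z" "i \<in> I" "j \<in> I"
      "m \<in> max_ideal" "n \<in> max_ideal" by blast
    then have "a + b = (i + j) + (m + n) * z" "i + j \<in> I" "m + n \<in> max_ideal"
      using ideal_add_mem[OF Ii] ideal_add_mem[OF is_ideal_max_ideal] by (auto simp: algebra_simps)
    then show "a + b \<in> ?Y" by blast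
  next
    fix r a assume "a \<in> ?Y"
    then obtain m i where *: "a = i + m * z" "i \<in> I" "m \<in> max_ideal" by blast
    then have "r * a = r * i + (r * m) * z" "r * i \<in> I" "r * m \<in> max_ideal"
      using ideal_mult_mem[OF Ii] ideal_mult_mem[OF is_ideal_max_ideal] by (auto simp: algebra_simps)
    then show "r * a \<in> ?Y" by blast
  qed
  moreover have "{m * d | m d. m \<in> max_ideal \<and> d \<in> D} \<union> J \<subseteq> ?Y"
  proof
    fix u assume u: "u \<in> {m * d | m d. m \<in> max_ideal \<and> d \<in> D} \<union> J"
    from u show "u \<in> ?Y"
    proof
      assume "u \<in> J"
      then show ?thesis using JI ideal_zero_mem[OF is_ideal_max_ideal]
        by (intro CollectI exI[of _ 0] exI[of _ u]) auto
    next
      assume "u \<in> {m * d | m d. m \<in> max_ideal \<and> d \<in> D}"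
      then obtain m i r where *: "u = m * (i + r * z)" "m \<in> max_ideal" "i \<in> I" unfolding XD[symmetric] by blast
      then have "u = m * i + (r * m) * z" "m * i \<in> I" "r * m \<in> max_ideal"
        using ideal_mult_mem[OF Ii] ideal_mult_mem[OF is_ideal_max_ideal] by (auto simp: algebra_simps)
      then show ?thesis by blast
    qed
  qed
  ultimately have "D \<subseteq> ?Y" using gen hull_minimal[of _ ?Y is_ideal] by blast
  then obtain m i where mi: "m \<in> max_ideal" "i \<in> I" "z = i + m * z" using z by blast
  have "1 - m \<notin> max_ideal"
    using mi(1) one_notin_max_ideal ideal_add_mem[OF is_ideal_max_ideal, of "1 - m" m] by auto
  then obtain r where r: "r * (1 - m) = 1"
    using unit_iff_notin_max_ideal[OF noeth] by (metis dvdE mult.commute)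
  have "(1 - m) * z = i" using mi(3) by (simp add: left_diff_distrib) (metis add_diff_cancel_right')
  then have "z = r * i" using r by (metis mult.assoc mult_1)
  then show False using z mi(2) ideal_mult_mem[OF Ii] by blast
qed

text \<open>Let \<open>D\<close> be the closure of \<open>J\<close>, \<open>E\<close> the ideal
  generated by \<open>max_ideal * D\<close> and \<open>J\<close>, and \<open>K\<close> maximal with
  \<open>K \<inter> D = E\<close>. By \<open>power_mem_of_maximal_intersection\<close> some power of
  \<open>max_ideal\<close> lies in \<open>K\<close>; elements of \<open>D\<close> are congruent to
  elements of \<open>J\<close> modulo that power, so \<open>D \<subseteq> K\<close>, hence
  \<open>D = E\<close>, and Nakayama gives \<open>D = J\<close>.\<close>

theorem krull_intersection:
  fixes x :: "'n::finite \<Rightarrow> 'a::local_ring"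
  assumes noeth: "noetherian TYPE('a)" and gen: "is_ideal hull (range x) = max_ideal"
    and J: "is_ideal (J :: 'a set)" and b: "\<And>d. \<exists>j\<in>J. b - j \<in> ideal_power max_ideal d"
  shows "b \<in> J"
proof -
  let ?m = "max_ideal :: 'a set"
  define D where "D = {b :: 'a. \<forall>d. \<exists>j\<in>J. b - j \<in> ideal_power ?m d}"
  have D: "is_ideal D"
    unfolding is_ideal_def
  proof (intro conjI ballI allI)
    show "0 \<in> D" unfolding D_def
      using ideal_zero_mem[OF J] ideal_zero_mem[OF is_ideal_power] by force
  next
    fix u v assume uv: "u \<in> D" "v \<in> D"
    show "u + v \<in> D" unfolding D_def
    proof (intro CollectI allI)
      fix d
      obtain j k where "j \<in> J" "u - j \<in> ideal_power ?m d" "k \<in> J" "v - k \<in> ideal_power ?m d"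
        using uv unfolding D_def by blast
      then show "\<exists>j\<in>J. u + v - j \<in> ideal_power ?m d"
        using ideal_cong_add[OF is_ideal_power] ideal_add_mem[OF J] by blast
    qed
  next
    fix r u assume u: "u \<in> D"
    show "r * u \<in> D" unfolding D_def
    proof (intro CollectI allI)
      fix d
      obtain j where "j \<in> J" "u - j \<in> ideal_power ?m d"
        using u unfolding D_def by blast
      then show "\<exists>j\<in>J. r * u - j \<in> ideal_power ?m d"
        using ideal_mult_mem[OF is_ideal_power, of "u - j" ?m d r] ideal_mult_mem[OF J, of j r]
        by (metis right_diff_distrib)
    qed
  qed
  have JD: "J \<subseteq> D"
    using ideal_zero_mem[OF is_ideal_power] unfolding D_def by (auto intro!: bexI[rotated])
  define E where "E = is_ideal hull ({m * z | m z. m \<in> ?m \<and> z \<in> D} \<union> J)"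
  have E: "is_ideal E" unfolding E_def by (rule is_ideal_hull)
  have ED: "E \<subseteq> D"
    unfolding E_def using JD ideal_mult_mem[OF D] D by (intro hull_minimal) auto
  let ?F = "{K. is_ideal K \<and> K \<inter> D = E}"
  have "E \<in> ?F" using E ED by blast
  then obtain K where K: "K \<in> ?F" and K_max: "\<forall>I\<in>?F. K \<subseteq> I \<longrightarrow> I = K"
    using noetherian_maximal[OF noeth, of ?F] by blast
  have xm: "x i \<in> ?m" for i using gen by (metis hull_inc rangeI)
  have "\<exists>j. x i ^ j \<in> K" for i
  proof (rule power_mem_of_maximal_intersection[OF noeth D])
    show "x i * z \<in> E" if "z \<in> D" for z
      unfolding E_def using xm that by (intro hull_inc) blast
  qed (use K K_max in auto)
  then obtain k where k: "ideal_power ?m k \<subseteq> K"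
    using ideal_power_subset_if_generators_nilpotent[OF gen] K by blast
  have "D \<subseteq> K"
  proof
    fix u assume "u \<in> D"
    then obtain j where j: "j \<in> J" "u - j \<in> ideal_power ?m k" unfolding D_def by blast
    have "j \<in> E" unfolding E_def using j(1) by (intro hull_inc) blast
    then have "j \<in> K" using K by blast
    then have "(u - j) + j \<in> K" using j k K ideal_add_mem by blast
    then show "u \<in> K" by simp
  qed
  then have "D \<subseteq> E" using K by blast
  then have "D = J" using nakayama[OF noeth D J JD] unfolding E_def by blast
  then show ?thesis using b unfolding D_def by blast
qed

section \<open>Existence of expansions\<close>

lemma nat_seq_mono_subseq:
  fixes s :: "nat \<Rightarrow> nat"
  shows "\<exists>r :: nat \<Rightarrow> nat. strict_mono r \<and> mono (\<lambda>k. s (r k))"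
proof -
  obtain r :: "nat \<Rightarrow> nat" where r: "strict_mono r" "monoseq (\<lambda>k. s (r k))" using seq_monosub by blast
  show ?thesis
  proof (cases "mono (\<lambda>k. s (r k))")
    case False
    with r(2) have dec: "s (r n) \<le> s (r m)" if "m \<le> n" for m n
      using that unfolding monoseq_def mono_def by blast
    obtain N where N: "\<And>k. s (r N) \<le> s (r k)"
      using ex_has_least_nat[of "\<lambda>_. True" _ "\<lambda>k. s (r k)"] by blast
    have "s (r (N + k)) = s (r N)" for k using N[of "N + k"] dec[of N "N + k"] by simp
    moreover have "strict_mono (\<lambda>k. r (N + k))" using r(1) by (simp add: strict_mono_def)
    ultimately show ?thesis by (intro exI[of _ "\<lambda>k. r (N + k)"]) (simp add: mono_def)
  qed (use r in blast)
qed

lemma dickson_mono_subseq: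
  fixes s :: "nat \<Rightarrow> 'n \<Rightarrow> nat"
  assumes "finite I"
  shows "\<exists>r :: nat \<Rightarrow> nat. strict_mono r \<and> (\<forall>i\<in>I. mono (\<lambda>k. s (r k) i))"
  using assms
proof (induction I)
  case empty
  then show ?case by (intro exI[of _ id]) (simp add: strict_mono_def)
next
  case (insert i I)
  then obtain r :: "nat \<Rightarrow> nat" where r: "strict_mono r" "\<forall>i\<in>I. mono (\<lambda>k. s (r k) i)" by blast
  obtain t :: "nat \<Rightarrow> nat" where t: "strict_mono t" "mono (\<lambda>k. s (r (t k)) i)"
    using nat_seq_mono_subseq[of "\<lambda>k. s (r k) i"] by blast
  have "strict_mono (\<lambda>k. r (t k))" using r(1) t(1) by (simp add: strict_mono_def)
  moreover have "mono (\<lambda>k. s (r (t k)) j)" if "j \<in> I" for j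
    using r(2) that strict_mono_mono[OF t(1)] by (auto simp: mono_def)
  ultimately show ?case using t(2) by (intro exI[of _ "\<lambda>k. r (t k)"]) auto
qed

lemma dickson_bounded_degree:
  fixes U :: "('n::finite \<Rightarrow> nat) set"
  shows "\<exists>d. \<forall>a\<in>U. \<exists>b\<in>U. sum b UNIV < d \<and> b \<le> a"
proof (rule ccontr)
  assume "\<not> ?thesis"
  then obtain s where s: "\<And>d. s d \<in> U" "\<And>d b. b \<in> U \<Longrightarrow> sum b UNIV < d \<Longrightarrow> \<not> b \<le> s d"
    by metis
  obtain r :: "nat \<Rightarrow> nat" where r: "strict_mono r" "\<And>i. mono (\<lambda>k. s (r k) i)"
    using dickson_mono_subseq[of UNIV s] by auto
  \<comment> \<open>This index exceeds the degree of \<open>s (r 0)\<close>, and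
    \<open>r ?k \<ge> ?k\<close>, so \<open>s (r ?k)\<close> was chosen not to dominate
    \<open>s (r 0)\<close>.\<close>
  let ?k = "Suc (sum (s (r 0)) UNIV)"
  have "s (r 0) \<le> s (r ?k)" using r(2) by (auto simp: le_fun_def mono_def)
  moreover have "sum (s (r 0)) UNIV < r ?k" using seq_suble[OF r(1), of ?k] by simp
  ultimately show False using s by blast
qed

section \<open>Construction of a finite expansion\<close>

lemma finite_bounded_exponents: "finite {a :: 'n::finite \<Rightarrow> nat. sum a UNIV = d}"
proof -
  have "finite (Pi\<^sub>E (UNIV :: 'n set) (\<lambda>_. {..d}))" by (rule finite_PiE) auto
  moreover have "{a :: 'n \<Rightarrow> nat. sum a UNIV = d} \<subseteq> Pi\<^sub>E UNIV (\<lambda>_. {..d})"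
    by (auto intro!: member_le_sum)
  ultimately show ?thesis by (rule rev_finite_subset)
qed

lemma ideal_power_Suc_0_subset: "is_ideal I \<Longrightarrow> ideal_power I (Suc 0) \<subseteq> I"
  unfolding ideal_power.simps(2)
proof (rule hull_minimal)
  assume I: "is_ideal I"
  show "{a * b | a b. a \<in> I \<and> b \<in> ideal_power I 0} \<subseteq> I"
    using ideal_mult_mem[OF I] by (auto simp: mult.commute)
qed

lemma ideal_power_max_ideal_repr:
  fixes x :: "'n::finite \<Rightarrow> 'a::comm_ring_1"
  assumes "is_ideal hull (range x) = I" "b \<in> ideal_power I d"
  shows "\<exists>c. b = (\<Sum>a | sum a UNIV = d. c a * power_product x a)"
proof -
  let ?G = "{m * power_product x a | m a. m \<in> UNIV \<and> a \<in> {a. sum a UNIV = d}}"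
  have "{power_product x a | a. sum a UNIV = d} \<subseteq> ?G"
  proof
    fix t assume "t \<in> {power_product x a | a. sum a UNIV = d}"
    then obtain a where a: "t = power_product x a" "sum a UNIV = d" by blast
    then have "t = 1 * power_product x a" by simp
    then show "t \<in> ?G" using a(2) by blast
  qed
  then have "is_ideal hull {power_product x a | a. sum a UNIV = d} \<subseteq> is_ideal hull ?G"
    by (rule hull_mono)
  then have "b \<in> is_ideal hull ?G"
    using assms(2) unfolding ideal_power_eq_power_products[OF assms(1)] by (rule subsetD)
  then have "\<exists>c. (\<forall>a. c a \<in> UNIV) \<and> b = (\<Sum>a | sum a UNIV = d. c a * power_product x a)"
    by (intro ideal_hull_sum_repr finite_bounded_exponents) (simp_all add: is_ideal_def)
  then show ?thesis by simp
qed

text \<open>The expansion is built degree by degree, keeping at each step the terms with unit coefficient.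
  By Dickson's lemma all of these are multiples of those of degree \<open>< d\<close> for some \<open>d\<close>, so the rest
  from degree \<open>d\<close> on lies, by Krull's theorem, in the ideal of combinations of the latter with
  coefficients in \<open>\<mm>\<close>, and can be absorbed into their coefficients.\<close>

theorem expansion_exists:
  fixes x :: "'n::finite \<Rightarrow> 'a::local_ring"
  assumes noeth: "noetherian TYPE('a)" and gen: "is_ideal hull (range x) = max_ideal"
  shows "\<exists>U c. finite U \<and> (\<forall>a\<in>U. c a dvd 1) \<and> f = (\<Sum>a\<in>U. c a * power_product x a)"
proof -
  let ?m = "max_ideal :: 'a set" and ?deg = "\<lambda>a :: 'n \<Rightarrow> nat. sum a UNIV"
  define C where "C d b = (SOME c. b = (\<Sum>a | ?deg a = d. c a * power_product x a))" for d b
  have C: "b = (\<Sum>a | ?deg a = d. C d b a * power_product x a)" if "b \<in> ideal_power ?m d" for d b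
    using ideal_power_max_ideal_repr[OF gen that] unfolding C_def by (rule someI_ex)
  define r where "r = rec_nat f (\<lambda>d b. b - (\<Sum>a | ?deg a = d \<and> C d b a \<notin> ?m. C d b a * power_product x a))"
  define u where "u a = C (?deg a) (r (?deg a)) a" for a
  define T where "T d = {a. ?deg a = d \<and> u a \<notin> ?m}" for d
  have finT: "finite (T d)" for d
    unfolding T_def by (rule finite_subset[OF _ finite_bounded_exponents[of d]]) auto
  have r_0: "r 0 = f" by (simp add: r_def)
  have r_Suc: "r (Suc d) = r d - (\<Sum>a\<in>T d. u a * power_product x a)" for d
  proof -
    have "T d = {a. ?deg a = d \<and> C d (r d) a \<notin> ?m}" by (auto simp: T_def u_def)
    then have "(\<Sum>a\<in>T d. u a * power_product x a) =
        (\<Sum>a | ?deg a = d \<and> C d (r d) a \<notin> ?m. C d (r d) a * power_product x a)"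
      by (intro sum.cong) (auto simp: u_def)
    then show ?thesis by (simp add: r_def)
  qed
  have pp: "power_product x a \<in> ideal_power ?m (?deg a)" for a
    unfolding ideal_power_eq_power_products[OF gen] by (intro hull_inc) blast
  \<comment> \<open>Terms of degree \<open>d\<close> whose coefficient lies in
    \<open>max_ideal\<close> already belong to the next power, so subtracting the unit terms is
    enough.\<close>
  have r_mem: "r d \<in> ideal_power ?m d" for d
  proof (induction d)
    case (Suc d)
    have "r d = (\<Sum>a | ?deg a = d. u a * power_product x a)"
      by (subst C[OF Suc]) (auto simp: u_def intro!: sum.cong)
    also have "\<dots> = (\<Sum>a\<in>T d. u a * power_product x a) +
        (\<Sum>a\<in>{a. ?deg a = d} - T d. u a * power_product x a)"
      by (subst add.commute, rule sum.subset_diff)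
         (auto simp: T_def finite_bounded_exponents)
    finally have "r (Suc d) = (\<Sum>a\<in>{a. ?deg a = d} - T d. u a * power_product x a)"
      by (simp add: r_Suc)
    also have "\<dots> \<in> ideal_power ?m (Suc d)"
    proof (rule ideal_sum_mem[OF is_ideal_power])
      fix a assume "a \<in> {a. ?deg a = d} - T d"
      then have "u a \<in> ?m" "power_product x a \<in> ideal_power ?m d" using pp[of a] by (auto simp: T_def)
      then show "u a * power_product x a \<in> ideal_power ?m (Suc d)"
        by (auto intro!: hull_inc)
    qed
    finally show ?case .
  qed simp
  have f_eq: "f = (\<Sum>k<d. \<Sum>a\<in>T k. u a * power_product x a) + r d" for d
    by (induction d) (simp_all add: r_0 r_Suc algebra_simps)
  obtain d where d: "\<And>a. u a \<notin> ?m \<Longrightarrow> \<exists>b. u b \<notin> ?m \<and> ?deg b < d \<and> b \<le> a"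
    using dickson_bounded_degree[of "{a. u a \<notin> ?m}"] by auto
  define U where "U = (\<Union>k<d. T k)"
  have finU: "finite U" using finT by (auto simp: U_def)
  have U_mem: "a \<in> U \<longleftrightarrow> u a \<notin> ?m \<and> ?deg a < d" for a by (auto simp: U_def T_def)
  define J where "J = is_ideal hull {m * power_product x a | m a. m \<in> ?m \<and> a \<in> U}"
  have J: "is_ideal J" unfolding J_def by (rule is_ideal_hull)
  \<comment> \<open>As \<open>?deg b < d \<le> ?deg a\<close>, the quotient of the two monomials is
    not constant and therefore lies in \<open>max_ideal\<close>.\<close>
  have term_J: "u a * power_product x a \<in> J" if a: "u a \<notin> ?m" "d \<le> ?deg a" for a
  proof -
    obtain b where b: "b \<in> U" "b \<le> a" using d[OF a(1)] U_mem by auto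
    let ?c = "\<lambda>i. a i - b i"
    have ab: "a = (\<lambda>i. ?c i + b i)" using b(2) by (auto simp: le_fun_def)
    have "?deg a = ?deg ?c + ?deg b" by (subst ab) (simp only: sum.distrib)
    then have "?deg ?c \<ge> 1" using a(2) b(1) U_mem[of b] by simp
    then have "power_product x ?c \<in> ideal_power ?m 1"
      using pp[of ?c] ideal_power_antimono[of 1 "?deg ?c" ?m] by blast
    also have "ideal_power ?m 1 \<subseteq> ?m"
      using ideal_power_Suc_0_subset[OF is_ideal_max_ideal] by simp
    finally have "power_product x ?c * power_product x b \<in> J"
      unfolding J_def using b(1) by (intro hull_inc) blast
    then show ?thesis using ideal_mult_mem[OF J] ab by (metis power_product_add)
  qed
  have "r d \<in> J"
  proof (rule krull_intersection[OF noeth gen J])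
    fix e
    show "\<exists>j\<in>J. r d - j \<in> ideal_power ?m e"
    proof (cases "d \<le> e")
      case True
      let ?j = "\<Sum>k\<in>{d..<e}. \<Sum>a\<in>T k. u a * power_product x a"
      have "(\<Sum>k<e. \<Sum>a\<in>T k. u a * power_product x a) =
          (\<Sum>k<d. \<Sum>a\<in>T k. u a * power_product x a) + ?j"
        using True by (simp add: lessThan_atLeast0 sum.atLeastLessThan_concat)
      then have "r d - ?j = r e" using f_eq[of d] f_eq[of e] by (simp add: algebra_simps)
      moreover have "?j \<in> J"
        by (intro ideal_sum_mem[OF J] term_J) (auto simp: T_def)
      ultimately show ?thesis using r_mem[of e] by metis
    next
      case False
      then show ?thesis using r_mem[of d] ideal_power_antimono[of e d ?m] ideal_zero_mem[OF J]
        by (intro bexI[of _ 0]) auto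
    qed
  qed
  then obtain c where c: "\<And>a. c a \<in> ?m" "r d = (\<Sum>a\<in>U. c a * power_product x a)"
    using ideal_hull_sum_repr[OF finU is_ideal_max_ideal] unfolding J_def by blast
  have "(\<Sum>k<d. \<Sum>a\<in>T k. u a * power_product x a) = (\<Sum>a\<in>U. u a * power_product x a)"
    unfolding U_def using finT by (subst sum.UNION_disjoint) (auto simp: T_def)
  then have "f = (\<Sum>a\<in>U. (u a + c a) * power_product x a)"
    using f_eq[of d] c(2) by (simp add: distrib_right sum.distrib)
  moreover have "(u a + c a) dvd 1" if "a \<in> U" for a
  proof -
    have "u a + c a \<notin> ?m"
      using is_ideal_diff[OF is_ideal_max_ideal, of "u a + c a" "c a"] c(1)[of a] U_mem that by auto
    then show ?thesis using unit_iff_notin_max_ideal[OF noeth] by blast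
  qed
  ultimately show ?thesis
    using finU by (intro exI[of _ U] exI[of _ "\<lambda>a. u a + c a"] conjI ballI)
qed

lemma eval_monomial_eq: "eval_monomial x A = power_product x (Poly_Mapping.lookup A)"
  by (simp add: eval_monomial_def power_product_def)

text \<open>Access to the value chosen by \<open>SOME\<close> in \<open>expansion\<close>: the
  expansion just constructed, indexed by plain functions, is transported to finitely supported
  ones.\<close>

lemma is_expansion_expansion:
  fixes x :: "'n::finite \<Rightarrow> 'a::local_ring"
  assumes "noetherian TYPE('a)" "is_ideal hull (range x) = max_ideal"
  shows "is_expansion x f (expansion x f)"
proof -
  obtain U c where U: "finite U" "\<And>a. a \<in> U \<Longrightarrow> c a dvd 1" "f = (\<Sum>a\<in>U. c a * power_product x a)"
    using expansion_exists[OF assms, of f] by blast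
  define \<rho> where "\<rho> = Abs_poly_mapping (\<lambda>A. if Poly_Mapping.lookup A \<in> U then c (Poly_Mapping.lookup A) else 0)"
  let ?V = "{A. Poly_Mapping.lookup A \<in> U}"
  have bij: "bij_betw Poly_Mapping.lookup ?V U"
  proof (rule bij_betw_imageI)
    show "inj_on Poly_Mapping.lookup ?V" by (rule inj_onI) (rule poly_mapping_eqI, simp)
    have lookup_Abs: "Poly_Mapping.lookup (Abs_poly_mapping a) = a" for a :: "'n \<Rightarrow> nat"
      by (subst Abs_poly_mapping_inverse) auto
    show "Poly_Mapping.lookup ` ?V = U"
    proof
      show "U \<subseteq> Poly_Mapping.lookup ` ?V"
        by (rule subsetI, rule_tac x = "Abs_poly_mapping x" in image_eqI) (simp_all add: lookup_Abs)
    qed auto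
  qed
  then have finV: "finite ?V" using U(1) bij_betw_finite by blast
  have lookup: "Poly_Mapping.lookup \<rho> A = (if Poly_Mapping.lookup A \<in> U then c (Poly_Mapping.lookup A) else 0)" for A
    unfolding \<rho>_def by (subst Abs_poly_mapping_inverse) (auto intro: finite_subset[OF _ finV])
  have keys: "Poly_Mapping.keys \<rho> = ?V"
  proof -
    have "c a \<noteq> 0" if "a \<in> U" for a using U(2)[OF that] by auto
    then show ?thesis by (auto simp: in_keys_iff lookup split: if_splits)
  qed
  have "f = (\<Sum>A\<in>?V. c (Poly_Mapping.lookup A) * eval_monomial x A)"
    unfolding U(3) eval_monomial_eq by (rule sum.reindex_bij_betw[OF bij, symmetric])
  then have "is_expansion x f \<rho>"
    unfolding is_expansion_def keys using U(2) by (simp add: lookup)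
  then show ?thesis unfolding expansion_def by (rule someI)
qed

section \<open>Reduction of polynomials\<close>

lemma residue_add: "residue (a + b) = residue a + residue b"
  by (simp add: plus_residue_field.abs_eq)

lemma residue_diff: "residue (a - b) = residue a - residue b"
  by (simp add: minus_residue_field.abs_eq)

lemma residue_mult: "residue (a * b) = residue a * residue b"
  by (simp add: times_residue_field.abs_eq)

lemma residue_0 [simp]: "residue 0 = 0"
  by (simp add: zero_residue_field.abs_eq)

lemma residue_1 [simp]: "residue 1 = 1"
  by (simp add: one_residue_field.abs_eq)

lemma residue_sum: "residue (sum f A) = (\<Sum>a\<in>A. residue (f a))"
  by (induction A rule: infinite_finite_induct) (simp_all add: residue_add)

lemma residue_eq_0_iff: "residue a = 0 \<longleftrightarrow> a \<in> max_ideal"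
  using residue_field.abs_eq_iff[of a 0] by simp

lemma residue_surj: "\<exists>a. residue a = c"
  using Quotient_abs_rep[OF Quotient_residue_field] by blast

lemma map_poly_residue_mult:
  "map_poly residue (p * q) = map_poly residue p * map_poly residue q"
  by (rule poly_eqI) (simp add: coeff_map_poly coeff_mult residue_sum residue_mult)

lemma map_poly_residue_diff:
  "map_poly residue (p - q) = map_poly residue p - map_poly residue q"
  by (rule poly_eqI) (simp add: coeff_map_poly residue_diff)

lemma map_poly_residue_monom_1: "map_poly residue (monom 1 n) = monom 1 n"
  by (rule poly_eqI) (simp add: coeff_map_poly)

lemma coeff_mem_max_ideal: "map_poly residue p = 0 \<Longrightarrow> coeff p i \<in> max_ideal"
  by (metis coeff_0 coeff_map_poly residue_0 residue_eq_0_iff)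

text \<open>Lifting zero coefficients to zero keeps the degree bounded. The last property is
  separate because \<open>degree 0 = 0\<close> does not detect the zero polynomial, and in
  \<open>division\<close> the exponents of a lift are only known to be non-negative if it is
  nonzero.\<close>

lemma lift_poly:
  fixes g :: "'a::local_ring residue_field poly"
  obtains p where "map_poly residue p = g" "degree p \<le> degree g" "g = 0 \<Longrightarrow> p = 0"
proof -
  obtain r :: "'a residue_field \<Rightarrow> 'a" where r: "\<And>c. residue (r c) = c" using residue_surj by metis
  define p where "p = (\<Sum>i\<le>degree g. monom (if coeff g i = 0 then 0 else r (coeff g i)) i)"
  have coeff: "coeff p i = (if coeff g i = 0 then 0 else r (coeff g i))" for i
    by (cases "i \<le> degree g") (auto simp: p_def coeff_sum coeff_eq_0)
  show ?thesis
  proof (rule that)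
    show "map_poly residue p = g" by (rule poly_eqI) (simp add: coeff_map_poly coeff r)
    show "degree p \<le> degree g" by (rule degree_le) (simp add: coeff coeff_eq_0)
    show "p = 0" if "g = 0" by (rule poly_eqI) (simp add: coeff that)
  qed
qed

section \<open>Comaximal polynomials\<close>

text \<open>Stated as a Bezout identity because the cofactors themselves are what division along a
  line requires.\<close>

definition comaximal :: "'k::comm_ring_1 \<Rightarrow> 'k \<Rightarrow> bool" where
  "comaximal a b \<longleftrightarrow> (\<exists>u v. u * a + v * b = 1)"

lemma comaximal_mult:
  assumes "comaximal a c" "comaximal b c" shows "comaximal (a * b) c"
proof -
  obtain u v r s where *: "u * a + v * c = 1" "r * b + s * c = 1"
    using assms unfolding comaximal_def by blast
  have "(u * r) * (a * b) + (u * a * s + v * r * b + v * s * c) * c = (u * a + v * c) * (r * b + s * c)"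
    by (simp add: algebra_simps)
  then show ?thesis using * unfolding comaximal_def by (metis mult_1)
qed

lemma comaximal_one_left: "comaximal 1 c"
  unfolding comaximal_def by (intro exI[of _ 1] exI[of _ 0]) simp

lemma comaximal_power_left: "comaximal a c \<Longrightarrow> comaximal (a ^ n) c"
  by (induction n) (simp_all add: comaximal_one_left comaximal_mult)

text \<open>Writing \<open>h = c + t h'\<close> with \<open>c \<noteq> 0\<close> shows that the
  variable \<open>t\<close> is invertible modulo \<open>h\<close>.\<close>

lemma comaximal_monom:
  fixes h :: "'k::field poly"
  assumes "coeff h 0 \<noteq> 0"
  shows "comaximal (monom 1 n) h"
proof -
  obtain c h' where h: "h = pCons c h'" by (cases h)
  then have c: "c \<noteq> 0" using assms by simp
  have "(- smult (inverse c) h') * monom 1 1 + [:inverse c:] * h = 1"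
    using c by (simp add: h monom_altdef smult_add_right one_pCons)
  then have "comaximal (monom 1 1) h" unfolding comaximal_def by blast
  then have "comaximal (monom 1 1 ^ n) h" by (rule comaximal_power_left)
  then show ?thesis by (simp add: monom_power)
qed

text \<open>Any solution \<open>u\<close> may be replaced by its remainder modulo \<open>h\<close>,
  the quotient being absorbed into \<open>v\<close>.\<close>

lemma comaximal_solve_small:
  fixes a h c :: "'k::field poly"
  assumes "comaximal a h" "h \<noteq> 0"
  obtains u v where "c = a * u + h * v" "u = 0 \<or> degree u < degree h"
proof -
  obtain r s where rs: "r * a + s * h = 1" using assms(1) unfolding comaximal_def by blast
  let ?u = "(c * r) mod h" and ?v = "c * s + a * ((c * r) div h)"
  have "a * ?u + h * ?v = a * (c * r) + c * s * h"
    by (simp add: algebra_simps minus_div_mult_eq_mod[symmetric])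
  also have "\<dots> = c * (r * a + s * h)" by (simp add: algebra_simps)
  finally have "c = a * ?u + h * ?v" using rs by simp
  then show ?thesis using that degree_mod_less[OF assms(2)] by blast
qed

section \<open>Sums along a line of exponents\<close>

text \<open>Used with \<open>mon\<close> the monomials in the parameters of \<open>R\<close> (and \<open>\<phi>\<close> the identity), and with \<open>mon\<close>
  the monomials of the polynomial ring over the residue field (and \<open>\<phi>\<close> the constants).\<close>

definition line_sum ::
    "('c::zero \<Rightarrow> 'b::comm_ring_1) \<Rightarrow> (int ^ 'n \<Rightarrow> 'b) \<Rightarrow> int ^ 'n \<Rightarrow> int ^ 'n \<Rightarrow> 'c poly \<Rightarrow> 'b" where
  "line_sum \<phi> mon w z a = (\<Sum>i\<le>degree a. \<phi> (coeff a i) * mon (z + int i *s w))"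

lemma line_sum_bound:
  assumes "\<phi> 0 = 0" "degree a \<le> N"
  shows "line_sum \<phi> mon w z a = (\<Sum>i\<le>N. \<phi> (coeff a i) * mon (z + int i *s w))"
  unfolding line_sum_def
  by (rule sum.mono_neutral_left) (use assms in \<open>auto simp: coeff_eq_0\<close>)

lemma line_sum_diff:
  fixes a b :: "'c::ab_group_add poly"
  assumes \<phi>: "\<And>r s. \<phi> (r - s) = \<phi> r - \<phi> s"
  shows "line_sum \<phi> mon w z (a - b) = line_sum \<phi> mon w z a - line_sum \<phi> mon w z b"
proof -
  have 0: "\<phi> 0 = 0" using \<phi>[of 0 0] by simp
  let ?N = "max (degree a) (degree b)"
  show ?thesis
    using line_sum_bound[of \<phi> a ?N mon w z] line_sum_bound[of \<phi> b ?N mon w z]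
      line_sum_bound[of \<phi> "a - b" ?N mon w z]
    by (simp add: 0 degree_diff_le_max \<phi> left_diff_distrib sum_subtractf)
qed

text \<open>The Cauchy product along parallel lines. Multiplicativity of \<open>mon\<close> is
  demanded only at the points that occur, since the monomials used later truncate negative
  exponents.\<close>

lemma line_sum_mult:
  fixes a b :: "'c::comm_ring_1 poly"
  assumes \<phi>: "\<phi> 0 = 0" "\<And>r s. \<phi> (r + s) = \<phi> r + \<phi> s" "\<And>r s. \<phi> (r * s) = \<phi> r * \<phi> s"
    and mon: "\<And>i j. i \<le> degree a \<Longrightarrow> j \<le> degree b \<Longrightarrow> a \<noteq> 0 \<Longrightarrow> b \<noteq> 0 \<Longrightarrow>
      mon (y + int i *s w) * mon (z + int j *s w) = mon ((y + int i *s w) + (z + int j *s w))"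
  shows "line_sum \<phi> mon w y a * line_sum \<phi> mon w z b = line_sum \<phi> mon w (y + z) (a * b)"
proof (cases "a = 0 \<or> b = 0")
  case True
  then show ?thesis by (auto simp: line_sum_def \<phi>(1))
next
  case False
  have \<phi>_sum: "\<phi> (sum k A) = (\<Sum>i\<in>A. \<phi> (k i))" for k :: "nat \<Rightarrow> 'c" and A
    by (induction A rule: infinite_finite_induct) (simp_all add: \<phi>)
  let ?m = "degree a" and ?n = "degree b"
  let ?f = "\<lambda>i j. \<phi> (coeff a i) * \<phi> (coeff b j) * mon (y + z + int (i + j) *s w)"
  have mon': "mon (y + int i *s w) * mon (z + int j *s w) = mon (y + z + int (i + j) *s w)"
    if "i \<le> ?m" "j \<le> ?n" for i j
  proof -
    have "(y + int i *s w) + (z + int j *s w) = y + z + int (i + j) *s w"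
      by (simp add: vec_eq_iff algebra_simps)
    then show ?thesis using mon[OF that] False by metis
  qed
  have "line_sum \<phi> mon w y a * line_sum \<phi> mon w z b = (\<Sum>i\<le>?m. \<Sum>j\<le>?n.
      \<phi> (coeff a i) * \<phi> (coeff b j) * (mon (y + int i *s w) * mon (z + int j *s w)))"
    unfolding line_sum_def by (simp add: sum_product mult_ac)
  also have "\<dots> = (\<Sum>i\<le>?m. \<Sum>j\<le>?n. ?f i j)"
    using mon' by (intro sum.cong) auto
  also have "\<dots> = (\<Sum>(i, j)\<in>{..?m} \<times> {..?n}. ?f i j)"
    by (rule sum.cartesian_product)
  also have "\<dots> = (\<Sum>(i, j)\<in>{(i, j). i + j \<le> ?m + ?n}. ?f i j)"
  proof (rule sum.mono_neutral_left)
    show "finite {(i, j). i + j \<le> ?m + ?n}"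
      by (rule finite_subset[of _ "{..?m + ?n} \<times> {..?m + ?n}"]) auto
    have "?f i j = 0" if "\<not> (i \<le> ?m \<and> j \<le> ?n)" for i j
      using that by (cases "i \<le> ?m") (simp_all add: coeff_eq_0 \<phi>(1))
    then show "\<forall>p\<in>{(i, j). i + j \<le> ?m + ?n} - {..?m} \<times> {..?n}. (case p of (i, j) \<Rightarrow> ?f i j) = 0"
      by (simp only: split_paired_all Ball_def) auto
  qed auto
  also have "\<dots> = (\<Sum>k\<le>?m + ?n. \<Sum>i\<le>k. ?f i (k - i))"
    by (rule sum.triangle_reindex_eq)
  also have "\<dots> = (\<Sum>k\<le>?m + ?n. \<phi> (coeff (a * b) k) * mon (y + z + int k *s w))"
    by (intro sum.cong refl) (simp add: coeff_mult \<phi>_sum \<phi>(3) sum_distrib_right)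
  also have "\<dots> = line_sum \<phi> mon w (y + z) (a * b)"
    by (rule line_sum_bound[symmetric]) (simp_all add: \<phi>(1) degree_mult_le)
  finally show ?thesis .
qed

text \<open>Moves sums with different base points on one line to a common base point, where they can
  be subtracted.\<close>

lemma line_sum_monom_mult:
  fixes a :: "'c::comm_ring_1 poly"
  assumes 0: "\<phi> 0 = 0"
  shows "line_sum \<phi> mon w z (monom 1 e * a) = line_sum \<phi> mon w (z + int e *s w) a"
proof -
  have deg: "degree (monom 1 e * a) \<le> e + degree a"
    by (rule order_trans[OF degree_mult_le]) (simp add: degree_monom_le)
  have "line_sum \<phi> mon w z (monom 1 e * a) =
      (\<Sum>i\<le>e + degree a. \<phi> (coeff (monom 1 e * a) i) * mon (z + int i *s w))"
    by (rule line_sum_bound[of \<phi>, OF 0 deg])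
  also have "\<dots> = (\<Sum>i\<in>{e..e + degree a}. \<phi> (coeff (monom 1 e * a) i) * mon (z + int i *s w))"
    by (rule sum.mono_neutral_right) (auto simp: coeff_monom_mult 0)
  also have "\<dots> = (\<Sum>i\<le>degree a. \<phi> (coeff a i) * mon (z + int (e + i) *s w))"
    by (rule sum.reindex_bij_witness[of _ "\<lambda>i. e + i" "\<lambda>i. i - e"])
       (auto simp: coeff_monom_mult)
  also have "\<dots> = line_sum \<phi> mon w (z + int e *s w) a"
    unfolding line_sum_def
    by (intro sum.cong refl arg_cong2[of _ _ _ _ "(*)"] arg_cong[of _ _ mon])
       (simp add: vec_eq_iff algebra_simps)
  finally show ?thesis .
qed

section \<open>Factorization in the completion\<close>

definition form :: "int ^ 'n::finite \<Rightarrow> int ^ 'n \<Rightarrow> int" where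
  "form c z = (\<Sum>i\<in>UNIV. c $ i * z $ i)"

lemma form_add: "form c (y + z) = form c y + form c z"
  by (simp add: form_def algebra_simps sum.distrib)

lemma form_diff: "form c (y - z) = form c y - form c z"
  by (simp add: form_def algebra_simps sum_subtractf)

lemma form_smult: "form c (k *s z) = k * form c z"
  by (simp add: form_def sum_distrib_left mult_ac)

lemma form_pos:
  assumes "\<And>i. c $ i > 0" "\<And>i. z $ i \<ge> 0" "z \<noteq> 0"
  shows "form c z \<ge> 1"
proof -
  obtain i where i: "z $ i \<noteq> 0" using assms(3) by (auto simp: vec_eq_iff)
  then have "0 < c $ i * z $ i" using assms(1,2)[of i] by simp
  also have "\<dots> \<le> form c z"
    unfolding form_def using assms(1,2) by (intro member_le_sum) (auto simp: less_imp_le)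
  finally show ?thesis by simp
qed

lemma form_axis: "form (axis i k) z = k * z $ i"
proof -
  have "form (axis i k) z = (\<Sum>j\<in>UNIV. if j = i then k * z $ i else 0)"
    unfolding form_def by (intro sum.cong) (auto simp: axis_def)
  then show ?thesis by simp
qed

lemma form_add_left: "form (b + c) z = form b z + form c z"
  by (simp add: form_def algebra_simps sum.distrib)

definition nonneg :: "int ^ 'n \<Rightarrow> bool" where
  "nonneg z \<longleftrightarrow> (\<forall>i. 0 \<le> z $ i)"

lemma nonneg_axis: "0 \<le> k \<Longrightarrow> nonneg (axis i k)"
  by (simp add: nonneg_def axis_def)

text \<open>Together with \<open>neg_part\<close> this yields the exponents \<open>\<alpha>\<close>
  and \<open>\<beta>\<close> of the overview, with disjoint supports.\<close>

definition pos_part :: "int ^ 'n \<Rightarrow> int ^ 'n" where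
  "pos_part w = (\<chi> i. max 0 (w $ i))"

definition neg_part :: "int ^ 'n \<Rightarrow> int ^ 'n" where
  "neg_part w = (\<chi> i. max 0 (- w $ i))"

lemma pos_part_minus_neg_part: "pos_part w - neg_part w = w"
  by (auto simp: vec_eq_iff pos_part_def neg_part_def max_def)

text \<open>The vector equals \<open>i *s pos_part w + (c - i) *s neg_part w\<close>, the exponent
  of a term of a binary form of degree \<open>c\<close> in \<open>X^\<alpha>\<close> and
  \<open>X^\<beta>\<close>.\<close>

lemma nonneg_neg_part_translate:
  assumes "i \<le> c"
  shows "nonneg (int c *s neg_part w + int i *s w)"
proof -
  have "0 \<le> int c * max 0 (- w $ k) + int i * w $ k" for k
  proof (cases "0 \<le> w $ k")
    case False
    then have "int i * (- w $ k) \<le> int c * (- w $ k)" using assms by (intro mult_right_mono) auto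
    then show ?thesis using False by simp
  qed simp
  then show ?thesis by (simp add: nonneg_def neg_part_def)
qed

text \<open>Meaningful for \<^const>\<open>nonneg\<close> exponents only: negative entries are truncated to 0.\<close>

definition int_monomial :: "('n::finite \<Rightarrow> 'a::comm_ring_1) \<Rightarrow> int ^ 'n \<Rightarrow> 'a" where
  "int_monomial x z = power_product x (\<lambda>i. nat (z $ i))"

lemma int_monomial_add:
  "nonneg y \<Longrightarrow> nonneg z \<Longrightarrow> int_monomial x (y + z) = int_monomial x y * int_monomial x z"
  by (simp add: int_monomial_def nonneg_def nat_add_distrib flip: power_product_add)

text \<open>Entries of both signs occur because a positive form vanishes on the direction of a
  compact edge (\<open>positive_form_entries\<close>); conversely they allow
  \<open>level_form\<close> to be written down.\<close>

locale direction =
  fixes x :: "'n::finite \<Rightarrow> 'a::local_ring" and w :: "int ^ 'n"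
  assumes gen: "is_ideal hull (range x) = max_ideal"
    and pos_entry: "\<exists>i. 0 < w $ i" and neg_entry: "\<exists>i. w $ i < 0"
begin

text \<open>Every positive entry of \<open>w\<close> is weighted with the total size of the negative
  ones and vice versa, so the contributions cancel on \<open>w\<close>. In contrast to the real form
  determining the edge, it takes integer values on exponents, so approximation can proceed in steps
  of 1.\<close>

definition level_form :: "int ^ 'n" where
  "level_form = (\<chi> i. if 0 < w $ i then \<Sum>j | w $ j < 0. - w $ j
     else if w $ i < 0 then \<Sum>j | 0 < w $ j. w $ j else 1)"

abbreviation level :: "int ^ 'n \<Rightarrow> int" where
  "level \<equiv> form level_form"

lemma level_form_pos: "0 < level_form $ i"
proof -
  have "0 < (\<Sum>j | w $ j < 0. - w $ j)" "0 < (\<Sum>j | 0 < w $ j. w $ j)"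
    using pos_entry neg_entry by (auto intro!: sum_pos)
  then show ?thesis by (simp add: level_form_def)
qed

lemma level_direction: "level w = 0"
proof -
  let ?P = "{i. 0 < w $ i}" and ?N = "{i. w $ i < 0}"
  have "level w = (\<Sum>i\<in>?P \<union> ?N. level_form $ i * w $ i)"
    unfolding form_def by (rule sum.mono_neutral_right) auto
  also have "\<dots> = (\<Sum>i\<in>?P. level_form $ i * w $ i) + (\<Sum>i\<in>?N. level_form $ i * w $ i)"
    by (rule sum.union_disjoint) auto
  also have "(\<Sum>i\<in>?P. level_form $ i * w $ i) = (\<Sum>j\<in>?N. - w $ j) * (\<Sum>i\<in>?P. w $ i)"
    by (simp add: level_form_def sum_distrib_left)
  also have "(\<Sum>i\<in>?N. level_form $ i * w $ i) = (\<Sum>i\<in>?P. w $ i) * (\<Sum>j\<in>?N. w $ j)"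
    unfolding sum_distrib_left by (intro sum.cong) (auto simp: level_form_def)
  finally show ?thesis by (simp add: sum_negf mult.commute)
qed

text \<open>By Farkas' lemma, \<open>above p\<close> consists of the exponents in \<open>p + \<real> w + \<real>\<^sub>\<ge>\<^sub>0\<^sup>n\<close>.\<close>

definition above :: "int ^ 'n \<Rightarrow> (int ^ 'n) set" where
  "above p = {z. nonneg z \<and> (\<forall>c. nonneg c \<longrightarrow> form c w = 0 \<longrightarrow> form c p \<le> form c z)}"

lemma above_add: "y \<in> above p \<Longrightarrow> z \<in> above q \<Longrightarrow> y + z \<in> above (p + q)"
  by (auto simp: above_def nonneg_def form_add intro: add_mono)

lemma above_translate: "z \<in> above p \<Longrightarrow> nonneg (z - q + k *s w) \<Longrightarrow> z - q + k *s w \<in> above (p - q)"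
  by (auto simp: above_def form_add form_diff form_smult)

text \<open>\<open>p\<close> records the region that makes division possible, \<open>s\<close> the
  precision reached. Both add up under multiplication, see \<open>above_ideal_mult\<close>.\<close>

definition above_ideal :: "int ^ 'n \<Rightarrow> int \<Rightarrow> 'a set" where
  "above_ideal p s = is_ideal hull {int_monomial x z | z. z \<in> above p \<and> s \<le> level z}"

lemma is_ideal_above_ideal: "is_ideal (above_ideal p s)"
  unfolding above_ideal_def by (rule is_ideal_hull)

lemma int_monomial_mem_above_ideal: "z \<in> above p \<Longrightarrow> s \<le> level z \<Longrightarrow> int_monomial x z \<in> above_ideal p s"
  unfolding above_ideal_def by (intro hull_inc) blast

lemma above_ideal_antimono: "s \<le> t \<Longrightarrow> above_ideal p t \<subseteq> above_ideal p s"
  unfolding above_ideal_def by (intro hull_mono) auto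

lemma above_ideal_mult:
  assumes "a \<in> above_ideal p s" "b \<in> above_ideal q t"
  shows "a * b \<in> above_ideal (p + q) (s + t)"
proof (rule hull_mult_mem[OF assms[unfolded above_ideal_def]])
  fix a b
  assume "a \<in> {int_monomial x z | z. z \<in> above p \<and> s \<le> level z}"
    "b \<in> {int_monomial x z | z. z \<in> above q \<and> t \<le> level z}"
  then obtain y z where yz: "a = int_monomial x y" "y \<in> above p" "s \<le> level y"
    "b = int_monomial x z" "z \<in> above q" "t \<le> level z" by blast
  then have "a * b = int_monomial x (y + z)"
    by (simp add: above_def int_monomial_add)
  then show "a * b \<in> above_ideal (p + q) (s + t)"
    using yz by (auto intro!: int_monomial_mem_above_ideal above_add simp: form_add)
qed (rule is_ideal_above_ideal)

text \<open>Each parameter raises the level by at least 1, as \<open>level_form\<close> is positive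
  and integral, and does not leave the region above \<open>p\<close>. Hence coefficients that vanish
  in the residue field count as errors of the next level.\<close>

lemma max_ideal_mult_mem_above_ideal:
  assumes r: "r \<in> max_ideal" and z: "z \<in> above p"
  shows "r * int_monomial x z \<in> above_ideal p (level z + 1)"
proof -
  have "is_ideal {r. r * int_monomial x z \<in> above_ideal p (level z + 1)}"
    using is_ideal_above_ideal[of p "level z + 1"] by (auto simp: is_ideal_def distrib_right mult.assoc)
  moreover have "x i * int_monomial x z \<in> above_ideal p (level z + 1)" for i
  proof -
    have ax: "nonneg (axis i 1 :: int ^ 'n)" by (simp add: nonneg_axis)
    have "int_monomial x (axis i 1) = x i"
    proof -
      have "(\<lambda>j. nat (axis i 1 $ j)) = (\<lambda>j. if j = i then 1 else 0)" by (auto simp: axis_def)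
      then show ?thesis by (simp add: int_monomial_def power_product_unit)
    qed
    then have "x i * int_monomial x z = int_monomial x (axis i 1 + z)"
      using ax z by (simp add: int_monomial_add above_def)
    moreover have "0 \<le> form c (axis i 1)" if "nonneg c" for c :: "int ^ 'n"
      unfolding form_def using that ax by (auto simp: nonneg_def intro!: sum_nonneg)
    then have "axis i 1 + z \<in> above p"
      using z ax unfolding above_def by (force simp: form_add nonneg_def)
    moreover have "level z + 1 \<le> level (axis i 1 + z)"
    proof -
      have "axis i (1::int) \<noteq> 0" by (simp add: axis_eq_0_iff)
      then have "1 \<le> level (axis i 1)"
        using level_form_pos ax by (intro form_pos) (auto simp: nonneg_def)
      then show ?thesis by (simp add: form_add)
    qed
    ultimately show ?thesis by (simp add: int_monomial_mem_above_ideal)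
  qed
  ultimately have "max_ideal \<subseteq> {r. r * int_monomial x z \<in> above_ideal p (level z + 1)}"
    unfolding gen[symmetric] by (intro hull_minimal) auto
  then show ?thesis using r by blast
qed

text \<open>With \<open>C\<close> the sum of the entries of \<open>level_form\<close>, the level of
  an exponent is at most \<open>C\<close> times its total degree, so high level forces high
  degree.\<close>

lemma above_ideal_subset_ideal_power:
  "\<exists>C>0. \<forall>p s k. int (C * k) \<le> s \<longrightarrow> above_ideal p s \<subseteq> ideal_power max_ideal k"
proof -
  let ?C = "\<Sum>i\<in>UNIV. level_form $ i"
  have C: "0 < ?C" using level_form_pos by (intro sum_pos) auto
  show ?thesis
  proof (intro exI[of _ "nat ?C"] conjI allI impI)
    fix p s k assume s: "int (nat ?C * k) \<le> s"
    show "above_ideal p s \<subseteq> ideal_power max_ideal k"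
      unfolding above_ideal_def
    proof (rule hull_minimal, clarify)
      fix z assume z: "z \<in> above p" "s \<le> level z"
      let ?a = "\<lambda>i. nat (z $ i)"
      have nn: "0 \<le> z $ i" for i using z(1) by (simp add: above_def nonneg_def)
      have "level z \<le> (\<Sum>i\<in>UNIV. ?C * z $ i)"
        unfolding form_def using nn level_form_pos
        by (intro sum_mono mult_right_mono member_le_sum) (auto simp: less_imp_le)
      also have "\<dots> = ?C * int (sum ?a UNIV)" using nn by (simp add: sum_distrib_left)
      finally have "level z \<le> ?C * int (sum ?a UNIV)" .
      moreover have "int (nat ?C * k) = ?C * int k" using C by simp
      ultimately have "?C * int k \<le> ?C * int (sum ?a UNIV)" using s z(2) by linarith
      then have "k \<le> sum ?a UNIV" using C by (simp only: mult_le_cancel_left_pos of_nat_le_iff)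
      then have "ideal_power max_ideal (sum ?a UNIV) \<subseteq> (ideal_power max_ideal k :: 'a set)"
        by (rule ideal_power_antimono)
      moreover have "int_monomial x z \<in> ideal_power max_ideal (sum ?a UNIV)"
        unfolding ideal_power_eq_power_products[OF gen] int_monomial_def by (intro hull_inc) blast
      ultimately show "int_monomial x z \<in> ideal_power max_ideal k" by blast
    qed (rule is_ideal_power)
  qed (use C in simp)
qed

abbreviation ev :: "int ^ 'n \<Rightarrow> 'a poly \<Rightarrow> 'a" where
  "ev \<equiv> line_sum (\<lambda>r. r) (int_monomial x) w"

lemma ev_mem_above_ideal:
  assumes "\<And>i. i \<le> degree a \<Longrightarrow> a \<noteq> 0 \<Longrightarrow> z + int i *s w \<in> above p \<and> s \<le> level (z + int i *s w)"
  shows "ev z a \<in> above_ideal p s"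
proof (cases "a = 0")
  case True
  then show ?thesis by (simp add: line_sum_def ideal_zero_mem is_ideal_above_ideal)
next
  case False
  then show ?thesis unfolding line_sum_def
    using assms by (intro ideal_sum_mem ideal_mult_mem is_ideal_above_ideal int_monomial_mem_above_ideal) auto
qed

lemma level_translate: "level (z + k *s w) = level z"
  by (simp add: form_add form_smult level_direction)

lemma ev_mem_above_ideal_Suc:
  assumes "map_poly residue a = 0" "\<And>i. i \<le> degree a \<Longrightarrow> z + int i *s w \<in> above p"
  shows "ev z a \<in> above_ideal p (level z + 1)"
  unfolding line_sum_def
proof (rule ideal_sum_mem[OF is_ideal_above_ideal])
  fix i assume "i \<in> {..degree a}"
  then show "coeff a i * int_monomial x (z + int i *s w) \<in> above_ideal p (level z + 1)"
    using max_ideal_mult_mem_above_ideal[OF coeff_mem_max_ideal[OF assms(1)], of "z + int i *s w" p i] assms(2)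
    by (simp add: level_translate)
qed


text \<open>In the class of \<open>z\<close> modulo \<open>\<int> w\<close>, division by a binary form of degree \<open>deg g + deg h\<close> needs as many
  consecutive lattice points as this degree. The forms \<open>-w\<^sub>j e\<^sub>i + w\<^sub>i e\<^sub>j\<close> with \<open>w\<^sub>i > 0 > w\<^sub>j\<close>
  provide them.\<close>

lemma segment_window:
  assumes g: "nonneg \<gamma>" and z: "z \<in> above (\<gamma> + d *s neg_part w)"
  obtains p q where "\<And>i. 0 < w $ i \<Longrightarrow> p * w $ i \<le> z $ i - \<gamma> $ i"
    "\<And>i. w $ i < 0 \<Longrightarrow> q * (- w $ i) \<le> z $ i - \<gamma> $ i"
    "\<And>i. w $ i = 0 \<Longrightarrow> \<gamma> $ i \<le> z $ i"
    "d - 1 \<le> p + q"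
proof -
  let ?P = "{i. 0 < w $ i}" and ?N = "{i. w $ i < 0}"
  let ?f = "\<lambda>i. (z $ i - \<gamma> $ i) div \<bar>w $ i\<bar>"
  \<comment> \<open>From \<open>z - \<gamma>\<close> one can go \<open>p\<close> steps against
    \<open>w\<close> and \<open>q\<close> steps along \<open>w\<close> before a coordinate with
    nonzero entry of \<open>w\<close> becomes negative. Both may be negative numbers.\<close>
  define p q where "p = Min (?f ` ?P)" and "q = Min (?f ` ?N)"
  have ne: "?f ` ?P \<noteq> {}" "?f ` ?N \<noteq> {}" using pos_entry neg_entry by auto
  have above: "form c (\<gamma> + d *s neg_part w) \<le> form c z" if "nonneg c" "form c w = 0" for c
    using z that unfolding above_def by blast
  have bound: "k * \<bar>w $ i\<bar> \<le> z $ i - \<gamma> $ i" if "k \<le> ?f i" "w $ i \<noteq> 0" for k i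
  proof -
    have "k * \<bar>w $ i\<bar> \<le> ?f i * \<bar>w $ i\<bar>" using that by (intro mult_right_mono) auto
    also have "\<dots> \<le> z $ i - \<gamma> $ i"
      using that(2) by (metis div_mult_mod_eq le_add_same_cancel1 pos_mod_sign zero_less_abs_iff)
    finally show ?thesis .
  qed
  show ?thesis
  proof (rule that)
    show "p * w $ i \<le> z $ i - \<gamma> $ i" if "0 < w $ i" for i
      using bound[of p i] that unfolding p_def by simp
    show "q * (- w $ i) \<le> z $ i - \<gamma> $ i" if "w $ i < 0" for i
      using bound[of q i] that unfolding q_def by simp
    show "\<gamma> $ i \<le> z $ i" if "w $ i = 0" for i
      using above[of "axis i 1"] that by (simp add: form_axis nonneg_axis neg_part_def)
    have "p \<in> ?f ` ?P" unfolding p_def by (rule Min_in[OF _ ne(1)]) simp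
    moreover have "q \<in> ?f ` ?N" unfolding q_def by (rule Min_in[OF _ ne(2)]) simp
    ultimately obtain i j where ij: "0 < w $ i" "p = ?f i" "w $ j < 0" "q = ?f j" by blast
    let ?c = "axis i (- w $ j) + axis j (w $ i)"
    have "nonneg ?c" using ij by (auto simp: nonneg_def axis_def)
    moreover have "form ?c w = 0" by (simp add: form_add_left form_axis)
    ultimately have "form ?c (\<gamma> + d *s neg_part w) \<le> form ?c z" by (rule above)
    then have ge: "d * (w $ i * (- w $ j)) \<le> (- w $ j) * (z $ i - \<gamma> $ i) + w $ i * (z $ j - \<gamma> $ j)"
      using ij by (simp add: form_add_left form_axis neg_part_def algebra_simps)
    \<comment> \<open>Each of the two floors loses less than one step. Therefore
      \<open>d < p + q + 2\<close>, that is, the window has \<open>p + q + 1 \<ge> d\<close>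
      points.\<close>
    have less: "a < (a div \<bar>b\<bar> + 1) * \<bar>b\<bar>" if "b \<noteq> 0" for a b :: int
      using that by (metis add.commute distrib_left div_mult_mod_eq less_add_same_cancel1 add_less_cancel_left
        distrib_right mult_1 pos_mod_bound zero_less_abs_iff)
    have "z $ i - \<gamma> $ i < (p + 1) * w $ i" "z $ j - \<gamma> $ j < (q + 1) * (- w $ j)"
      using less[of "w $ i" "z $ i - \<gamma> $ i"] less[of "w $ j" "z $ j - \<gamma> $ j"] ij by simp_all
    then have "(- w $ j) * (z $ i - \<gamma> $ i) < (- w $ j) * ((p + 1) * w $ i)"
      "w $ i * (z $ j - \<gamma> $ j) < w $ i * ((q + 1) * (- w $ j))"
      using ij by (simp_all del: mult_minus_left mult_minus_right)
    with ge have "d * (w $ i * (- w $ j)) < (p + q + 2) * (w $ i * (- w $ j))"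
      by (simp add: algebra_simps)
    moreover have "0 < w $ i * (- w $ j)" using ij by (simp add: mult_pos_neg)
    ultimately show "d - 1 \<le> p + q" by (simp only: mult_less_cancel_right) linarith
  qed
qed


text \<open>On the line through \<open>z\<close> in direction \<open>w\<close> the problem concerns
  polynomials in one variable: \<open>z\<close> corresponds to \<open>t^P\<close>, and
  \<open>t^P = t^e g u + h v\<close> is solved over the residue field with
  \<open>degree u < degree h\<close>. By \<open>segment_window\<close> the exponents of
  \<open>U\<close> and \<open>V\<close> are then non-negative. Lifting the coefficients leaves an
  error of higher level.\<close>

lemma division:
  fixes g h :: "'a residue_field poly" and \<gamma> :: "int ^ 'n"
  defines "a0 \<equiv> \<gamma> + int (degree g) *s neg_part w" and "b0 \<equiv> int (degree h) *s neg_part w"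
  assumes \<gamma>: "nonneg \<gamma>" and co: "comaximal g h" and h0: "coeff h 0 \<noteq> 0"
    and G: "map_poly residue G = g" "degree G \<le> degree g"
    and H: "map_poly residue H = h" "degree H \<le> degree h"
    and z: "z \<in> above (a0 + b0)"
  shows "\<exists>U V. U \<in> above_ideal b0 (level z - level a0) \<and> V \<in> above_ideal a0 (level z - level b0) \<and>
    int_monomial x z - ev a0 G * U - ev b0 H * V \<in> above_ideal (a0 + b0) (level z + 1)"
proof -
  let ?m = "degree g" and ?n = "degree h"
  have sum_eq: "a0 + b0 = \<gamma> + int (?m + ?n) *s neg_part w"
    by (simp add: a0_def b0_def vec_eq_iff algebra_simps)
  obtain p' q' where p': "\<And>i. 0 < w $ i \<Longrightarrow> p' * w $ i \<le> z $ i - \<gamma> $ i"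
    and q': "\<And>i. w $ i < 0 \<Longrightarrow> q' * (- w $ i) \<le> z $ i - \<gamma> $ i"
    and zero: "\<And>i. w $ i = 0 \<Longrightarrow> \<gamma> $ i \<le> z $ i" and pq': "int (?m + ?n) - 1 \<le> p' + q'"
    using segment_window[OF \<gamma> z[unfolded sum_eq]] by blast
  \<comment> \<open>After clipping at 0 the window contains \<open>z\<close> itself. The unclipped
    \<open>p'\<close> and \<open>q'\<close> still govern \<open>U\<close>, because \<open>G\<close>
    carries the additional monomial with exponent \<open>\<gamma>\<close>.\<close>
  define p q where "p = max 0 p'" and "q = max 0 q'"
  have nn: "0 \<le> z $ i" "0 \<le> \<gamma> $ i" for i
    using z \<gamma> by (auto simp: above_def nonneg_def)
  have p: "p * w $ i \<le> z $ i" if "0 < w $ i" for i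
    using p'[OF that] nn[of i] by (auto simp: p_def max_def)
  have q: "q * (- w $ i) \<le> z $ i" if "w $ i < 0" for i
    using q'[OF that] nn[of i] by (auto simp: q_def max_def)
  have pq: "0 \<le> p" "0 \<le> q" "p' \<le> p" "q' \<le> q" by (auto simp: p_def q_def)
  have line_nonneg: "nonneg (z + k *s w)" if "- p \<le> k" "k \<le> q" for k
    unfolding nonneg_def
  proof
    fix i
    consider "0 < w $ i" | "w $ i < 0" | "w $ i = 0" by linarith
    then show "0 \<le> (z + k *s w) $ i"
    proof cases
      case 1
      then have "(- p) * w $ i \<le> k * w $ i" using that by (intro mult_right_mono) auto
      then show ?thesis using p[OF 1] by simp
    next
      case 2
      then have "k * (- w $ i) \<le> q * (- w $ i)" using that by (intro mult_right_mono) auto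
      then show ?thesis using q[OF 2] by simp
    qed (use nn in simp)
  qed
  have U_nonneg: "nonneg (z - a0 + k *s w)" if "- p' \<le> k" "k \<le> q' - int ?m" for k
    unfolding nonneg_def
  proof
    fix i
    consider "0 < w $ i" | "w $ i < 0" | "w $ i = 0" by linarith
    then show "0 \<le> (z - a0 + k *s w) $ i"
    proof cases
      case 1
      then have "(- p') * w $ i \<le> k * w $ i" using that by (intro mult_right_mono) auto
      then show ?thesis using p'[OF 1] 1 by (simp add: a0_def neg_part_def)
    next
      case 2
      then have "(k + int ?m) * (- w $ i) \<le> q' * (- w $ i)" using that by (intro mult_right_mono) auto
      then show ?thesis using q'[OF 2] 2 by (simp add: a0_def neg_part_def algebra_simps)
    qed (use zero in \<open>simp add: a0_def neg_part_def\<close>)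
  qed
  have V_nonneg: "nonneg (z - b0 + k *s w)" if "- p \<le> k" "k \<le> q - int ?n" for k
    unfolding nonneg_def
  proof
    fix i
    consider "0 < w $ i" | "w $ i < 0" | "w $ i = 0" by linarith
    then show "0 \<le> (z - b0 + k *s w) $ i"
    proof cases
      case 1
      then have "(- p) * w $ i \<le> k * w $ i" using that by (intro mult_right_mono) auto
      then show ?thesis using p[OF 1] 1 by (simp add: b0_def neg_part_def)
    next
      case 2
      then have "(k + int ?n) * (- w $ i) \<le> q * (- w $ i)" using that by (intro mult_right_mono) auto
      then show ?thesis using q[OF 2] 2 by (simp add: b0_def neg_part_def algebra_simps)
    qed (use nn in \<open>simp add: b0_def neg_part_def\<close>)
  qed
  \<comment> \<open>Counting along the line from \<open>z + (- p) *s w\<close>, \<open>P\<close> is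
    the position of \<open>z\<close>, and \<open>e\<close> is the position at which the product of
    \<open>G\<close> and \<open>U\<close> starts.\<close>
  define P e where "P = nat p" and "e = nat (p - p')"
  have Pe: "int P = p" "int e = p - p'" using pq by (auto simp: P_def e_def)
  have "h \<noteq> 0" using h0 by auto
  \<comment> \<open>The two products start at different points of the line. The compensating factor
    \<open>t^e\<close> does no harm to comaximality since \<open>h\<close> has a nonzero constant
    term.\<close>
  have "comaximal (monom 1 e * g) h"
    by (rule comaximal_mult[OF comaximal_monom[OF h0] co])
  then obtain u v where uv: "monom 1 P = monom 1 e * g * u + h * v" "u = 0 \<or> degree u < ?n"
    using comaximal_solve_small[OF _ \<open>h \<noteq> 0\<close>] by blast
  have deg_u: "int (degree (monom 1 e * g * u)) \<le> p + q" if "u \<noteq> 0"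
  proof -
    have "degree (monom 1 e * g * u) \<le> degree (monom (1::'a residue_field) e * g) + degree u"
      by (rule degree_mult_le)
    also have "degree (monom (1::'a residue_field) e * g) \<le> degree (monom (1::'a residue_field) e) + ?m"
      by (rule degree_mult_le)
    also have "degree (monom (1::'a residue_field) e) = e" by (simp add: degree_monom_eq)
    finally show ?thesis using uv(2) that pq' pq Pe by linarith
  qed
  have deg_v: "int ?n + int (degree v) \<le> p + q" if "v \<noteq> 0"
  proof -
    have "?n + degree v = degree (h * v)" using that \<open>h \<noteq> 0\<close> by (simp add: degree_mult_eq)
    also have "h * v = monom 1 P - monom 1 e * g * u" using uv(1) by (simp add: algebra_simps)
    also have "degree \<dots> \<le> max (degree (monom (1::'a residue_field) P)) (degree (monom 1 e * g * u))"
      by (rule degree_diff_le_max)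
    also have "\<dots> \<le> nat (p + q)"
    proof (cases "u = 0")
      case True
      then show ?thesis using Pe pq by (simp add: degree_monom_eq)
    next
      case False
      then have "degree (monom 1 e * g * u) \<le> nat (p + q)" "P \<le> nat (p + q)"
        using deg_u Pe pq by linarith+
      then show ?thesis by (simp add: degree_monom_eq)
    qed
    finally show ?thesis using pq by linarith
  qed
  obtain u' where u': "map_poly residue u' = u" "degree u' \<le> degree u" "u = 0 \<Longrightarrow> u' = 0"
    using lift_poly by blast
  obtain v' where v': "map_poly residue v' = v" "degree v' \<le> degree v" "v = 0 \<Longrightarrow> v' = 0"
    using lift_poly by blast
  define U V where "U = ev (z - a0 + (- p') *s w) u'" and "V = ev (z - b0 + (- p) *s w) v'"
  have U_pt: "z - a0 + (- p') *s w + int i *s w = z - a0 + (int i - p') *s w" for i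
    by (simp add: vec_eq_iff algebra_simps)
  have V_pt: "z - b0 + (- p) *s w + int i *s w = z - b0 + (int i - p) *s w" for i
    by (simp add: vec_eq_iff algebra_simps)
  have U_nn: "nonneg (z - a0 + (int i - p') *s w)" if "i \<le> degree u'" "u' \<noteq> 0" for i
  proof (rule U_nonneg)
    have "degree u < ?n" "i \<le> degree u" using that u' uv(2) by auto
    then show "int i - p' \<le> q' - int ?m" using pq' by linarith
  qed simp
  have V_nn: "nonneg (z - b0 + (int i - p) *s w)" if "i \<le> degree v'" "v' \<noteq> 0" for i
  proof (rule V_nonneg)
    have "v \<noteq> 0" "i \<le> degree v" using that v' by auto
    then show "int i - p \<le> q - int ?n" using deg_v by linarith
  qed simp
  have "U \<in> above_ideal b0 (level z - level a0)"
    unfolding U_def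
  proof (rule ev_mem_above_ideal, unfold U_pt)
    fix i assume "i \<le> degree u'" "u' \<noteq> 0"
    then show "z - a0 + (int i - p') *s w \<in> above b0 \<and>
        level z - level a0 \<le> level (z - a0 + (int i - p') *s w)"
      using above_translate[OF z U_nn] by (simp only: level_translate form_diff order_refl)
        (simp add: algebra_simps)
  qed
  moreover have "V \<in> above_ideal a0 (level z - level b0)"
    unfolding V_def
  proof (rule ev_mem_above_ideal, unfold V_pt)
    fix i assume "i \<le> degree v'" "v' \<noteq> 0"
    then show "z - b0 + (int i - p) *s w \<in> above a0 \<and>
        level z - level b0 \<le> level (z - b0 + (int i - p) *s w)"
      using above_translate[OF z V_nn] by (simp only: level_translate form_diff order_refl)
        (simp add: algebra_simps)
  qed
  moreover have "int_monomial x z - ev a0 G * U - ev b0 H * V \<in> above_ideal (a0 + b0) (level z + 1)"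
  proof -
    let ?z = "z + (- p) *s w"
    \<comment> \<open>All three terms are brought to the base point \<open>?z\<close>, where their
      difference becomes one polynomial; its residue vanishes by the identity for \<open>u\<close>
      and \<open>v\<close>.\<close>
    let ?R = "monom 1 P - monom 1 e * (G * u') - H * v'"
    have line_pt: "?z + int i *s w = z + (int i - p) *s w" for i
      by (simp add: vec_eq_iff algebra_simps)
    have "ev ?z (monom 1 P) = ev ?z (monom 1 P * 1)" by simp
    also have "\<dots> = ev (?z + int P *s w) 1" by (rule line_sum_monom_mult) simp
    also have "?z + int P *s w = z" by (simp add: Pe vec_eq_iff)
    finally have ev_P: "ev ?z (monom 1 P) = int_monomial x z" by (simp add: line_sum_def)
    have "ev a0 G * U = ev (a0 + (z - a0 + (- p') *s w)) (G * u')"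
      unfolding U_def
    proof (rule line_sum_mult)
      fix i j assume ij: "i \<le> degree G" "j \<le> degree u'" "u' \<noteq> 0"
      have "nonneg (int ?m *s neg_part w + int i *s w)" using ij G by (intro nonneg_neg_part_translate) auto
      then have "nonneg (a0 + int i *s w)"
        using \<gamma> by (auto simp: nonneg_def a0_def add.assoc)
      then show "int_monomial x (a0 + int i *s w) * int_monomial x (z - a0 + (- p') *s w + int j *s w) =
          int_monomial x (a0 + int i *s w + (z - a0 + (- p') *s w + int j *s w))"
        using U_nn[OF ij(2,3)] unfolding U_pt by (rule int_monomial_add[symmetric])
    qed simp_all
    also have "a0 + (z - a0 + (- p') *s w) = ?z + int e *s w"
      by (simp add: Pe vec_eq_iff algebra_simps)
    also have "ev (?z + int e *s w) (G * u') = ev ?z (monom 1 e * (G * u'))"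
      by (rule line_sum_monom_mult[symmetric]) simp
    finally have ev_U: "ev a0 G * U = ev ?z (monom 1 e * (G * u'))" .
    have "ev b0 H * V = ev (b0 + (z - b0 + (- p) *s w)) (H * v')"
      unfolding V_def
    proof (rule line_sum_mult)
      fix i j assume ij: "i \<le> degree H" "j \<le> degree v'" "v' \<noteq> 0"
      have "nonneg (b0 + int i *s w)" unfolding b0_def using ij H by (intro nonneg_neg_part_translate) auto
      then show "int_monomial x (b0 + int i *s w) * int_monomial x (z - b0 + (- p) *s w + int j *s w) =
          int_monomial x (b0 + int i *s w + (z - b0 + (- p) *s w + int j *s w))"
        using V_nn[OF ij(2,3)] unfolding V_pt by (rule int_monomial_add[symmetric])
    qed simp_all
    also have "b0 + (z - b0 + (- p) *s w) = ?z" by (simp add: vec_eq_iff)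
    finally have ev_V: "ev b0 H * V = ev ?z (H * v')" .
    have "int_monomial x z - ev a0 G * U - ev b0 H * V = ev ?z ?R"
      unfolding ev_P[symmetric] ev_U ev_V by (simp add: line_sum_diff)
    also have "\<dots> \<in> above_ideal (a0 + b0) (level ?z + 1)"
    proof (rule ev_mem_above_ideal_Suc)
      show "map_poly residue ?R = 0"
        using uv(1) by (simp add: map_poly_residue_diff map_poly_residue_mult map_poly_residue_monom_1
          G(1) H(1) u'(1) v'(1) mult.assoc)
      fix i assume "i \<le> degree ?R"
      also have "\<dots> \<le> nat (p + q)"
      proof (intro degree_diff_le)
        show "degree (monom (1::'a) P) \<le> nat (p + q)"
          using degree_monom_le[of "1::'a" P] Pe pq by linarith
        show "degree (monom 1 e * (G * u')) \<le> nat (p + q)"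
        proof (cases "u = 0")
          case False
          have "degree (monom 1 e * (G * u')) \<le> degree (monom (1::'a) e) + degree (G * u')"
            by (rule degree_mult_le)
          also have "\<dots> \<le> e + (degree G + degree u')"
            by (intro add_mono degree_mult_le degree_monom_le)
          finally show ?thesis using G(2) u'(2) uv(2) False pq' pq Pe by linarith
        qed (use u' in simp)
        show "degree (H * v') \<le> nat (p + q)"
        proof (cases "v = 0")
          case False
          then show ?thesis using degree_mult_le[of H v'] H(2) v'(2) deg_v by linarith
        qed (use v' in simp)
      qed
      finally have "int i - p \<le> q" using pq by linarith
      then have "nonneg (z + (int i - p) *s w)" by (intro line_nonneg) auto
      then show "?z + int i *s w \<in> above (a0 + b0)"
        using above_translate[OF z, of 0 "int i - p"] unfolding line_pt by simp
    qed
    also have "level ?z = level z" by (rule level_translate)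
    finally show ?thesis .
  qed
  ultimately show ?thesis by blast
qed


text \<open>For fixed \<open>s\<close> the elements that admit such a division form an ideal, so the
  monomial generators treated in \<open>division\<close> suffice.\<close>

lemma division_ideal:
  fixes g h :: "'a residue_field poly" and \<gamma> :: "int ^ 'n"
  defines "a0 \<equiv> \<gamma> + int (degree g) *s neg_part w" and "b0 \<equiv> int (degree h) *s neg_part w"
  assumes "nonneg \<gamma>" "comaximal g h" "coeff h 0 \<noteq> 0"
    and "map_poly residue G = g" "degree G \<le> degree g"
    and "map_poly residue H = h" "degree H \<le> degree h"
    and r: "r \<in> above_ideal (a0 + b0) s"
  shows "\<exists>U V. U \<in> above_ideal b0 (s - level a0) \<and> V \<in> above_ideal a0 (s - level b0) \<and>
    r - ev a0 G * U - ev b0 H * V \<in> above_ideal (a0 + b0) (s + 1)"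
proof -
  define X where "X = {r. \<exists>U V. U \<in> above_ideal b0 (s - level a0) \<and> V \<in> above_ideal a0 (s - level b0) \<and>
    r - ev a0 G * U - ev b0 H * V \<in> above_ideal (a0 + b0) (s + 1)}"
  have XI: "r \<in> X" if "U \<in> above_ideal b0 (s - level a0)" "V \<in> above_ideal a0 (s - level b0)"
    "r - ev a0 G * U - ev b0 H * V \<in> above_ideal (a0 + b0) (s + 1)" for r U V
    using that unfolding X_def by blast
  note ideal = is_ideal_above_ideal
  have "is_ideal X"
    unfolding is_ideal_def
  proof (intro conjI ballI allI)
    show "0 \<in> X" by (rule XI[of 0 0]) (simp_all add: ideal_zero_mem[OF ideal])
  next
    fix a b assume "a \<in> X" "b \<in> X"
    then obtain U V U' V' where *: "U \<in> above_ideal b0 (s - level a0)" "V \<in> above_ideal a0 (s - level b0)"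
      "a - ev a0 G * U - ev b0 H * V \<in> above_ideal (a0 + b0) (s + 1)"
      "U' \<in> above_ideal b0 (s - level a0)" "V' \<in> above_ideal a0 (s - level b0)"
      "b - ev a0 G * U' - ev b0 H * V' \<in> above_ideal (a0 + b0) (s + 1)" unfolding X_def by blast
    show "a + b \<in> X"
    proof (rule XI)
      show "U + U' \<in> above_ideal b0 (s - level a0)" "V + V' \<in> above_ideal a0 (s - level b0)"
        using * by (simp_all add: ideal_add_mem[OF ideal])
      have eq: "a + b - ev a0 G * (U + U') - ev b0 H * (V + V') =
          (a - ev a0 G * U - ev b0 H * V) + (b - ev a0 G * U' - ev b0 H * V')"
        by (simp add: algebra_simps)
      show "a + b - ev a0 G * (U + U') - ev b0 H * (V + V') \<in> above_ideal (a0 + b0) (s + 1)"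
        unfolding eq using * by (intro ideal_add_mem[OF ideal])
    qed
  next
    fix t a assume "a \<in> X"
    then obtain U V where *: "U \<in> above_ideal b0 (s - level a0)" "V \<in> above_ideal a0 (s - level b0)"
      "a - ev a0 G * U - ev b0 H * V \<in> above_ideal (a0 + b0) (s + 1)" unfolding X_def by blast
    show "t * a \<in> X"
    proof (rule XI)
      show "t * U \<in> above_ideal b0 (s - level a0)" "t * V \<in> above_ideal a0 (s - level b0)"
        using * by (simp_all add: ideal_mult_mem[OF ideal])
      have eq: "t * a - ev a0 G * (t * U) - ev b0 H * (t * V) = t * (a - ev a0 G * U - ev b0 H * V)"
        by (simp add: algebra_simps)
      show "t * a - ev a0 G * (t * U) - ev b0 H * (t * V) \<in> above_ideal (a0 + b0) (s + 1)"
        unfolding eq using * by (intro ideal_mult_mem[OF ideal])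
    qed
  qed
  moreover have "int_monomial x z \<in> X" if z: "z \<in> above (a0 + b0)" "s \<le> level z" for z
  proof -
    obtain U V where UV: "U \<in> above_ideal b0 (level z - level a0)" "V \<in> above_ideal a0 (level z - level b0)"
      "int_monomial x z - ev a0 G * U - ev b0 H * V \<in> above_ideal (a0 + b0) (level z + 1)"
      using division[OF assms(3-9), of z] z(1) unfolding a0_def b0_def by blast
    show ?thesis
    proof (rule XI)
      show "U \<in> above_ideal b0 (s - level a0)"
        using UV(1) above_ideal_antimono[of "s - level a0" "level z - level a0" b0] z(2) by auto
      show "V \<in> above_ideal a0 (s - level b0)"
        using UV(2) above_ideal_antimono[of "s - level b0" "level z - level b0" a0] z(2) by auto
      show "int_monomial x z - ev a0 G * U - ev b0 H * V \<in> above_ideal (a0 + b0) (s + 1)"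
        using UV(3) above_ideal_antimono[of "s + 1" "level z + 1" "a0 + b0"] z(2) by auto
    qed
  qed
  ultimately have "above_ideal (a0 + b0) s \<subseteq> X"
    unfolding above_ideal_def by (intro hull_minimal) auto
  then show ?thesis using r unfolding X_def by blast
qed

text \<open>Newton-like correction: dividing the error by the initial approximations yields
  \<open>U\<close> and \<open>V\<close>, and passing to \<open>G + V\<close> and
  \<open>H + U\<close> raises the level of the error by 1. Sequences are constructed because their
  limits exist only in the completion.\<close>

lemma hensel_sequences:
  fixes g h :: "'a residue_field poly" and \<gamma> :: "int ^ 'n"
  defines "a0 \<equiv> \<gamma> + int (degree g) *s neg_part w" and "b0 \<equiv> int (degree h) *s neg_part w"
  assumes \<gamma>: "nonneg \<gamma>" and co: "comaximal g h" and h0: "coeff h 0 \<noteq> 0"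
    and q: "map_poly residue q = g * h" "degree q \<le> degree g + degree h"
    and f: "f - ev (a0 + b0) q \<in> above_ideal (a0 + b0) (level (a0 + b0) + 1)"
  shows "\<exists>G H. (\<forall>k. G k \<in> above_ideal a0 (level a0)) \<and> (\<forall>k. H k \<in> above_ideal b0 (level b0)) \<and>
    (\<forall>k. G (Suc k) - G k \<in> above_ideal a0 (level a0 + int k + 1)) \<and>
    (\<forall>k. H (Suc k) - H k \<in> above_ideal b0 (level b0 + int k + 1)) \<and>
    (\<forall>k. f - G k * H k \<in> above_ideal (a0 + b0) (level (a0 + b0) + int k + 1))"
proof -
  obtain G0 where G0: "map_poly residue G0 = g" "degree G0 \<le> degree g" using lift_poly by blast
  obtain H0 where H0: "map_poly residue H0 = h" "degree H0 \<le> degree h" using lift_poly by blast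
  note ideal = is_ideal_above_ideal
  have pt_above: "p + int i *s w \<in> above p" if "nonneg (p + int i *s w)" for p i
    using that by (simp add: above_def form_add form_smult)
  have a_nn: "nonneg (a0 + int i *s w)" if "i \<le> degree g" for i
    using nonneg_neg_part_translate[OF that, of w] \<gamma> by (auto simp: nonneg_def a0_def add.assoc)
  have b_nn: "nonneg (b0 + int i *s w)" if "i \<le> degree h" for i
    using nonneg_neg_part_translate[OF that, of w] by (auto simp: b0_def)
  have ab_nn: "nonneg (a0 + b0 + int i *s w)" if "i \<le> degree g + degree h" for i
  proof -
    have "a0 + b0 + int i *s w = \<gamma> + (int (degree g + degree h) *s neg_part w + int i *s w)"
      by (simp add: a0_def b0_def vec_eq_iff algebra_simps)
    then show ?thesis using nonneg_neg_part_translate[OF that, of w] \<gamma> by (simp add: nonneg_def add.assoc)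
  qed
  define G1 H1 where "G1 = ev a0 G0" and "H1 = ev b0 H0"
  have G1: "G1 \<in> above_ideal a0 (level a0)" unfolding G1_def
    by (rule ev_mem_above_ideal) (use G0 a_nn in \<open>auto simp: level_translate intro!: pt_above\<close>)
  have H1: "H1 \<in> above_ideal b0 (level b0)" unfolding H1_def
    by (rule ev_mem_above_ideal) (use H0 b_nn in \<open>auto simp: level_translate intro!: pt_above\<close>)
  have GH1: "G1 * H1 = ev (a0 + b0) (G0 * H0)"
    unfolding G1_def H1_def
    by (rule line_sum_mult) (use G0 H0 a_nn b_nn in \<open>auto simp: int_monomial_add\<close>)
  let ?D = "level (a0 + b0)"
  have level_add: "?D = level a0 + level b0" by (rule form_add)
  have start: "f - G1 * H1 \<in> above_ideal (a0 + b0) (?D + 1)"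
  proof -
    have "ev (a0 + b0) (q - G0 * H0) \<in> above_ideal (a0 + b0) (?D + 1)"
    proof (rule ev_mem_above_ideal_Suc)
      show "map_poly residue (q - G0 * H0) = 0"
        by (simp add: map_poly_residue_diff map_poly_residue_mult q G0 H0)
      fix i assume "i \<le> degree (q - G0 * H0)"
      also have "\<dots> \<le> degree g + degree h"
        using q(2) degree_mult_le[of G0 H0] G0(2) H0(2) by (intro degree_diff_le) auto
      finally show "a0 + b0 + int i *s w \<in> above (a0 + b0)" by (intro pt_above ab_nn)
    qed
    then have "(f - ev (a0 + b0) q) + ev (a0 + b0) (q - G0 * H0) \<in> above_ideal (a0 + b0) (?D + 1)"
      using f ideal_add_mem[OF ideal] by blast
    then show ?thesis by (simp add: GH1 line_sum_diff)
  qed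
  \<comment> \<open>Division is always by the fixed \<open>G1\<close> and \<open>H1\<close>. The
    congruences to these keep the cross terms \<open>(G - G1) * U\<close> and
    \<open>V * (H - H1)\<close> one level higher than the error.\<close>
  define inv where "inv k p \<longleftrightarrow> fst p - G1 \<in> above_ideal a0 (level a0 + 1) \<and>
    snd p - H1 \<in> above_ideal b0 (level b0 + 1) \<and>
    f - fst p * snd p \<in> above_ideal (a0 + b0) (?D + int k + 1)" for k and p :: "'a \<times> 'a"
  define step where "step k p p' \<longleftrightarrow> fst p' - fst p \<in> above_ideal a0 (level a0 + int k + 1) \<and>
    snd p' - snd p \<in> above_ideal b0 (level b0 + int k + 1)" for k and p p' :: "'a \<times> 'a"
  have "\<exists>F. \<forall>k. inv k (F k) \<and> step k (F k) (F (Suc k))"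
  proof (rule dependent_nat_choice)
    show "\<exists>p. inv 0 p"
      by (rule exI[of _ "(G1, H1)"]) (simp add: inv_def start ideal_zero_mem[OF ideal])
  next
    fix p k assume p: "inv k p"
    let ?s = "?D + int k + 1"
    define G H where "G = fst p" and "H = snd p"
    have G: "G - G1 \<in> above_ideal a0 (level a0 + 1)" and H: "H - H1 \<in> above_ideal b0 (level b0 + 1)"
      and r: "f - G * H \<in> above_ideal (a0 + b0) ?s"
      using p by (simp_all add: inv_def G_def H_def)
    obtain U V where UV: "U \<in> above_ideal b0 (?s - level a0)" "V \<in> above_ideal a0 (?s - level b0)"
      "(f - G * H) - G1 * U - H1 * V \<in> above_ideal (a0 + b0) (?s + 1)"
      using division_ideal[OF \<gamma> co h0 G0 H0, folded a0_def b0_def, OF r] unfolding G1_def H1_def by blast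
    have U: "U \<in> above_ideal b0 (level b0 + int k + 1)" and V: "V \<in> above_ideal a0 (level a0 + int k + 1)"
      using UV(1,2) by (simp_all add: level_add algebra_simps)
    have U1: "U \<in> above_ideal b0 (level b0 + 1)" and V1: "V \<in> above_ideal a0 (level a0 + 1)"
      using U V above_ideal_antimono[of "level b0 + 1" "level b0 + int k + 1" b0]
        above_ideal_antimono[of "level a0 + 1" "level a0 + int k + 1" a0] by auto
    have 1: "(G - G1) * U \<in> above_ideal (a0 + b0) (?s + 1)"
      using above_ideal_mult[OF G U] by (simp add: level_add algebra_simps)
    have 2: "V * (H - H1) \<in> above_ideal (a0 + b0) (?s + 1)"
      using above_ideal_mult[OF V H] by (simp add: level_add algebra_simps)
    have 3: "V * U \<in> above_ideal (a0 + b0) (?s + 1)"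
      using above_ideal_mult[OF V U1] by (simp add: level_add algebra_simps)
    have "((f - G * H) - G1 * U - H1 * V) - (G - G1) * U - V * (H - H1) - V * U
        \<in> above_ideal (a0 + b0) (?s + 1)"
      by (rule is_ideal_diff[OF ideal is_ideal_diff[OF ideal is_ideal_diff[OF ideal UV(3) 1] 2] 3])
    moreover have "((f - G * H) - G1 * U - H1 * V) - (G - G1) * U - V * (H - H1) - V * U =
        f - (G + V) * (H + U)"
      by (simp add: algebra_simps)
    moreover have "(G - G1) + V \<in> above_ideal a0 (level a0 + 1)" "(H - H1) + U \<in> above_ideal b0 (level b0 + 1)"
      using G H U1 V1 by (simp_all only: ideal_add_mem[OF ideal])
    ultimately have "inv (Suc k) (G + V, H + U)"
      by (simp add: inv_def algebra_simps)
    moreover have "step k p (G + V, H + U)"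
      using U V by (simp add: step_def G_def H_def)
    ultimately show "\<exists>p'. inv (Suc k) p' \<and> step k p p'" by blast
  qed
  then obtain F where F: "\<And>k. inv k (F k)" "\<And>k. step k (F k) (F (Suc k))" by blast
  have "fst (F k) \<in> above_ideal a0 (level a0)" "snd (F k) \<in> above_ideal b0 (level b0)" for k
  proof -
    have "fst (F k) - G1 \<in> above_ideal a0 (level a0)" "snd (F k) - H1 \<in> above_ideal b0 (level b0)"
      using F(1)[of k] above_ideal_antimono[of "level a0" "level a0 + 1" a0]
        above_ideal_antimono[of "level b0" "level b0 + 1" b0] unfolding inv_def by auto
    then have "(fst (F k) - G1) + G1 \<in> above_ideal a0 (level a0)" "(snd (F k) - H1) + H1 \<in> above_ideal b0 (level b0)"
      using G1 H1 by (simp_all only: ideal_add_mem[OF ideal])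
    then show "fst (F k) \<in> above_ideal a0 (level a0)" "snd (F k) \<in> above_ideal b0 (level b0)" by simp_all
  qed
  then show ?thesis
    using F unfolding inv_def step_def
    by (intro exI[of _ "\<lambda>k. fst (F k)"] exI[of _ "\<lambda>k. snd (F k)"]) blast
qed


text \<open>The limits of the two Hensel sequences multiply to \<open>f\<close>. By
  \<open>nontrivial\<close> both base points have level at least 1, so every term of either sequence
  lies in \<open>max_ideal\<close> and neither limit is a unit.\<close>

theorem not_irreducible_if_initial_factors:
  fixes g h :: "'a residue_field poly" and \<gamma> :: "int ^ 'n"
  defines "a0 \<equiv> \<gamma> + int (degree g) *s neg_part w" and "b0 \<equiv> int (degree h) *s neg_part w"
  assumes \<gamma>: "nonneg \<gamma>" and co: "comaximal g h" and h0: "coeff h 0 \<noteq> 0"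
    and q: "map_poly residue q = g * h" "degree q \<le> degree g + degree h"
    and f: "f - ev (a0 + b0) q \<in> above_ideal (a0 + b0) (level (a0 + b0) + 1)"
    and nontrivial: "\<gamma> \<noteq> 0 \<or> degree g \<noteq> 0" "degree h \<noteq> 0"
  shows "\<not> irreducible (to_completion f)"
proof
  assume irred: "irreducible (to_completion f)"
  note ideal = is_ideal_above_ideal and pideal = is_ideal_power[of "max_ideal :: 'a set"]
  obtain G H where GH: "\<And>k. G k \<in> above_ideal a0 (level a0)" "\<And>k. H k \<in> above_ideal b0 (level b0)"
    "\<And>k. G (Suc k) - G k \<in> above_ideal a0 (level a0 + int k + 1)"
    "\<And>k. H (Suc k) - H k \<in> above_ideal b0 (level b0 + int k + 1)"
    "\<And>k. f - G k * H k \<in> above_ideal (a0 + b0) (level (a0 + b0) + int k + 1)"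
    using hensel_sequences[OF \<gamma> co h0 q, folded a0_def b0_def, OF f] by blast
  obtain C where C: "0 < C"
    and power: "\<And>p s k. int (C * k) \<le> s \<Longrightarrow> above_ideal p s \<subseteq> ideal_power max_ideal k"
    using above_ideal_subset_ideal_power by auto
  obtain j where j: "neg_part w $ j > 0" using neg_entry by (auto simp: neg_part_def less_max_iff_disj)
  have neg_nn: "nonneg (neg_part w)" by (simp add: nonneg_def neg_part_def)
  have "nonneg a0" "a0 \<noteq> 0"
  proof -
    show "nonneg a0" using \<gamma> neg_nn by (simp add: nonneg_def a0_def)
    show "a0 \<noteq> 0"
    proof
      assume "a0 = 0"
      then have sum0: "\<gamma> $ i + int (degree g) * neg_part w $ i = 0" for i
        by (metis a0_def vector_add_component vector_smult_component zero_index)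
      have *: "\<gamma> $ i = 0 \<and> int (degree g) * neg_part w $ i = 0" for i
        using sum0[of i] \<gamma> neg_nn by (simp add: nonneg_def add_nonneg_eq_0_iff)
      then have "\<gamma> = 0" "degree g = 0" using *[of j] j by (auto simp: vec_eq_iff)
      then show False using nontrivial by simp
    qed
  qed
  then have lev_a: "1 \<le> level a0" using level_form_pos by (intro form_pos) (auto simp: nonneg_def)
  have "nonneg b0" "b0 \<noteq> 0"
    using neg_nn j nontrivial(2) by (auto simp: b0_def nonneg_def vec_eq_iff intro!: exI[of _ j])
  then have lev_b: "1 \<le> level b0" using level_form_pos by (intro form_pos) (auto simp: nonneg_def)
  have lev_ab: "level (a0 + b0) = level a0 + level b0" by (rule form_add)
  have max_ideal: "above_ideal p (level p) \<subseteq> max_ideal" if "1 \<le> level p" for p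
    unfolding above_ideal_def
  proof (rule hull_minimal)
    show "{int_monomial x z | z. z \<in> above p \<and> level p \<le> level z} \<subseteq> max_ideal"
    proof clarify
      fix z assume z: "z \<in> above p" "level p \<le> level z"
      then have "z \<noteq> 0" using that by (auto simp: form_def)
      then obtain i where "z $ i \<noteq> 0" by (auto simp: vec_eq_iff)
      moreover have "0 \<le> z $ i" using z(1) by (simp add: above_def nonneg_def)
      ultimately have "0 < nat (z $ i)" by simp
      also have "\<dots> \<le> sum (\<lambda>i. nat (z $ i)) UNIV" by (rule member_le_sum) auto
      finally obtain k where "sum (\<lambda>i. nat (z $ i)) UNIV = Suc k" by (metis gr0_implies_Suc)
      then have "int_monomial x z \<in> ideal_power max_ideal (Suc k)"
        unfolding ideal_power_eq_power_products[OF gen] int_monomial_def by (intro hull_inc) blast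
      then show "int_monomial x z \<in> max_ideal"
        using ideal_power_Suc_0_subset[OF is_ideal_max_ideal] ideal_power_antimono[of "Suc 0" "Suc k" max_ideal]
        by auto
    qed
  qed (rule is_ideal_max_ideal)
  \<comment> \<open>A gain of \<open>C\<close> levels is worth one power of
    \<open>max_ideal\<close>. Taking every \<open>C\<close>-th term therefore gives successive
    differences in the power that \<open>compatible_seq\<close> demands.\<close>
  define s t where "s k = G (C * k)" and "t k = H (C * k)" for k
  have telescope: "F (m + i) - F m \<in> above_ideal p (l + int m)"
    if "\<And>k. F (Suc k) - F k \<in> above_ideal p (l + int k + 1)" for F p l m i
  proof (induction i)
    case (Suc i)
    have "F (Suc (m + i)) - F (m + i) \<in> above_ideal p (l + int m)"
      using that[of "m + i"] above_ideal_antimono[of "l + int m" "l + int (m + i) + 1" p] by auto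
    then have "(F (Suc (m + i)) - F (m + i)) + (F (m + i) - F m) \<in> above_ideal p (l + int m)"
      using Suc ideal_add_mem[OF ideal] by blast
    then show ?case by simp
  qed (simp add: ideal_zero_mem[OF ideal])
  have compat: "compatible_seq s" "compatible_seq t"
    unfolding compatible_seq_def
  proof (intro allI)
    fix k
    have "G (C * k + C) - G (C * k) \<in> above_ideal a0 (level a0 + int (C * k))"
      by (rule telescope[OF GH(3)])
    then show "s (Suc k) - s k \<in> ideal_power max_ideal k"
      using power[of k "level a0 + int (C * k)" a0] lev_a by (auto simp: s_def add.commute)
  next
    show "\<forall>k. t (Suc k) - t k \<in> ideal_power max_ideal k"
    proof
      fix k
      have "H (C * k + C) - H (C * k) \<in> above_ideal b0 (level b0 + int (C * k))"
        by (rule telescope[OF GH(4)])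
      then show "t (Suc k) - t k \<in> ideal_power max_ideal k"
        using power[of k "level b0 + int (C * k)" b0] lev_b by (auto simp: t_def add.commute)
    qed
  qed
  have "f - s k * t k \<in> ideal_power max_ideal k" for k
    using GH(5)[of "C * k"] power[of k "level (a0 + b0) + int (C * k) + 1" "a0 + b0"] lev_a lev_b lev_ab
    by (auto simp: s_def t_def)
  then have rel: "completion_rel (\<lambda>_. f) (\<lambda>k. s k * t k)"
    using compat by (simp add: completion_rel_def compatible_seq_intros)
  have "to_completion f = abs_completion (\<lambda>_. f)" by (simp add: to_completion_def)
  also have "\<dots> = abs_completion (\<lambda>k. s k * t k)"
    by (rule Quotient_rel_abs[OF Quotient_completion]) (rule rel)
  also have "\<dots> = abs_completion s * abs_completion t"
    by (rule times_completion.abs_eq[symmetric]) (simp_all add: completion_rel_refl compat)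
  finally have "abs_completion s dvd 1 \<or> abs_completion t dvd 1"
    using irred unfolding irreducible_def by blast
  moreover have "\<not> abs_completion s dvd 1" if "compatible_seq s" "\<And>k. s k \<in> max_ideal" for s :: "nat \<Rightarrow> 'a"
  proof
    assume "abs_completion s dvd 1"
    then obtain c where c: "1 = abs_completion s * c" by (rule dvdE)
    obtain r where r: "completion_rel r r" "c = abs_completion r"
      using Quotient_rep_abs[OF Quotient_completion] Quotient_abs_rep[OF Quotient_completion]
        Quotient_rep_reflp[OF Quotient_completion] by metis
    have "abs_completion (\<lambda>_. 1) = abs_completion (\<lambda>k. s k * r k)"
      using c r that(1) by (simp add: one_completion.abs_eq[symmetric] times_completion.abs_eq completion_rel_refl)
    moreover have "completion_rel (\<lambda>_. 1 :: 'a) (\<lambda>_. 1)" "completion_rel (\<lambda>k. s k * r k) (\<lambda>k. s k * r k)"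
      using r(1) that(1) by (simp_all add: completion_rel_refl compatible_seq_intros completion_rel_def
        ideal_zero_mem[OF is_ideal_power])
    ultimately have "completion_rel (\<lambda>_. 1) (\<lambda>k. s k * r k)"
      using Quotient_rel[OF Quotient_completion] by metis
    then have "1 - s (Suc 0) * r (Suc 0) \<in> max_ideal"
      using ideal_power_Suc_0_subset[OF is_ideal_max_ideal] unfolding completion_rel_def by blast
    moreover have "s (Suc 0) * r (Suc 0) \<in> max_ideal"
      using ideal_mult_mem[OF is_ideal_max_ideal that(2)[of "Suc 0"], of "r (Suc 0)"] by (simp add: mult.commute)
    ultimately have "(1 - s (Suc 0) * r (Suc 0)) + s (Suc 0) * r (Suc 0) \<in> max_ideal"
      by (rule ideal_add_mem[OF is_ideal_max_ideal])
    then show False by (simp add: one_notin_max_ideal)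
  qed
  moreover have "s k \<in> max_ideal" "t k \<in> max_ideal" for k
    using GH(1,2) max_ideal[OF lev_a] max_ideal[OF lev_b] by (auto simp: s_def t_def)
  ultimately show False using compat by blast
qed

end

section \<open>Powers of irreducible polynomials\<close>

text \<open>A nonconstant divisor of least degree is irreducible; it is made monic by
  scaling.\<close>

lemma exists_irreducible_factor:
  fixes q :: "'k::field poly"
  assumes "degree q > 0"
  obtains p where "irreducible p" "lead_coeff p = 1" "p dvd q"
proof -
  obtain p where p: "p dvd q" "degree p > 0"
    and least: "\<And>r. r dvd q \<Longrightarrow> degree r > 0 \<Longrightarrow> degree p \<le> degree r"
    using ex_has_least_nat[of "\<lambda>p. p dvd q \<and> degree p > 0" q degree] assms by auto
  let ?p = "smult (inverse (lead_coeff p)) p"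
  have "p \<noteq> 0" using p by auto
  have unit: "a dvd 1" if "a \<noteq> 0" "degree a = 0" for a :: "'k poly"
    using that by (simp add: is_unit_iff_degree)
  have dvd: "?p dvd q" using p(1) \<open>p \<noteq> 0\<close> by (simp add: smult_dvd_iff)
  have "irreducible ?p"
  proof (rule irreducibleI)
    show "?p \<noteq> 0" using \<open>p \<noteq> 0\<close> by simp
    then show "\<not> ?p dvd 1" using p \<open>p \<noteq> 0\<close> by (simp add: is_unit_iff_degree)
    fix a b assume ab: "?p = a * b"
    then have ne: "a \<noteq> 0" "b \<noteq> 0" using \<open>?p \<noteq> 0\<close> by auto
    have "a dvd ?p" unfolding ab by simp
    then have "a dvd q" using dvd dvd_trans by blast
    show "a dvd 1 \<or> b dvd 1"
    proof (cases "degree a = 0")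
      case False
      then have "degree p \<le> degree a" using least \<open>a dvd q\<close> by blast
      moreover have "degree p = degree a + degree b"
        using arg_cong[OF ab, of degree] ne \<open>p \<noteq> 0\<close> by (simp add: degree_mult_eq)
      ultimately show ?thesis using unit[OF ne(2)] by simp
    qed (use unit ne in blast)
  qed
  moreover have "lead_coeff ?p = 1" using \<open>p \<noteq> 0\<close> by simp
  ultimately show ?thesis using dvd by (rule that)
qed

text \<open>A nonzero element \<open>d\<close> of least degree in the ideal generated by
  \<open>p\<close> and \<open>r\<close> divides both. If it were not a unit, it would be associated
  to \<open>p\<close>, and \<open>p\<close> would divide \<open>r\<close>.\<close>

lemma comaximal_irreducible:
  fixes p r :: "'k::field poly"
  assumes "irreducible p" "\<not> p dvd r"
  shows "comaximal p r"
proof -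
  define S where "S = {u * p + v * r | u v. True}"
  have "1 * p + 0 * r \<in> S" unfolding S_def by blast
  then have "p \<in> S" by simp
  moreover have "p \<noteq> 0" using assms(1) by auto
  ultimately obtain d where d: "d \<in> S" "d \<noteq> 0"
    and least: "\<And>e. e \<in> S \<Longrightarrow> e \<noteq> 0 \<Longrightarrow> degree d \<le> degree e"
    using ex_has_least_nat[of "\<lambda>d. d \<in> S \<and> d \<noteq> 0" p degree] by auto
  obtain u v where uv: "d = u * p + v * r" using d(1) unfolding S_def by blast
  have "d dvd a * p + b * r" for a b
  proof -
    let ?e = "(a * p + b * r) mod d"
    have "?e = (a - u * ((a * p + b * r) div d)) * p + (b - v * ((a * p + b * r) div d)) * r"
      unfolding minus_div_mult_eq_mod[symmetric] by (subst (2) uv) (simp add: algebra_simps)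
    then have "?e \<in> S" unfolding S_def by blast
    then have "?e = 0" using least[of ?e] degree_mod_less[OF d(2), of "a * p + b * r"] by force
    then show ?thesis by (simp add: dvd_eq_mod_eq_0)
  qed
  from this[of 1 0] this[of 0 1] have dvd: "d dvd p" "d dvd r" by simp_all
  then obtain s where s: "p = d * s" by blast
  have "d dvd 1 \<or> s dvd 1" using assms(1) s by (rule irreducibleD)
  then show ?thesis
  proof
    assume "d dvd 1"
    then obtain c where "1 = d * c" by blast
    then have "(c * u) * p + (c * v) * r = 1" unfolding uv by (simp add: algebra_simps)
    then show ?thesis unfolding comaximal_def by blast
  next
    assume "s dvd 1"
    then have "d * s dvd d" using mult_dvd_mono[of d d s 1] by simp
    then have "p dvd d" using s by simp
    then show ?thesis using dvd(2) assms(2) dvd_trans by blast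
  qed
qed

text \<open>Once the highest power of an irreducible factor \<open>p\<close> is split off, the
  cofactor is comaximal to that power, hence constant by \<open>no_factors\<close>.\<close>

lemma power_irreducible_or_comaximal_factors:
  fixes q :: "'k::field poly"
  assumes q: "degree q > 0"
    and no_factors: "\<And>g h. q = g * h \<Longrightarrow> comaximal g h \<Longrightarrow> degree g = 0 \<or> degree h = 0"
  obtains c p k where "c \<noteq> 0" "irreducible p" "lead_coeff p = 1" "k \<ge> 1" "q = smult c (p ^ k)"
proof -
  obtain p where p: "irreducible p" "lead_coeff p = 1" "p dvd q"
    using exists_irreducible_factor[OF q] .
  have "p \<noteq> 0" "q \<noteq> 0" using p(1) q by auto
  have deg_p: "degree p > 0" using p(1) \<open>p \<noteq> 0\<close> by (auto simp: irreducible_def is_unit_iff_degree)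
  have "k \<le> degree q" if "p ^ k dvd q" for k
  proof -
    have "k \<le> k * degree p" using deg_p by simp
    also have "\<dots> = degree (p ^ k)" by (simp add: degree_power_eq \<open>p \<noteq> 0\<close>)
    also have "\<dots> \<le> degree q" using that \<open>q \<noteq> 0\<close> by (rule dvd_imp_degree_le)
    finally show ?thesis .
  qed
  then obtain k where k: "p ^ k dvd q" "\<And>j. p ^ j dvd q \<Longrightarrow> j \<le> k"
    using ex_has_greatest_nat[of "\<lambda>k. p ^ k dvd q" 0 "\<lambda>k. k" "Suc (degree q)"]
    by (auto simp: less_Suc_eq_le)
  have "k \<ge> 1" using k(2)[of 1] p(3) by simp
  obtain r where r: "q = p ^ k * r" using k(1) by blast
  have "\<not> p dvd r"
  proof
    assume "p dvd r"
    then have "p ^ Suc k dvd q" unfolding r by (simp add: mult_dvd_mono mult.commute)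
    then show False using k(2)[of "Suc k"] by simp
  qed
  then have "comaximal (p ^ k) r" by (intro comaximal_power_left comaximal_irreducible p(1))
  moreover have "degree (p ^ k) \<noteq> 0" using deg_p \<open>k \<ge> 1\<close> by (simp add: degree_power_eq \<open>p \<noteq> 0\<close>)
  ultimately have "degree r = 0" using no_factors[OF r] by simp
  then obtain c where c: "r = [:c:]" by (rule degree_eq_zeroE)
  then have "q = smult c (p ^ k)" "c \<noteq> 0" using r \<open>q \<noteq> 0\<close> by auto
  then show ?thesis using that p(1,2) \<open>k \<ge> 1\<close> by blast
qed

lemma irreducible_algebraically_closed:
  fixes p :: "'k::field poly"
  assumes "irreducible p" "lead_coeff p = 1" "algebraically_closed TYPE('k)"
  obtains c where "p = [:c, 1:]"
proof -
  have "p \<noteq> 0" using assms(1) by auto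
  then have "degree p > 0" using assms(1) by (auto simp: irreducible_def is_unit_iff_degree)
  then obtain z where "poly p z = 0" using assms(3) unfolding algebraically_closed_def by blast
  then obtain r where r: "p = [:- z, 1:] * r" by (auto simp: poly_eq_0_iff_dvd)
  have "\<not> [:- z, 1:] dvd 1" by (simp add: is_unit_iff_degree)
  then have "r dvd 1" using irreducibleD[OF assms(1) r] by blast
  moreover have "r \<noteq> 0" using r \<open>p \<noteq> 0\<close> by auto
  ultimately obtain c where c: "r = [:c:]" by (auto simp: is_unit_iff_degree elim: degree_eq_zeroE)
  then have "c = 1" using assms(2) r by (simp add: lead_coeff_mult split: if_splits)
  then show ?thesis using that[of "- z"] r c by (simp add: one_pCons)
qed

section \<open>Homogenizations of irreducible polynomials\<close>

definition exponent_vec :: "('n::finite \<Rightarrow>\<^sub>0 nat) \<Rightarrow> int ^ 'n" where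
  "exponent_vec A = (\<chi> i. int (Poly_Mapping.lookup A i))"

lemma exponent_vec_nth [simp]: "exponent_vec A $ i = int (Poly_Mapping.lookup A i)"
  by (simp add: exponent_vec_def)

lemma exponent_vec_inject: "exponent_vec A = exponent_vec B \<longleftrightarrow> A = B"
  by (auto simp: vec_eq_iff intro: poly_mapping_eqI)

lemma exponent_vec_add: "exponent_vec (A + B) = exponent_vec A + exponent_vec B"
  by (simp add: vec_eq_iff lookup_add)

lemma nonneg_exponent_vec: "nonneg (exponent_vec A)"
  by (simp add: nonneg_def)

definition vec_exponent :: "int ^ 'n::finite \<Rightarrow> 'n \<Rightarrow>\<^sub>0 nat" where
  "vec_exponent z = Abs_poly_mapping (\<lambda>i. nat (z $ i))"

lemma lookup_vec_exponent [simp]: "Poly_Mapping.lookup (vec_exponent z) i = nat (z $ i)"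
  unfolding vec_exponent_def by (subst Abs_poly_mapping_inverse) auto

lemma exponent_vec_inverse: "nonneg z \<Longrightarrow> exponent_vec (vec_exponent z) = z"
  by (simp add: vec_eq_iff nonneg_def)

lemma vec_exponent_inverse: "vec_exponent (exponent_vec A) = A"
  by (rule poly_mapping_eqI) simp

lemma vec_exponent_add: "nonneg y \<Longrightarrow> nonneg z \<Longrightarrow> vec_exponent (y + z) = vec_exponent y + vec_exponent z"
  by (rule poly_mapping_eqI) (simp add: lookup_add nonneg_def nat_add_distrib)

lemma int_monomial_exponent_vec: "int_monomial x (exponent_vec A) = eval_monomial x A"
  by (simp add: int_monomial_def eval_monomial_eq)

text \<open>Both sets are restricted to the maxima of one coordinate after another, in effect to
  their lexicographically largest elements. With all coordinates in \<open>I\<close>, the sum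
  \<open>A + B\<close> arises from one pair only.\<close>

lemma separating_pair:
  fixes S T :: "('n \<Rightarrow>\<^sub>0 nat) set"
  assumes "finite I" "finite S" "S \<noteq> {}" "finite T" "T \<noteq> {}"
  shows "\<exists>A\<in>S. \<exists>B\<in>T. \<forall>A'\<in>S. \<forall>B'\<in>T. A' + B' = A + B \<longrightarrow>
    (\<forall>i\<in>I. Poly_Mapping.lookup A' i = Poly_Mapping.lookup A i)"
  using assms
proof (induction I arbitrary: S T)
  case empty
  then show ?case by auto
next
  case (insert i I)
  let ?l = "\<lambda>A. Poly_Mapping.lookup A i"
  let ?S = "{A \<in> S. ?l A = Max (?l ` S)}" and ?T = "{B \<in> T. ?l B = Max (?l ` T)}"
  have "Max (?l ` S) \<in> ?l ` S" "Max (?l ` T) \<in> ?l ` T" using insert.prems by simp_all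
  then have ne: "?S \<noteq> {}" "?T \<noteq> {}" by force+
  have fin: "finite ?S" "finite ?T" using insert.prems by simp_all
  obtain A B where AB: "A \<in> ?S" "B \<in> ?T"
    and uniq: "\<And>A' B'. A' \<in> ?S \<Longrightarrow> B' \<in> ?T \<Longrightarrow> A' + B' = A + B \<Longrightarrow>
      \<forall>i\<in>I. Poly_Mapping.lookup A' i = Poly_Mapping.lookup A i"
    using insert.IH[OF fin(1) ne(1) fin(2) ne(2)] by blast
  have "\<forall>j\<in>insert i I. Poly_Mapping.lookup A' j = Poly_Mapping.lookup A j"
    if A'B': "A' \<in> S" "B' \<in> T" "A' + B' = A + B" for A' B'
  proof -
    have "?l A' \<le> ?l A" "?l B' \<le> ?l B" using AB A'B'(1,2) insert.prems by auto
    moreover have "?l A' + ?l B' = ?l A + ?l B" using A'B'(3) by (metis lookup_add)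
    ultimately have eq: "?l A' = ?l A" "?l B' = ?l B" by linarith+
    then have "A' \<in> ?S" "B' \<in> ?T" using AB A'B'(1,2) by simp_all
    then have "\<forall>i\<in>I. Poly_Mapping.lookup A' i = Poly_Mapping.lookup A i" using A'B'(3) by (rule uniq)
    then show ?thesis using eq by simp
  qed
  then show ?case using AB by blast
qed

lemma poly_mapping_eq_sum_single:
  "p = (\<Sum>A\<in>Poly_Mapping.keys p. Poly_Mapping.single A (Poly_Mapping.lookup p A))"
  by (rule poly_mapping_eqI)
     (auto simp: lookup_sum lookup_single when_def in_keys_iff)

lemma lookup_times_unique:
  fixes G H :: "'b::cancel_comm_monoid_add \<Rightarrow>\<^sub>0 'k::comm_semiring_0"
  assumes "A \<in> Poly_Mapping.keys G" "B \<in> Poly_Mapping.keys H"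
    and uniq: "\<And>A' B'. A' \<in> Poly_Mapping.keys G \<Longrightarrow> B' \<in> Poly_Mapping.keys H \<Longrightarrow> A' + B' = A + B \<Longrightarrow> A' = A"
  shows "Poly_Mapping.lookup (G * H) (A + B) = Poly_Mapping.lookup G A * Poly_Mapping.lookup H B"
proof -
  let ?t = "\<lambda>A' B'. Poly_Mapping.lookup G A' * Poly_Mapping.lookup H B'"
  have "G * H = (\<Sum>A'\<in>Poly_Mapping.keys G. \<Sum>B'\<in>Poly_Mapping.keys H. Poly_Mapping.single (A' + B') (?t A' B'))"
    by (subst poly_mapping_eq_sum_single[of G], subst poly_mapping_eq_sum_single[of H])
       (simp add: sum_product mult_single)
  then have "Poly_Mapping.lookup (G * H) (A + B) =
      (\<Sum>A'\<in>Poly_Mapping.keys G. \<Sum>B'\<in>Poly_Mapping.keys H. ?t A' B' when A' + B' = A + B)"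
    by (simp add: lookup_sum lookup_single)
  also have "\<dots> = (\<Sum>A'\<in>Poly_Mapping.keys G. \<Sum>B'\<in>Poly_Mapping.keys H.
      if A' = A then (if B' = B then ?t A' B' else 0) else 0)"
  proof (intro sum.cong refl)
    fix A' B' assume "A' \<in> Poly_Mapping.keys G" "B' \<in> Poly_Mapping.keys H"
    then show "(?t A' B' when A' + B' = A + B) = (if A' = A then (if B' = B then ?t A' B' else 0) else 0)"
      using uniq[of A' B'] by (auto simp: when_def)
  qed
  also have "\<dots> = (\<Sum>A'\<in>Poly_Mapping.keys G. if A' = A then ?t A' B else 0)"
    using assms(2) by (intro sum.cong) auto
  also have "\<dots> = ?t A B" using assms(1) by simp
  finally show ?thesis .
qed

text \<open>Applying \<open>separating_pair\<close> to the parts on which \<open>L\<close> is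
  maximal gives a product term that arises only once; it cannot cancel, and over a domain its
  coefficient is nonzero.\<close>

lemma keys_times_extreme:
  fixes G H :: "('n::finite, 'k::idom) mpoly" and L :: "('n \<Rightarrow>\<^sub>0 nat) \<Rightarrow> int"
  assumes "G \<noteq> 0" "H \<noteq> 0" and L: "\<And>A B. L (A + B) = L A + L B"
  obtains A B where "A \<in> Poly_Mapping.keys G" "B \<in> Poly_Mapping.keys H" "A + B \<in> Poly_Mapping.keys (G * H)"
    "\<And>A'. A' \<in> Poly_Mapping.keys G \<Longrightarrow> L A' \<le> L A" "\<And>B'. B' \<in> Poly_Mapping.keys H \<Longrightarrow> L B' \<le> L B"
proof -
  let ?G = "Poly_Mapping.keys G" and ?H = "Poly_Mapping.keys H"
  let ?S = "{A \<in> ?G. L A = Max (L ` ?G)}" and ?T = "{B \<in> ?H. L B = Max (L ` ?H)}"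
  have "Max (L ` ?G) \<in> L ` ?G" "Max (L ` ?H) \<in> L ` ?H" using assms(1,2) by simp_all
  then have ne: "?S \<noteq> {}" "?T \<noteq> {}" by force+
  have fin: "finite ?S" "finite ?T" by simp_all
  obtain A B where AB: "A \<in> ?S" "B \<in> ?T"
    and uniq: "\<And>A' B'. A' \<in> ?S \<Longrightarrow> B' \<in> ?T \<Longrightarrow> A' + B' = A + B \<Longrightarrow>
      \<forall>i\<in>UNIV. Poly_Mapping.lookup A' i = Poly_Mapping.lookup A i"
    using separating_pair[OF finite fin(1) ne(1) fin(2) ne(2), of UNIV] by blast
  have max: "L A' \<le> L A" "L B' \<le> L B" if "A' \<in> ?G" "B' \<in> ?H" for A' B'
    using AB that by auto
  have "Poly_Mapping.lookup (G * H) (A + B) = Poly_Mapping.lookup G A * Poly_Mapping.lookup H B"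
  proof (rule lookup_times_unique)
    fix A' B' assume A'B': "A' \<in> ?G" "B' \<in> ?H" "A' + B' = A + B"
    then have "L A' + L B' = L A + L B" by (metis L)
    then have "L A' = L A" "L B' = L B" using max[OF A'B'(1,2)] by linarith+
    then have "A' \<in> ?S" "B' \<in> ?T" using AB A'B'(1,2) by simp_all
    then have "\<forall>i\<in>UNIV. Poly_Mapping.lookup A' i = Poly_Mapping.lookup A i" using A'B'(3) by (rule uniq)
    then show "A' = A" by (intro poly_mapping_eqI) simp
  qed (use AB in auto)
  then have "A + B \<in> Poly_Mapping.keys (G * H)" using AB by (auto simp: in_keys_iff)
  then show ?thesis using AB max that by blast
qed

text \<open>The maximum of \<open>L\<close> on the support is additive under products, and so is the
  minimum, by the same lemma for \<open>- L\<close>. If they agree for the product, they agree for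
  each factor.\<close>

lemma factor_homogeneous:
  fixes G H :: "('n::finite, 'k::idom) mpoly" and L :: "('n \<Rightarrow>\<^sub>0 nat) \<Rightarrow> int"
  assumes "G \<noteq> 0" "H \<noteq> 0" and L: "\<And>A B. L (A + B) = L A + L B"
    and hom: "\<And>A B. A \<in> Poly_Mapping.keys (G * H) \<Longrightarrow> B \<in> Poly_Mapping.keys (G * H) \<Longrightarrow> L A = L B"
    and A: "A \<in> Poly_Mapping.keys G" "B \<in> Poly_Mapping.keys G"
  shows "L A = L B"
proof -
  obtain A1 B1 where 1: "A1 \<in> Poly_Mapping.keys G" "B1 \<in> Poly_Mapping.keys H" "A1 + B1 \<in> Poly_Mapping.keys (G * H)"
    "\<And>A'. A' \<in> Poly_Mapping.keys G \<Longrightarrow> L A' \<le> L A1" "\<And>B'. B' \<in> Poly_Mapping.keys H \<Longrightarrow> L B' \<le> L B1"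
    using keys_times_extreme[OF assms(1,2) L] by metis
  obtain A2 B2 where 2: "A2 \<in> Poly_Mapping.keys G" "B2 \<in> Poly_Mapping.keys H" "A2 + B2 \<in> Poly_Mapping.keys (G * H)"
    "\<And>A'. A' \<in> Poly_Mapping.keys G \<Longrightarrow> - L A' \<le> - L A2" "\<And>B'. B' \<in> Poly_Mapping.keys H \<Longrightarrow> - L B' \<le> - L B2"
    using keys_times_extreme[OF assms(1,2), of "\<lambda>A. - L A"] L by (metis minus_add_distrib)
  have "L A1 + L B1 = L A2 + L B2" using hom[OF 1(3) 2(3)] by (simp add: L)
  then show ?thesis using 1(4)[OF A(1)] 1(4)[OF A(2)] 2(4)[OF A(1)] 2(4)[OF A(2)] 1(5)[OF 2(2)] by linarith
qed

text \<open>Choose \<open>w $ j \<noteq> 0\<close>. By \<open>par\<close> it divides every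
  \<open>u $ j * w $ i\<close>, hence their gcd, which is \<open>u $ j\<close> up to sign because
  \<open>w\<close> is primitive.\<close>

lemma primitive_vector_multiple:
  assumes w: "primitive_vector w" and par: "\<And>i j. u $ i * w $ j = u $ j * w $ i"
  shows "\<exists>k. u = k *s w"
proof -
  obtain j where j: "w $ j \<noteq> 0" using w by (auto simp: primitive_vector_def vec_eq_iff)
  have "w $ j dvd Gcd (range (\<lambda>i. u $ j * w $ i))"
    using par by (intro Gcd_greatest) (auto simp flip: par)
  also have "range (\<lambda>i. u $ j * w $ i) = (*) (u $ j) ` range (\<lambda>i. w $ i)" by auto
  also have "Gcd \<dots> = normalize (u $ j * Gcd (range (\<lambda>i. w $ i)))" by (rule Gcd_mult)
  finally have "w $ j dvd u $ j" using w by (simp add: primitive_vector_def)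
  then obtain k where k: "u $ j = w $ j * k" by blast
  have "u $ i = k * w $ i" for i using par[of i j] k j by (simp add: mult.assoc mult.left_commute)
  then show ?thesis by (auto simp: vec_eq_iff)
qed

lemma line_indexing:
  fixes S :: "('n::finite \<Rightarrow>\<^sub>0 nat) set" and w :: "int ^ 'n"
  assumes S: "finite S" "S \<noteq> {}"
    and line: "\<And>A B. A \<in> S \<Longrightarrow> B \<in> S \<Longrightarrow> \<exists>k. exponent_vec A - exponent_vec B = k *s w"
  obtains A0 idx where "A0 \<in> S" "\<And>A. A \<in> S \<Longrightarrow> exponent_vec A = exponent_vec A0 + int (idx A) *s w" "idx A0 = 0"
proof -
  obtain B where B: "B \<in> S" using S by blast
  have "\<forall>A\<in>S. \<exists>k. exponent_vec A - exponent_vec B = k *s w" using line B by blast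
  from bchoice[OF this] obtain k
    where k: "\<And>A. A \<in> S \<Longrightarrow> exponent_vec A - exponent_vec B = k A *s w" by blast
  define A0 where "A0 = arg_min_on k S"
  have A0: "A0 \<in> S" "\<And>A. A \<in> S \<Longrightarrow> k A0 \<le> k A"
    unfolding A0_def using arg_min_if_finite(1)[OF S] arg_min_least[OF S] by blast+
  show ?thesis
  proof (rule that[OF A0(1), of "\<lambda>A. nat (k A - k A0)"])
    fix A assume A: "A \<in> S"
    have "exponent_vec A = exponent_vec A0 + (k A - k A0) *s w"
      using k[OF A] k[OF A0(1)] by (auto simp: vec_eq_iff algebra_simps)
    then show "exponent_vec A = exponent_vec A0 + int (nat (k A - k A0)) *s w"
      using A0(2)[OF A] by simp
  qed simp
qed

lemma coeff_sum_monom: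
  assumes "finite S" "inj_on idx S" "A \<in> S"
  shows "coeff (\<Sum>B\<in>S. monom (c B) (idx B)) (idx A) = c A"
proof -
  have "coeff (\<Sum>B\<in>S. monom (c B) (idx B)) (idx A) = (\<Sum>B\<in>S. if B = A then c A else 0)"
    unfolding coeff_sum using assms by (intro sum.cong) (auto simp: inj_on_def)
  then show ?thesis using assms by simp
qed

lemma line_sum_of_support:
  fixes c :: "('n::finite \<Rightarrow>\<^sub>0 nat) \<Rightarrow> 'c::comm_monoid_add"
  assumes S: "finite S" and inj: "inj_on idx S" and 0: "\<phi> 0 = 0"
    and pts: "\<And>A. A \<in> S \<Longrightarrow> exponent_vec A = a + int (idx A) *s w"
  shows "line_sum \<phi> mon w a (\<Sum>A\<in>S. monom (c A) (idx A)) = (\<Sum>A\<in>S. \<phi> (c A) * mon (exponent_vec A))"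
proof -
  let ?p = "\<Sum>A\<in>S. monom (c A) (idx A)"
  have coeff: "coeff ?p (idx A) = c A" if "A \<in> S" for A
    by (rule coeff_sum_monom[OF S inj that])
  have coeff_0: "coeff ?p i = 0" if "i \<notin> idx ` S" for i
    unfolding coeff_sum using that by (intro sum.neutral) auto
  let ?N = "max (degree ?p) (Max (insert 0 (idx ` S)))"
  have "line_sum \<phi> mon w a ?p = (\<Sum>i\<le>?N. \<phi> (coeff ?p i) * mon (a + int i *s w))"
    by (rule line_sum_bound[of \<phi>, OF 0]) simp
  also have "\<dots> = (\<Sum>i\<in>idx ` S. \<phi> (coeff ?p i) * mon (a + int i *s w))"
    by (rule sum.mono_neutral_right)
       (use S coeff_0 0 in \<open>auto intro!: max.coboundedI2 Max_ge\<close>)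
  also have "\<dots> = (\<Sum>A\<in>S. \<phi> (c A) * mon (exponent_vec A))"
    using inj coeff pts by (simp add: sum.reindex)
  finally show ?thesis .
qed

definition vec_monomial :: "int ^ 'n::finite \<Rightarrow> ('n, 'k::comm_ring_1) mpoly" where
  "vec_monomial z = Poly_Mapping.single (vec_exponent z) 1"

abbreviation line_poly :: "int ^ 'n::finite \<Rightarrow> int ^ 'n \<Rightarrow> 'k::field poly \<Rightarrow> ('n, 'k) mpoly" where
  "line_poly \<equiv> line_sum (Poly_Mapping.single 0) vec_monomial"

lemma line_poly_eq:
  "line_poly w z a = (\<Sum>i\<le>degree a. Poly_Mapping.single (vec_exponent (z + int i *s w)) (coeff a i))"
  by (simp add: line_sum_def vec_monomial_def mult_single)

text \<open>This is \<open>p(X^\<alpha> / X^\<beta>)\<close> multiplied by the power of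
  \<open>X^\<beta>\<close> with exponent \<open>degree p\<close>, where
  \<open>w = \<alpha> - \<beta>\<close> is the decomposition into positive and negative
  part.\<close>

definition homogenization :: "int ^ 'n::finite \<Rightarrow> 'k::field poly \<Rightarrow> ('n, 'k) mpoly" where
  "homogenization w p = line_poly w (int (degree p) *s neg_part w) p"

lemma line_poly_mult:
  fixes a b :: "'k::field poly" and w y z :: "int ^ 'n::finite"
  assumes "\<And>i. i \<le> degree a \<Longrightarrow> nonneg (y + int i *s w)" "\<And>i. i \<le> degree b \<Longrightarrow> nonneg (z + int i *s w)"
  shows "line_poly w y a * line_poly w z b = line_poly w (y + z) (a * b)"
proof (rule line_sum_mult)
  fix i j assume "i \<le> degree a" "j \<le> degree b"
  then show "vec_monomial (y + int i *s w) * vec_monomial (z + int j *s w) =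
      (vec_monomial (y + int i *s w + (z + int j *s w)) :: ('n, 'k) mpoly)"
    using assms by (simp add: vec_monomial_def mult_single vec_exponent_add)
qed (simp_all add: single_add mult_single)

lemma homogenization_mult:
  assumes "a \<noteq> 0" "b \<noteq> 0"
  shows "homogenization w (a * b) = homogenization w a * homogenization w b"
proof -
  have "int (degree (a * b)) *s neg_part w = int (degree a) *s neg_part w + int (degree b) *s neg_part w"
    using assms by (simp add: degree_mult_eq vec_eq_iff algebra_simps)
  then show ?thesis
    unfolding homogenization_def by (simp add: line_poly_mult nonneg_neg_part_translate)
qed

lemma vec_exponent_0 [simp]: "vec_exponent 0 = 0"
  by (rule poly_mapping_eqI) simp

lemma homogenization_const: "homogenization w [:c:] = Poly_Mapping.single 0 c"
  by (simp add: homogenization_def line_poly_eq)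

lemma homogenization_power: "p \<noteq> 0 \<Longrightarrow> homogenization w (p ^ k) = homogenization w p ^ k"
  by (induction k) (simp_all add: homogenization_mult homogenization_const one_pCons)

lemma translate_inject:
  assumes "w \<noteq> (0 :: int ^ 'n)" "z + int i *s w = z + int j *s w"
  shows "i = j"
proof -
  obtain k where "w $ k \<noteq> 0" using assms(1) by (auto simp: vec_eq_iff)
  moreover have "(z + int i *s w) $ k = (z + int j *s w) $ k" using assms(2) by simp
  ultimately show ?thesis by simp
qed

text \<open>The index \<open>i\<close> may exceed \<open>degree a\<close>, so that polynomials of
  possibly different degrees can be compared at the same exponent.\<close>

lemma lookup_line_poly:
  fixes w z :: "int ^ 'n::finite"
  assumes w: "w \<noteq> 0" and nn: "\<And>i. i \<le> degree a \<Longrightarrow> nonneg (z + int i *s w)"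
    and i: "nonneg (z + int i *s w)"
  shows "Poly_Mapping.lookup (line_poly w z a) (vec_exponent (z + int i *s w)) = coeff a i"
proof -
  have inj: "j = i" if "vec_exponent (z + int j *s w) = vec_exponent (z + int i *s w)" "j \<le> degree a" for j
    using translate_inject[OF w, of z j i] that nn i by (metis exponent_vec_inverse)
  have "Poly_Mapping.lookup (line_poly w z a) (vec_exponent (z + int i *s w)) =
      (\<Sum>j\<le>degree a. if j = i then coeff a i else 0)"
    unfolding line_poly_eq lookup_sum lookup_single
    using inj by (intro sum.cong) (auto simp: when_def)
  then show ?thesis by (simp add: coeff_eq_0)
qed

lemma keys_line_poly:
  fixes w z :: "int ^ 'n::finite"
  assumes nn: "\<And>i. i \<le> degree a \<Longrightarrow> nonneg (z + int i *s w)"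
    and A: "A \<in> Poly_Mapping.keys (line_poly w z a)"
  obtains i where "i \<le> degree a" "exponent_vec A = z + int i *s w"
proof -
  have "(\<Sum>i\<le>degree a. Poly_Mapping.lookup (Poly_Mapping.single (vec_exponent (z + int i *s w)) (coeff a i)) A) \<noteq> 0"
    using A unfolding line_poly_eq lookup_sum in_keys_iff by simp
  then obtain i where i: "i \<le> degree a"
    "Poly_Mapping.lookup (Poly_Mapping.single (vec_exponent (z + int i *s w)) (coeff a i)) A \<noteq> 0"
    by (metis (no_types, lifting) atMost_iff sum.neutral)
  then have "A = vec_exponent (z + int i *s w)"
    by (auto simp: lookup_single when_def split: if_splits)
  then show ?thesis using i(1) nn[OF i(1)] exponent_vec_inverse that by blast
qed

text \<open>The nonzero constant coefficients put each base point into the support of the other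
  side, hence at a non-negative multiple of \<open>w\<close> from the other base point; both
  directions together force equality.\<close>

lemma line_poly_inject:
  fixes w y z :: "int ^ 'n::finite"
  assumes w: "w \<noteq> 0" and a0: "coeff a 0 \<noteq> 0" and b0: "coeff b 0 \<noteq> 0"
    and nn: "\<And>i. i \<le> degree a \<Longrightarrow> nonneg (y + int i *s w)" "\<And>i. i \<le> degree b \<Longrightarrow> nonneg (z + int i *s w)"
    and eq: "line_poly w y a = line_poly w z b"
  shows "y = z" "a = b"
proof -
  have nny: "nonneg y" and nnz: "nonneg z" using nn(1)[of 0] nn(2)[of 0] by simp_all
  have "vec_exponent y \<in> Poly_Mapping.keys (line_poly w y a)"
    using lookup_line_poly[of w a y 0] w nn(1) a0 nny by (simp add: in_keys_iff)
  then obtain i where "exponent_vec (vec_exponent y) = z + int i *s w"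
    unfolding eq using keys_line_poly[OF nn(2)] by blast
  then have i: "y = z + int i *s w" using nny by (simp add: exponent_vec_inverse)
  have "vec_exponent z \<in> Poly_Mapping.keys (line_poly w z b)"
    using lookup_line_poly[of w b z 0] w nn(2) b0 nnz by (simp add: in_keys_iff)
  then obtain j where "exponent_vec (vec_exponent z) = y + int j *s w"
    unfolding eq[symmetric] using keys_line_poly[OF nn(1)] by blast
  then have j: "z = y + int j *s w" using nnz by (simp add: exponent_vec_inverse)
  have "y + int (j + i) *s w = y + int 0 *s w"
    by (subst (2) i, subst j) (simp add: vec_eq_iff algebra_simps)
  then have "j + i = 0" by (rule translate_inject[OF w])
  then show yz: "y = z" using i by simp
  show "a = b"
  proof (rule poly_eqI)
    fix n
    show "coeff a n = coeff b n"
    proof (cases "n \<le> degree a \<or> n \<le> degree b")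
      case True
      then have "nonneg (y + int n *s w)" using nn yz by auto
      then show ?thesis
        using lookup_line_poly[of w a y n] lookup_line_poly[of w b z n] w nn eq yz by simp
    qed (simp add: coeff_eq_0 not_le)
  qed
qed

lemma nonneg_segment:
  assumes "nonneg z" "nonneg (z + int m *s w)" "i \<le> m"
  shows "nonneg (z + int i *s w)"
  unfolding nonneg_def
proof
  fix k
  show "0 \<le> (z + int i *s w) $ k"
  proof (cases "0 \<le> w $ k")
    case True
    then show ?thesis using assms(1) by (simp add: nonneg_def)
  next
    case False
    then have "int i * (- w $ k) \<le> int m * (- w $ k)" using assms(3) by (intro mult_right_mono) auto
    moreover have "0 \<le> z $ k + int m * w $ k" using assms(2) by (simp add: nonneg_def)
    ultimately show ?thesis by simp
  qed
qed

lemma line_poly_of_support: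
  fixes G :: "('n::finite, 'k::field) mpoly"
  assumes "G \<noteq> 0" and w: "w \<noteq> 0"
    and line: "\<And>A B. A \<in> Poly_Mapping.keys G \<Longrightarrow> B \<in> Poly_Mapping.keys G \<Longrightarrow>
      \<exists>k. exponent_vec A - exponent_vec B = k *s w"
  obtains z a where "G = line_poly w z a" "coeff a 0 \<noteq> 0" "\<And>i. i \<le> degree a \<Longrightarrow> nonneg (z + int i *s w)"
proof -
  let ?S = "Poly_Mapping.keys G"
  have "finite ?S" "?S \<noteq> {}" using assms(1) by simp_all
  then obtain A0 idx where A0: "A0 \<in> ?S" "idx A0 = 0"
    and idx: "\<And>A. A \<in> ?S \<Longrightarrow> exponent_vec A = exponent_vec A0 + int (idx A) *s w"
    using line_indexing[OF _ _ line] by metis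
  have inj: "inj_on idx ?S"
    by (rule inj_onI) (metis exponent_vec_inject idx)
  define a where "a = (\<Sum>A\<in>?S. monom (Poly_Mapping.lookup G A) (idx A))"
  have coeff: "coeff a (idx A) = Poly_Mapping.lookup G A" if "A \<in> ?S" for A
    unfolding a_def by (rule coeff_sum_monom[OF finite_keys inj that])
  have "line_poly w (exponent_vec A0) a =
      (\<Sum>A\<in>?S. Poly_Mapping.single 0 (Poly_Mapping.lookup G A) * vec_monomial (exponent_vec A))"
    unfolding a_def by (rule line_sum_of_support) (use inj idx in auto)
  also have "\<dots> = (\<Sum>A\<in>?S. Poly_Mapping.single A (Poly_Mapping.lookup G A))"
    by (simp add: vec_monomial_def mult_single vec_exponent_inverse)
  finally have G: "G = line_poly w (exponent_vec A0) a" using poly_mapping_eq_sum_single[of G] by simp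
  have a0: "coeff a 0 \<noteq> 0" using coeff[OF A0(1)] A0 by (simp add: in_keys_iff)
  have "\<exists>A\<in>?S. idx A = degree a"
  proof (rule ccontr)
    assume "\<not> ?thesis"
    then have "coeff a (degree a) = 0" unfolding a_def[symmetric] by (subst (1) a_def) (auto simp: coeff_sum intro!: sum.neutral)
    then show False using a0 by simp
  qed
  then have "nonneg (exponent_vec A0 + int (degree a) *s w)" using idx nonneg_exponent_vec by metis
  then have "nonneg (exponent_vec A0 + int i *s w)" if "i \<le> degree a" for i
    using nonneg_segment[OF nonneg_exponent_vec _ that] by blast
  then show ?thesis using that G a0 by blast
qed

text \<open>Any factor is homogeneous for all forms vanishing on \<open>w\<close>, so by primitivity
  its support lies on one lattice line and it is a line polynomial itself. A factorization thus
  comes from \<open>p = a * b\<close>. If \<open>a\<close> is constant, the corresponding factor is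
  a monomial, and it must be constant since no variable divides the homogenization.\<close>

theorem irreducible_homogenization:
  fixes p :: "'k::field poly" and w :: "int ^ 'n::finite"
  assumes p: "irreducible p" and p0: "coeff p 0 \<noteq> 0"
    and w: "primitive_vector w" and neg: "w $ j < 0"
  shows "irreducible (homogenization w p)"
proof -
  let ?P = "homogenization w p" and ?z = "int (degree p) *s neg_part w"
  have w0: "w \<noteq> 0" using neg by auto
  have P_eq: "?P = line_poly w ?z p" by (simp add: homogenization_def)
  have nn: "nonneg (?z + int i *s w)" if "i \<le> degree p" for i
    using that by (rule nonneg_neg_part_translate)
  have nnz: "nonneg ?z" using nn[of 0] by simp
  have deg_p: "degree p > 0" using p p0 by (auto simp: irreducible_def is_unit_iff_degree)
  have key: "vec_exponent ?z \<in> Poly_Mapping.keys ?P"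
    using lookup_line_poly[of w p ?z 0] w0 nn p0 nnz by (simp add: P_eq in_keys_iff)
  have "?P \<noteq> 0" using key by auto
  moreover have "\<not> ?P dvd 1"
  proof
    assume "?P dvd 1"
    then obtain Q where Q: "1 = ?P * Q" by (rule dvdE)
    then have "Q \<noteq> 0" by auto
    \<comment> \<open>The degree in the variable \<open>j\<close>: it is positive for
      \<open>?P\<close>, as \<open>w $ j < 0\<close>, whereas it is 0 for a divisor of 1.\<close>
    let ?L = "\<lambda>A. int (Poly_Mapping.lookup A j)"
    obtain A B where AB: "A + B \<in> Poly_Mapping.keys (?P * Q)" "\<And>A'. A' \<in> Poly_Mapping.keys ?P \<Longrightarrow> ?L A' \<le> ?L A"
      by (rule keys_times_extreme[OF \<open>?P \<noteq> 0\<close> \<open>Q \<noteq> 0\<close>, of ?L]) (simp add: lookup_add, blast)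
    have "A + B = 0" using AB(1) Q by simp
    then have "Poly_Mapping.lookup A j = 0" by (metis add_is_0 lookup_add lookup_zero)
    then have "int (nat (?z $ j)) \<le> 0" using AB(2)[OF key] by (simp only: lookup_vec_exponent)
    moreover have "0 < ?z $ j" using neg deg_p by (simp add: neg_part_def mult_pos_neg)
    ultimately show False by linarith
  qed
  moreover have "G dvd 1 \<or> H dvd 1" if GH: "?P = G * H" for G H
  proof -
    have ne: "G \<noteq> 0" "H \<noteq> 0" using GH \<open>?P \<noteq> 0\<close> by auto
    have line: "\<exists>k. exponent_vec A - exponent_vec B = k *s w"
      if GH: "?P = G * H" and ne: "G \<noteq> 0" "H \<noteq> 0" and AB: "A \<in> Poly_Mapping.keys G" "B \<in> Poly_Mapping.keys G"
      for A B and G H :: "('n, 'k) mpoly"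
    proof (rule primitive_vector_multiple[OF w])
      fix i j
      let ?L = "\<lambda>A. exponent_vec A $ i * w $ j - exponent_vec A $ j * w $ i"
      have const: "?L A = ?z $ i * w $ j - ?z $ j * w $ i" if A: "A \<in> Poly_Mapping.keys (G * H)" for A
      proof -
        obtain m where "exponent_vec A = ?z + int m *s w"
          using keys_line_poly[OF nn] A unfolding GH[symmetric] P_eq by blast
        then show ?thesis by (simp only:) (simp add: algebra_simps)
      qed
      have "?L A = ?L B"
      proof (rule factor_homogeneous[OF ne _ _ AB])
        show "?L (A + B) = ?L A + ?L B" for A B
          unfolding exponent_vec_add vector_add_component by (simp only: algebra_simps)
        show "?L A = ?L B" if "A \<in> Poly_Mapping.keys (G * H)" "B \<in> Poly_Mapping.keys (G * H)" for A B
          using const[OF that(1)] const[OF that(2)] by simp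
      qed
      then show "(exponent_vec A - exponent_vec B) $ i * w $ j = (exponent_vec A - exponent_vec B) $ j * w $ i"
        unfolding vector_minus_component by (simp only: algebra_simps)
    qed
    obtain y a where G: "G = line_poly w y a" "coeff a 0 \<noteq> 0" "\<And>i. i \<le> degree a \<Longrightarrow> nonneg (y + int i *s w)"
      using line_poly_of_support[OF ne(1) w0 line[OF GH ne]] by blast
    have "?P = H * G" using GH by (simp add: mult.commute)
    then obtain y' b where H: "H = line_poly w y' b" "coeff b 0 \<noteq> 0" "\<And>i. i \<le> degree b \<Longrightarrow> nonneg (y' + int i *s w)"
      using line_poly_of_support[OF ne(2) w0 line[OF _ ne(2) ne(1)]] by blast
    have ab0: "a \<noteq> 0" "b \<noteq> 0" using G(2) H(2) by auto
    have "line_poly w ?z p = line_poly w (y + y') (a * b)"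
      using GH G(1) H(1) line_poly_mult[OF G(3) H(3)] P_eq by simp
    moreover have "coeff (a * b) 0 \<noteq> 0" using G(2) H(2) by (simp add: coeff_mult)
    moreover have "nonneg (y + y' + int i *s w)" if "i \<le> degree (a * b)" for i
    proof -
      have "y + y' + int (degree a + degree b) *s w = (y + int (degree a) *s w) + (y' + int (degree b) *s w)"
        by (simp add: vec_eq_iff algebra_simps)
      then have "nonneg (y + y' + int (degree a + degree b) *s w)"
        using G(3)[OF order_refl] H(3)[OF order_refl] by (simp only: nonneg_def vector_add_component add_nonneg_nonneg simp_thms)
      moreover have "nonneg (y + y')" using G(3)[of 0] H(3)[of 0] by (simp add: nonneg_def)
      ultimately show ?thesis using nonneg_segment that ab0 by (metis degree_mult_eq)
    qed
    ultimately have z: "?z = y + y'" and pab: "p = a * b"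
      using line_poly_inject[OF w0 p0 _ nn] by blast+
    \<comment> \<open>At coordinates with \<open>w $ i \<ge> 0\<close> the start of the segment has
      entry 0, at the others its end has; either way no monomial with exponent
      \<open>u \<noteq> 0\<close> can be split off.\<close>
    have unit: "line_poly w u c dvd (1 :: ('n, 'k) mpoly)"
      if c: "degree c = 0" "c \<noteq> 0" "degree p = degree d" and "?z = u + v"
        and uv: "nonneg u" "nonneg v" "nonneg (v + int (degree d) *s w)" for u v c d
    proof -
      have "u $ i = 0" for i
      proof (cases "0 \<le> w $ i")
        case True
        then have "u $ i + v $ i = 0" using arg_cong[OF \<open>?z = u + v\<close>, of "\<lambda>z. z $ i"] by (simp add: neg_part_def)
        then show ?thesis using uv by (simp add: nonneg_def add_nonneg_eq_0_iff)
      next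
        case False
        then have "u $ i + v $ i = - (int (degree d) * w $ i)"
          using arg_cong[OF \<open>?z = u + v\<close>, of "\<lambda>z. z $ i"] c(3) by (simp add: neg_part_def)
        moreover have "0 \<le> v $ i + int (degree d) * w $ i" "0 \<le> u $ i" using uv by (simp_all add: nonneg_def)
        ultimately show ?thesis by linarith
      qed
      then have "u = 0" by (simp add: vec_eq_iff)
      obtain r where r: "c = [:r:]" using c(1) by (rule degree_eq_zeroE)
      then have "r \<noteq> 0" using c(2) by simp
      have "line_poly w u c * Poly_Mapping.single 0 (inverse r) = (1 :: ('n, 'k) mpoly)"
        using \<open>r \<noteq> 0\<close> by (simp add: r \<open>u = 0\<close> line_poly_eq mult_single)
      then show ?thesis by (metis dvd_triv_left)
    qed
    have deg: "degree p = degree a + degree b" unfolding pab using ab0 by (rule degree_mult_eq)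
    have "a dvd 1 \<or> b dvd 1" using p pab by (rule irreducibleD)
    then show ?thesis
    proof
      assume "a dvd 1"
      then have "degree a = 0" using ab0 by (simp add: is_unit_iff_degree)
      then have "G dvd 1" unfolding G(1)
        using unit[of a b y y'] ab0 deg z G(3)[of 0] H(3)[of 0] H(3)[of "degree b"] by simp
      then show ?thesis ..
    next
      assume "b dvd 1"
      then have "degree b = 0" using ab0 by (simp add: is_unit_iff_degree)
      then have "H dvd 1" unfolding H(1)
        using unit[of b a y' y] ab0 deg z G(3)[of 0] H(3)[of 0] G(3)[of "degree a"] by (simp add: add.commute)
      then show ?thesis ..
    qed
  qed
  ultimately show ?thesis by (simp add: irreducible_def)
qed

section \<open>Loose edges\<close>

definition orthant :: "(real ^ 'n) set" where
  "orthant = {v. \<forall>i. 0 \<le> v $ i}"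

lemma real_point_nth [simp]: "real_point A $ i = real (Poly_Mapping.lookup A i)"
  by (simp add: real_point_def)

lemma inner_nonneg_orthant:
  fixes m v :: "real ^ 'n::finite"
  shows "m \<in> orthant \<Longrightarrow> v \<in> orthant \<Longrightarrow> 0 \<le> m \<bullet> v"
  by (auto simp: orthant_def inner_vec_def intro!: sum_nonneg)

lemma positive_form_orthant: "positive_form l \<Longrightarrow> l \<in> orthant"
  by (auto simp: positive_form_def orthant_def less_imp_le)

lemma inner_positive_form_eq_0:
  assumes "positive_form l" "v \<in> orthant" "l \<bullet> v = 0"
  shows "v = 0"
proof -
  have "(\<Sum>i\<in>UNIV. l $ i * v $ i) = 0" using assms(3) by (simp add: inner_vec_def)
  moreover have "0 \<le> l $ i * v $ i" for i
    using assms(1,2) by (simp add: positive_form_def orthant_def less_imp_le)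
  ultimately have "l $ i * v $ i = 0" for i by (simp add: sum_nonneg_eq_0_iff)
  then show ?thesis using assms(1) by (auto simp: vec_eq_iff positive_form_def) (metis less_irrefl)
qed

lemma closed_orthant: "closed (orthant :: (real ^ 'n::finite) set)"
  unfolding orthant_def by (intro closed_Collect_all closed_Collect_le continuous_intros)

lemma convex_orthant: "convex (orthant :: (real ^ 'n::finite) set)"
  by (rule convexI) (auto simp: orthant_def)

definition newton_hull :: "('n::finite \<Rightarrow>\<^sub>0 nat) set \<Rightarrow> (real ^ 'n) set" where
  "newton_hull S = (\<lambda>C. closed C \<and> convex C) hull
     {real_point A + v | A v. A \<in> S \<and> (\<forall>i. 0 \<le> v $ i)}"

lemma newton_hull_minimal:
  assumes "closed C" "convex C" "\<And>A v. A \<in> S \<Longrightarrow> v \<in> orthant \<Longrightarrow> real_point A + v \<in> C"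
  shows "newton_hull S \<subseteq> C"
  unfolding newton_hull_def by (rule hull_minimal) (use assms in \<open>auto simp: orthant_def\<close>)

lemma real_point_mem_newton_hull: "A \<in> S \<Longrightarrow> real_point A \<in> newton_hull S"
  unfolding newton_hull_def by (rule hull_inc, intro CollectI exI[of _ A] exI[of _ 0]) simp

lemma convex_newton_hull: "convex (newton_hull S)"
proof -
  have "closed (newton_hull S) \<and> convex (newton_hull S)"
    unfolding newton_hull_def by (rule hull_in) (auto intro!: closed_Inter convex_Inter)
  then show ?thesis by blast
qed

text \<open>The sum of a compact and a closed convex set is closed and convex, so the closure in the
  definition adds nothing. Used for the convex hull of the support and for the edge as a
  segment.\<close>

lemma newton_hull_subset_sum:
  fixes v :: "real ^ 'n::finite"
  assumes K: "compact K" "convex K"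
    and S: "\<And>A. A \<in> S \<Longrightarrow> \<exists>k\<in>K. real_point A - k \<in> orthant"
    and v: "v \<in> newton_hull S"
  obtains k where "k \<in> K" "v - k \<in> orthant"
proof -
  let ?C = "\<Union>k\<in>K. \<Union>y\<in>orthant. {k + y}"
  have "newton_hull S \<subseteq> ?C"
  proof (rule newton_hull_minimal)
    show "closed ?C" by (rule compact_closed_sums[OF K(1) closed_orthant])
    show "convex ?C" by (rule convex_sums[OF K(2) convex_orthant])
    fix A and v :: "real ^ 'n" assume "A \<in> S" "v \<in> orthant"
    then obtain k where k: "k \<in> K" "real_point A - k \<in> orthant" using S by blast
    then have "(real_point A - k) + v \<in> orthant" using \<open>v \<in> orthant\<close> by (auto simp: orthant_def intro: add_nonneg_nonneg)
    moreover have "real_point A + v = k + ((real_point A - k) + v)" by simp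
    ultimately show "real_point A + v \<in> ?C" using k(1) by blast
  qed
  then obtain k y where "k \<in> K" "y \<in> orthant" "v = k + y" using v by blast
  then show ?thesis using that[of k] by simp
qed

lemma newton_hull_lower_bound:
  fixes m v :: "real ^ 'n::finite"
  assumes "m \<in> orthant" "\<And>A. A \<in> S \<Longrightarrow> c \<le> m \<bullet> real_point A" "v \<in> newton_hull S"
  shows "c \<le> m \<bullet> v"
proof -
  have "newton_hull S \<subseteq> {v. c \<le> m \<bullet> v}"
  proof (rule newton_hull_minimal)
    show "closed {v. c \<le> m \<bullet> v}" by (rule closed_halfspace_ge)
    show "convex {v. c \<le> m \<bullet> v}" by (rule convex_halfspace_ge)
    show "real_point A + v \<in> {v. c \<le> m \<bullet> v}" if "A \<in> S" "v \<in> orthant" for A and v :: "real ^ 'n"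
      using assms(2)[OF that(1)] inner_nonneg_orthant[OF assms(1) that(2)] by (simp add: inner_add_right)
  qed
  then show ?thesis using assms(3) by blast
qed

lemma determines_face_iff:
  fixes m :: "real ^ 'n::finite"
  assumes "positive_form m" "A \<in> S" "\<And>B. B \<in> S \<Longrightarrow> m \<bullet> real_point A \<le> m \<bullet> real_point B"
  shows "determines_face m (newton_hull S) F \<longleftrightarrow> F = {v \<in> newton_hull S. m \<bullet> v = m \<bullet> real_point A}"
proof -
  have "m \<bullet> real_point A \<le> m \<bullet> v" if "v \<in> newton_hull S" for v
    using newton_hull_lower_bound[OF positive_form_orthant[OF assms(1)]] assms(3) that by blast
  then have "{v \<in> newton_hull S. \<forall>w\<in>newton_hull S. m \<bullet> v \<le> m \<bullet> w} =
      {v \<in> newton_hull S. m \<bullet> v = m \<bullet> real_point A}"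
    using real_point_mem_newton_hull[OF assms(2)] by (auto intro: antisym)
  then show ?thesis unfolding determines_face_def by simp
qed

lemma face_min:
  assumes S: "finite S" and l: "positive_form l" "determines_face l (newton_hull S) F" and "F \<noteq> {}"
  obtains A where "A \<in> S" "F = {v \<in> newton_hull S. l \<bullet> v = l \<bullet> real_point A}"
    "\<And>B. B \<in> S \<Longrightarrow> l \<bullet> real_point A \<le> l \<bullet> real_point B"
proof -
  have "S \<noteq> {}"
  proof
    assume "S = {}"
    then have "newton_hull S \<subseteq> {}" by (intro newton_hull_minimal) auto
    then show False using l(2) \<open>F \<noteq> {}\<close> unfolding determines_face_def by blast
  qed
  define A where "A = arg_min_on (\<lambda>A. l \<bullet> real_point A) S"
  have A: "A \<in> S" "\<And>B. B \<in> S \<Longrightarrow> l \<bullet> real_point A \<le> l \<bullet> real_point B"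
    unfolding A_def by (rule arg_min_if_finite(1)[OF S \<open>S \<noteq> {}\<close>], rule arg_min_least[OF S \<open>S \<noteq> {}\<close>])
  then have "F = {v \<in> newton_hull S. l \<bullet> v = l \<bullet> real_point A}"
    using determines_face_iff[OF l(1) A] l(2) by simp
  then show ?thesis by (rule that[OF A(1) _ A(2)])
qed

text \<open>A point of the face is a convex combination of support points plus a vector of the
  orthant. Minimality of \<open>l\<close> annihilates that vector and every weight away from
  \<open>A\<close>.\<close>

lemma face_singleton:
  assumes S: "finite S" and l: "positive_form l" and A: "A \<in> S"
    and min: "\<And>B. B \<in> S \<Longrightarrow> B \<noteq> A \<Longrightarrow> l \<bullet> real_point A < l \<bullet> real_point B"
  shows "{v \<in> newton_hull S. l \<bullet> v = l \<bullet> real_point A} = {real_point A}"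
proof -
  let ?X = "real_point ` S" and ?a = "real_point A"
  have "v = ?a" if v: "v \<in> newton_hull S" "l \<bullet> v = l \<bullet> ?a" for v
  proof -
    have "\<exists>k\<in>convex hull ?X. real_point B - k \<in> orthant" if "B \<in> S" for B
      using that by (intro bexI[of _ "real_point B"]) (auto simp: orthant_def hull_inc)
    then obtain k where k: "k \<in> convex hull ?X" "v - k \<in> orthant"
      using newton_hull_subset_sum[of "convex hull ?X" S v] finite_imp_compact_convex_hull S v(1)
      by (metis convex_convex_hull finite_imageI)
    then obtain u where u: "\<And>x. x \<in> ?X \<Longrightarrow> 0 \<le> u x" "sum u ?X = 1" "(\<Sum>x\<in>?X. u x *\<^sub>R x) = k"
      using convex_hull_finite[of ?X] S by auto
    have ge: "0 \<le> u x * (l \<bullet> x - l \<bullet> ?a)" if "x \<in> ?X" for x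
      using that u(1)[OF that] min by (force intro: mult_nonneg_nonneg)
    have "l \<bullet> k = (\<Sum>x\<in>?X. u x * (l \<bullet> x))" unfolding u(3)[symmetric] by (simp add: inner_sum_right)
    also have "\<dots> = (\<Sum>x\<in>?X. u x * (l \<bullet> x - l \<bullet> ?a)) + l \<bullet> ?a"
      using u(2) by (simp add: right_diff_distrib sum_subtractf flip: sum_distrib_right)
    finally have lk: "l \<bullet> k = (\<Sum>x\<in>?X. u x * (l \<bullet> x - l \<bullet> ?a)) + l \<bullet> ?a" .
    have "0 \<le> l \<bullet> (v - k)" by (rule inner_nonneg_orthant[OF positive_form_orthant[OF l] k(2)])
    then have "(\<Sum>x\<in>?X. u x * (l \<bullet> x - l \<bullet> ?a)) = 0" "l \<bullet> (v - k) = 0"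
      using lk v(2) sum_nonneg[of ?X "\<lambda>x. u x * (l \<bullet> x - l \<bullet> ?a)"] ge by (auto simp: inner_diff_right)
    then have "u x * (l \<bullet> x - l \<bullet> ?a) = 0" if "x \<in> ?X" for x
      using that ge S by (subst (asm) sum_nonneg_eq_0_iff) auto
    then have zero: "u x = 0" if "x \<in> ?X" "x \<noteq> ?a" for x using that min by fastforce
    have "k = (\<Sum>x\<in>?X. if x = ?a then u ?a *\<^sub>R ?a else 0)"
      unfolding u(3)[symmetric] using zero by (intro sum.cong) auto
    moreover have "1 = (\<Sum>x\<in>?X. if x = ?a then u ?a else 0)"
      unfolding u(2)[symmetric] using zero by (intro sum.cong) auto
    ultimately have "k = ?a" using S A by simp
    moreover have "v - k = 0" using inner_positive_form_eq_0[OF l k(2)] \<open>l \<bullet> (v - k) = 0\<close> by simp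
    ultimately show ?thesis by simp
  qed
  then show ?thesis using real_point_mem_newton_hull[OF A] by auto
qed

section \<open>Lattice points on a loose edge\<close>

lemma primitive_direction:
  fixes v :: "int ^ 'n::finite"
  assumes "v \<noteq> 0"
  obtains w g where "primitive_vector w" "v = g *s w" "g \<noteq> 0"
proof -
  define g where "g = Gcd (range (\<lambda>i. v $ i))"
  have g0: "g \<noteq> 0" using assms by (auto simp: vec_eq_iff g_def)
  define w :: "int ^ 'n" where "w = (\<chi> i. v $ i div g)"
  have vw: "v $ i = g * w $ i" for i by (simp add: w_def g_def)
  have "g = Gcd ((*) g ` range (\<lambda>i. w $ i))"
    unfolding image_image vw[symmetric] by (simp only: g_def)
  also have "\<dots> = normalize (g * Gcd (range (\<lambda>i. w $ i)))" by (rule Gcd_mult)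
  also have "\<dots> = g * Gcd (range (\<lambda>i. w $ i))" by (simp add: abs_mult g_def)
  finally have "Gcd (range (\<lambda>i. w $ i)) = 1" using g0 by simp
  moreover have "w \<noteq> 0" using assms vw by (auto simp: vec_eq_iff)
  ultimately have "primitive_vector w" by (simp add: primitive_vector_def)
  moreover have "v = g *s w" using vw by (simp add: vec_eq_iff)
  ultimately show ?thesis using g0 that by blast
qed

definition real_vec :: "int ^ 'n \<Rightarrow> real ^ 'n" where
  "real_vec z = (\<chi> i. real_of_int (z $ i))"

lemma real_vec_nth [simp]: "real_vec z $ i = real_of_int (z $ i)"
  by (simp add: real_vec_def)

lemma real_point_eq: "real_point A = real_vec (exponent_vec A)"
  by (simp add: vec_eq_iff)

lemma real_vec_translate: "real_vec (z + k *s w) = real_vec z + real_of_int k *\<^sub>R real_vec w"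
  by (simp add: vec_eq_iff)

lemma form_eq_inner: "real_of_int (form c z) = real_vec c \<bullet> real_vec z"
  by (simp add: form_def inner_vec_def)

lemma positive_form_entries:
  assumes "positive_form l" "l \<bullet> real_vec w = 0" "w \<noteq> 0"
  shows "\<exists>i. 0 < w $ i" "\<exists>i. w $ i < 0"
proof -
  have "\<exists>i. 0 < w $ i" if "l \<bullet> real_vec w = 0" "w \<noteq> 0" for w
  proof (rule ccontr)
    assume "\<not> ?thesis"
    then have "- real_vec w \<in> orthant" by (simp add: orthant_def not_less)
    moreover have "l \<bullet> (- real_vec w) = 0" using that(1) by simp
    ultimately have "- real_vec w = 0" using inner_positive_form_eq_0[OF assms(1)] by blast
    then show False using that(2) by (simp add: vec_eq_iff)
  qed
  from this[OF assms(2,3)] this[of "- w"]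
  show "\<exists>i. 0 < w $ i" "\<exists>i. w $ i < 0"
    using assms(2,3) by (simp_all add: inner_vec_def sum_negf)
qed

lemma form_diff_left: "form (b - c) z = form b z - form c z"
  by (simp add: form_def algebra_simps sum_subtractf)

locale loose_edge_of =
  fixes S :: "('n::finite \<Rightarrow>\<^sub>0 nat) set" and E :: "(real ^ 'n) set" and l :: "real ^ 'n"
  assumes fin: "finite S" and l: "positive_form l" and det: "determines_face l (newton_hull S) E"
    and dim: "aff_dim E = 1"
    and loose: "compact_face (newton_hull S) F \<Longrightarrow> E \<subseteq> F \<Longrightarrow> aff_dim F < 2"
begin

lemma face_level:
  assumes "A \<in> S" "real_point A \<in> E"
  shows "E = {v \<in> newton_hull S. l \<bullet> v = l \<bullet> real_point A}"
    and "B \<in> S \<Longrightarrow> l \<bullet> real_point A \<le> l \<bullet> real_point B"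
proof -
  have "E \<noteq> {}" using assms by blast
  then obtain C where C: "E = {v \<in> newton_hull S. l \<bullet> v = l \<bullet> real_point C}"
    "\<And>B. B \<in> S \<Longrightarrow> l \<bullet> real_point C \<le> l \<bullet> real_point B"
    using face_min[OF fin l det] by blast
  have eq: "l \<bullet> real_point A = l \<bullet> real_point C" using assms(2) C(1) by blast
  show "E = {v \<in> newton_hull S. l \<bullet> v = l \<bullet> real_point A}" unfolding eq by (rule C(1))
  show "B \<in> S \<Longrightarrow> l \<bullet> real_point A \<le> l \<bullet> real_point B" unfolding eq by (rule C(2))
qed

lemma two_points:
  obtains A B where "A \<in> S" "B \<in> S" "A \<noteq> B" "real_point A \<in> E" "real_point B \<in> E"
proof -
  have "E \<noteq> {}" using dim by auto
  then obtain A where A: "A \<in> S" "E = {v \<in> newton_hull S. l \<bullet> v = l \<bullet> real_point A}"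
    "\<And>B. B \<in> S \<Longrightarrow> l \<bullet> real_point A \<le> l \<bullet> real_point B"
    using face_min[OF fin l det] by blast
  have AE: "real_point A \<in> E" unfolding A(2) using real_point_mem_newton_hull[OF A(1)] by simp
  have "\<exists>B\<in>S. B \<noteq> A \<and> l \<bullet> real_point B = l \<bullet> real_point A"
  proof (rule ccontr)
    assume "\<not> ?thesis"
    then have "l \<bullet> real_point A < l \<bullet> real_point B" if "B \<in> S" "B \<noteq> A" for B
      using A(3)[OF that(1)] that by fastforce
    then have "E = {real_point A}" unfolding A(2) using face_singleton[OF fin l A(1)] by blast
    then show False using dim by simp
  qed
  then obtain B where B: "B \<in> S" "B \<noteq> A" "l \<bullet> real_point B = l \<bullet> real_point A" by blast
  then have "real_point B \<in> E" unfolding A(2) using real_point_mem_newton_hull[OF B(1)] by simp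
  then show ?thesis using that A(1) AE B(1,2) by metis
qed

lemma real_point_inject: "real_point A = real_point B \<longleftrightarrow> A = B"
  by (auto simp: vec_eq_iff intro: poly_mapping_eqI)

text \<open>An edge has dimension 1, so two of its points already span its affine hull.\<close>

lemma constant_on_edge:
  assumes AB: "real_point A \<in> E" "real_point B \<in> E" "A \<noteq> B"
    and m: "m \<bullet> real_point A = m \<bullet> real_point B" and v: "v \<in> affine hull E"
  shows "m \<bullet> v = m \<bullet> real_point A"
proof -
  let ?X = "{real_point A, real_point B}"
  have "affine hull ?X = affine hull E"
  proof (rule affine_dim_equal)
    show "affine hull ?X \<subseteq> affine hull E" using AB by (intro hull_mono) simp
    show "aff_dim (affine hull ?X) = aff_dim (affine hull E)"
      using AB(3) dim by (simp add: real_point_inject)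
  qed simp_all
  moreover have "affine hull ?X \<subseteq> {v. m \<bullet> v = m \<bullet> real_point A}"
    using m by (intro hull_minimal affine_hyperplane) auto
  ultimately show ?thesis using v by blast
qed

text \<open>The form \<open>m\<close> determines a compact face containing \<open>E\<close>. A
  further support point on it would lie off the affine hull of \<open>E\<close>, where
  \<open>l\<close> is constant, and would raise the dimension to 2, contrary to looseness.\<close>

lemma tight:
  assumes AB: "A \<in> S" "real_point A \<in> E" "real_point B \<in> E" "A \<noteq> B"
    and m: "positive_form m" "m \<bullet> real_point A = m \<bullet> real_point B"
    and min: "\<And>C. C \<in> S \<Longrightarrow> m \<bullet> real_point A \<le> m \<bullet> real_point C"
    and C: "C \<in> S" "m \<bullet> real_point C = m \<bullet> real_point A"
  shows "real_point C \<in> E"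
proof (rule ccontr)
  assume not_E: "real_point C \<notin> E"
  let ?F = "{v \<in> newton_hull S. m \<bullet> v = m \<bullet> real_point A}"
  have F: "compact_face (newton_hull S) ?F"
    unfolding compact_face_def using determines_face_iff[OF m(1) AB(1) min] m(1) by blast
  have const: "k \<bullet> v = k \<bullet> real_point A" if "v \<in> affine hull E" "k \<bullet> real_point A = k \<bullet> real_point B" for k v
    using constant_on_edge[OF AB(2-4) that(2,1)] .
  have "E \<subseteq> ?F"
    using const[OF hull_inc m(2)] det unfolding determines_face_def by auto
  then have "insert (real_point C) E \<subseteq> ?F"
    using C real_point_mem_newton_hull[OF C(1)] by simp
  then have "aff_dim (insert (real_point C) E) \<le> aff_dim ?F" by (rule aff_dim_subset)
  moreover have "real_point C \<notin> affine hull E"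
  proof
    assume "real_point C \<in> affine hull E"
    moreover have "l \<bullet> real_point A = l \<bullet> real_point B"
      using face_level(1)[OF AB(1,2)] AB(3) by auto
    ultimately have "l \<bullet> real_point C = l \<bullet> real_point A" by (rule const)
    then show False
      using not_E face_level(1)[OF AB(1,2)] real_point_mem_newton_hull[OF C(1)] by auto
  qed
  ultimately have "2 \<le> aff_dim ?F" using dim by (simp add: aff_dim_insert)
  then show False using loose[OF F \<open>E \<subseteq> ?F\<close>] by simp
qed

text \<open>Moving \<open>l\<close> along \<open>m\<close> until a further point of \<open>S\<close> becomes minimal would produce a face of
  dimension at least 2 through the edge.\<close>

lemma above_edge:
  assumes AB: "A \<in> S" "B \<in> S" "real_point A \<in> E" "real_point B \<in> E" "A \<noteq> B"
    and m: "m \<in> orthant" "m \<bullet> real_point A = m \<bullet> real_point B"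
    and C: "C \<in> S"
  shows "m \<bullet> real_point A \<le> m \<bullet> real_point C"
proof (rule ccontr)
  assume not_le: "\<not> ?thesis"
  define T where "T = {D \<in> S. m \<bullet> real_point D < m \<bullet> real_point A}"
  have T: "finite T" "T \<noteq> {}" using fin C not_le by (auto simp: T_def)
  \<comment> \<open>\<open>q D\<close> is the parameter at which \<open>l + q D *\<^sub>R m\<close>
    takes equal values at \<open>D\<close> and at \<open>A\<close>; the least one is reached
    first.\<close>
  define q where "q D = (l \<bullet> real_point D - l \<bullet> real_point A) / (m \<bullet> real_point A - m \<bullet> real_point D)" for D
  define D where "D = arg_min_on q T"
  have D: "D \<in> T" unfolding D_def by (rule arg_min_if_finite(1)[OF T])
  have D_min: "q D \<le> q D'" if "D' \<in> T" for D'
    unfolding D_def by (rule arg_min_least[OF T that])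
  have q_mult: "l \<bullet> real_point D' - l \<bullet> real_point A = q D' * (m \<bullet> real_point A - m \<bullet> real_point D')"
    if "D' \<in> T" for D'
    using that by (simp add: q_def T_def)
  have "0 \<le> q D" using D face_level(2)[OF AB(1,3)] by (simp add: q_def T_def)
  let ?k = "l + q D *\<^sub>R m"
  have "real_point D \<in> E"
  proof (rule tight[OF AB(1,3,4,5)])
    show "positive_form ?k"
      using l m(1) \<open>0 \<le> q D\<close> by (auto simp: positive_form_def orthant_def intro: add_pos_nonneg)
    have "l \<bullet> real_point A = l \<bullet> real_point B" using face_level(1)[OF AB(1,3)] AB(4) by auto
    then show "?k \<bullet> real_point A = ?k \<bullet> real_point B" using m(2) by (simp add: inner_add_left)
    show "?k \<bullet> real_point A \<le> ?k \<bullet> real_point D'" if "D' \<in> S" for D'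
    proof (cases "D' \<in> T")
      case True
      then have "q D * (m \<bullet> real_point A - m \<bullet> real_point D') \<le> q D' * (m \<bullet> real_point A - m \<bullet> real_point D')"
        using D_min by (intro mult_right_mono) (auto simp: T_def)
      then show ?thesis using q_mult[OF True] by (simp add: inner_add_left algebra_simps)
    next
      case False
      then have "q D * (m \<bullet> real_point A) \<le> q D * (m \<bullet> real_point D')"
        using \<open>0 \<le> q D\<close> that by (intro mult_left_mono) (auto simp: T_def)
      then show ?thesis using face_level(2)[OF AB(1,3) that] by (simp add: inner_add_left)
    qed
    show "D \<in> S" using D by (simp add: T_def)
    show "?k \<bullet> real_point D = ?k \<bullet> real_point A"
      using q_mult[OF D] by (simp add: inner_add_left algebra_simps)
  qed
  then have "m \<bullet> real_point D = m \<bullet> real_point A"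
    using constant_on_edge[OF AB(3-5) m(2)] by (simp add: hull_inc)
  then show False using D by (simp add: T_def)
qed

text \<open>Translates the edge into integral data. The last two conclusions are
  \<open>above_edge\<close> and \<open>tight\<close> for integral forms vanishing on
  \<open>w\<close>; in this shape looseness enters the algebra.\<close>

lemma lattice_points:
  obtains w A0 A1 d idx where "primitive_vector w" "\<exists>i. 0 < w $ i" "\<exists>i. w $ i < 0"
    "A0 \<in> S" "real_point A0 \<in> E" "A1 \<in> S" "real_point A1 \<in> E" "d \<ge> 1" "idx A0 = 0" "idx A1 = d"
    "\<And>A. A \<in> S \<Longrightarrow> real_point A \<in> E \<Longrightarrow> exponent_vec A = exponent_vec A0 + int (idx A) *s w"
    "\<And>A. A \<in> S \<Longrightarrow> real_point A \<in> E \<Longrightarrow> idx A \<le> d"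
    "\<And>c A. nonneg c \<Longrightarrow> form c w = 0 \<Longrightarrow> A \<in> S \<Longrightarrow> form c (exponent_vec A0) \<le> form c (exponent_vec A)"
    "\<And>c A. (\<And>i. 0 < c $ i) \<Longrightarrow> form c w = 0 \<Longrightarrow> A \<in> S \<Longrightarrow>
      form c (exponent_vec A) = form c (exponent_vec A0) \<Longrightarrow> real_point A \<in> E"
proof -
  obtain A B where AB: "A \<in> S" "B \<in> S" "A \<noteq> B" "real_point A \<in> E" "real_point B \<in> E"
    by (rule two_points)
  have "exponent_vec B - exponent_vec A \<noteq> 0" using AB(3) by (simp add: exponent_vec_inject)
  then obtain w g where w: "primitive_vector w" and g: "exponent_vec B - exponent_vec A = g *s w" "g \<noteq> 0"
    by (rule primitive_direction)
  have B: "real_point B = real_point A + real_of_int g *\<^sub>R real_vec w"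
    unfolding real_point_eq using g(1) by (simp add: diff_eq_eq add.commute flip: real_vec_translate)
  have orth: "k \<bullet> real_point A = k \<bullet> real_point B \<longleftrightarrow> k \<bullet> real_vec w = 0" for k
    unfolding B using g(2) by (simp add: inner_add_right)
  have "l \<bullet> real_point A = l \<bullet> real_point B" using face_level(1)[OF AB(1,4)] AB(5) by auto
  then have lw: "l \<bullet> real_vec w = 0" using orth by simp
  have "w \<noteq> 0" using w by (simp add: primitive_vector_def)
  note entries = positive_form_entries[OF l lw this]
  let ?T = "{C \<in> S. real_point C \<in> E}"
  have mult: "\<exists>k. exponent_vec C - exponent_vec A = k *s w" if "C \<in> ?T" for C
  proof (rule primitive_vector_multiple[OF w])
    fix i j
    let ?u = "exponent_vec C - exponent_vec A"
    \<comment> \<open>This form vanishes on \<open>w\<close> but need not be non-negative, so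
      \<open>above_edge\<close> is out of reach; on the edge itself, however, it is
      constant.\<close>
    let ?c = "axis i (w $ j) - axis j (w $ i)"
    have "form ?c w = 0" by (simp add: form_diff_left form_axis)
    then have "real_vec ?c \<bullet> real_vec w = 0" using form_eq_inner[of ?c w] by simp
    then have "real_vec ?c \<bullet> real_point C = real_vec ?c \<bullet> real_point A"
      using that by (intro constant_on_edge[OF AB(4,5,3)]) (simp_all add: orth hull_inc)
    then have "real_of_int (form ?c (exponent_vec C)) = real_of_int (form ?c (exponent_vec A))"
      unfolding form_eq_inner real_point_eq .
    then have "form ?c ?u = 0" by (simp add: form_diff)
    then show "?u $ i * w $ j = ?u $ j * w $ i"
      by (simp only: form_diff_left form_axis) (simp only: algebra_simps)
  qed
  have line: "\<exists>k. exponent_vec C - exponent_vec D = k *s w" if CD: "C \<in> ?T" "D \<in> ?T" for C D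
  proof -
    obtain i j where ij: "exponent_vec C - exponent_vec A = i *s w" "exponent_vec D - exponent_vec A = j *s w"
      using mult[OF CD(1)] mult[OF CD(2)] by blast
    have "exponent_vec C - exponent_vec D = (exponent_vec C - exponent_vec A) - (exponent_vec D - exponent_vec A)"
      by simp
    also have "\<dots> = (i - j) *s w" unfolding ij by (simp add: vec_eq_iff algebra_simps)
    finally show ?thesis by blast
  qed
  have finT: "finite ?T" "?T \<noteq> {}" using fin AB by auto
  obtain A0 idx where A0: "A0 \<in> ?T"
    and idx: "\<And>C. C \<in> ?T \<Longrightarrow> exponent_vec C = exponent_vec A0 + int (idx C) *s w"
    and idx_A0: "idx A0 = 0"
    by (rule line_indexing[OF finT line], assumption+, rule that)
  have fin_idx: "finite (idx ` ?T)" "idx ` ?T \<noteq> {}" using fin AB by auto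
  obtain A1 where A1: "A1 \<in> ?T" "idx A1 = Max (idx ` ?T)" using Max_in[OF fin_idx] by auto
  have le: "idx C \<le> idx A1" if "C \<in> ?T" for C unfolding A1(2) using fin_idx(1) that by (intro Max_ge) auto
  have "idx A1 \<ge> 1"
  proof (rule ccontr)
    assume "\<not> ?thesis"
    then have "idx C = 0" if "C \<in> ?T" for C using le[OF that] by simp
    then have "exponent_vec C = exponent_vec A0" if "C \<in> ?T" for C using idx[OF that] that by simp
    then have "A = B" using AB by (metis (mono_tags, lifting) exponent_vec_inject mem_Collect_eq)
    then show False using AB(3) by simp
  qed
  have pt: "real_vec k \<bullet> real_point A0 = real_vec k \<bullet> real_point A1" if "form k w = 0" for k
  proof -
    have "form k (exponent_vec A1) = form k (exponent_vec A0)"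
      unfolding idx[OF A1(1)] using that by (simp add: form_add form_smult)
    then show ?thesis unfolding real_point_eq form_eq_inner[symmetric] by simp
  qed
  have ne: "A0 \<noteq> A1" using \<open>idx A1 \<ge> 1\<close> idx_A0 by auto
  have A01: "A0 \<in> S" "A1 \<in> S" "real_point A0 \<in> E" "real_point A1 \<in> E" using A0 A1 by auto
  have ge: "form c (exponent_vec A0) \<le> form c (exponent_vec C)"
    if "nonneg c" "form c w = 0" "C \<in> S" for c C
  proof -
    have "real_vec c \<in> orthant" using that(1) by (simp add: nonneg_def orthant_def)
    from above_edge[OF A01 ne this pt[OF that(2)] that(3)]
    have "real_of_int (form c (exponent_vec A0)) \<le> real_of_int (form c (exponent_vec C))"
      unfolding form_eq_inner real_point_eq .
    then show ?thesis by simp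
  qed
  have eq: "real_point C \<in> E"
    if c: "\<And>i. 0 < c $ i" "form c w = 0" "C \<in> S" "form c (exponent_vec C) = form c (exponent_vec A0)" for c C
  proof (rule tight[OF A01(1,3,4) ne _ pt[OF c(2)] _ c(3)])
    show "positive_form (real_vec c)" using c(1) by (simp add: positive_form_def)
    show "real_vec c \<bullet> real_point D \<ge> real_vec c \<bullet> real_point A0" if "D \<in> S" for D
      using ge[OF _ c(2) that] c(1) unfolding real_point_eq form_eq_inner[symmetric]
      by (simp add: nonneg_def less_imp_le)
    show "real_vec c \<bullet> real_point C = real_vec c \<bullet> real_point A0"
      unfolding real_point_eq form_eq_inner[symmetric] using c(4) by simp
  qed
  show ?thesis
    by (rule that[OF w entries A01(1,3,2,4) \<open>idx A1 \<ge> 1\<close> idx_A0 refl _ _ ge eq])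
       (use idx le in auto)
qed

text \<open>The end points are \<open>d\<close> times the negative and the positive part of
  \<open>w\<close>. Every support point then dominates a point of the segment between them, so the
  polyhedron lies in segment plus orthant and every compact face lies in the segment. A face of
  dimension 1 spans the same line as \<open>E\<close>, and its form is constant on
  \<open>E\<close>.\<close>

lemma only_compact_edge:
  assumes A01: "A0 \<in> S" "real_point A0 \<in> E" "A1 \<in> S" "real_point A1 \<in> E"
    and d: "d \<ge> 1"
    and pts: "exponent_vec A0 = int d *s neg_part w" "exponent_vec A1 = exponent_vec A0 + int d *s w"
    and entries: "\<exists>i. 0 < w $ i" "\<exists>i. w $ i < 0"
    and above: "\<And>c A. nonneg c \<Longrightarrow> form c w = 0 \<Longrightarrow> A \<in> S \<Longrightarrow>
      form c (exponent_vec A0) \<le> form c (exponent_vec A)"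
  shows "compact_edge (newton_hull S) F \<longleftrightarrow> F = E"
proof
  assume "F = E"
  then show "compact_edge (newton_hull S) F"
    using l det dim by (auto simp: compact_edge_def compact_face_def)
next
  assume "compact_edge (newton_hull S) F"
  then obtain k where k: "positive_form k" "determines_face k (newton_hull S) F" and dimF: "aff_dim F = 1"
    by (auto simp: compact_edge_def compact_face_def)
  let ?a = "real_point A0" and ?b = "real_point A1"
  have ne: "?a \<noteq> ?b"
  proof
    assume "?a = ?b"
    then have "int d *s w = 0" using pts(2) by (simp add: real_point_inject)
    then show False using d entries by (auto simp: vec_eq_iff)
  qed
  have segE: "closed_segment ?a ?b \<subseteq> E"
  proof -
    have "convex E"
      using face_level(1)[OF A01(1,2)] convex_newton_hull[of S] convex_hyperplane[of l "l \<bullet> ?a"]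
      by (simp add: Collect_conj_eq convex_Int Int_def[symmetric])
    then show ?thesis using A01 by (intro closed_segment_subset)
  qed
  have seg: "\<exists>p\<in>closed_segment ?a ?b. real_point A - p \<in> orthant" if A: "A \<in> S" for A
  proof -
    let ?P = "{i. 0 < w $ i}"
    let ?r = "\<lambda>i. real_of_int (exponent_vec A $ i) / real_of_int \<bar>w $ i\<bar>"
    \<comment> \<open>Since \<open>A0\<close> vanishes where \<open>w\<close> is positive,
      \<open>t \<le> ?r i\<close> says exactly that \<open>A\<close> dominates
      \<open>A0 + t w\<close> in coordinate \<open>i\<close>; the cap \<open>real d\<close> keeps
      the point on the segment.\<close>
    define t where "t = Min (insert (real d) (?r ` ?P))"
    have t: "t \<le> real d" "\<And>i. 0 < w $ i \<Longrightarrow> t \<le> ?r i" by (simp_all add: t_def)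
    have "0 \<le> t" unfolding t_def by (simp add: divide_nonneg_nonneg)
    have "t \<in> insert (real d) (?r ` ?P)" unfolding t_def by (intro Min_in) auto
    \<comment> \<open>For \<open>t = real d\<close> the left side is 0. Otherwise some coordinate
      \<open>i\<close> is tight, and a non-negative combination of the coordinates \<open>i\<close>
      and \<open>j\<close> vanishing on \<open>w\<close> gives the bound.\<close>
    have neg: "(real d - t) * (- real_of_int (w $ j)) \<le> real_of_int (exponent_vec A $ j)" if j: "w $ j < 0" for j
      using \<open>t \<in> insert (real d) (?r ` ?P)\<close>
    proof
      assume "t \<in> ?r ` ?P"
      then obtain i where i: "0 < w $ i" "t = ?r i" by blast
      let ?c = "axis i (- w $ j) + axis j (w $ i)"
      have "nonneg ?c" using i j by (auto simp: nonneg_def axis_def)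
      moreover have "form ?c w = 0" by (simp add: form_add_left form_axis)
      ultimately have "form ?c (exponent_vec A0) \<le> form ?c (exponent_vec A)" using A by (rule above)
      then have "w $ i * (int d * - w $ j) \<le> (- w $ j) * exponent_vec A $ i + w $ i * exponent_vec A $ j"
        unfolding pts(1) using i j by (simp add: form_add_left form_axis neg_part_def)
      then have "real_of_int (w $ i * (int d * - w $ j)) \<le>
          real_of_int ((- w $ j) * exponent_vec A $ i + w $ i * exponent_vec A $ j)"
        by (simp only: of_int_le_iff)
      then have *: "real_of_int (w $ i) * (real d * - real_of_int (w $ j)) \<le>
          - real_of_int (w $ j) * real_of_int (exponent_vec A $ i) + real_of_int (w $ i) * real_of_int (exponent_vec A $ j)"
        by simp
      have "real_of_int (exponent_vec A $ i) = t * real_of_int (w $ i)" using i by simp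
      with * have "real_of_int (w $ i) * ((real d - t) * (- real_of_int (w $ j))) \<le>
          real_of_int (w $ i) * real_of_int (exponent_vec A $ j)"
        by (simp add: algebra_simps)
      then show ?thesis using i(1) by (simp only: mult_le_cancel_left_pos of_int_0_less_iff)
    qed simp
    let ?p = "(1 - t / real d) *\<^sub>R ?a + (t / real d) *\<^sub>R ?b"
    have "?p \<in> closed_segment ?a ?b"
      using \<open>0 \<le> t\<close> t(1) d unfolding closed_segment_def by (intro CollectI exI[of _ "t / real d"]) simp
    moreover have "real_point A - ?p \<in> orthant"
    proof -
      have "?b = ?a + real d *\<^sub>R real_vec w" unfolding real_point_eq pts(2) real_vec_translate by simp
      then have p: "?p = ?a + t *\<^sub>R real_vec w" using d by (simp add: algebra_simps)
      have a: "?a $ i = real d * real_of_int (neg_part w $ i)" for i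
        unfolding real_point_eq pts(1) by simp
      have "0 \<le> (real_point A - ?p) $ i" for i
      proof -
        consider "0 < w $ i" | "w $ i < 0" | "w $ i = 0" by linarith
        then show ?thesis
        proof cases
          case 1
          then have "t * real_of_int (w $ i) \<le> real_of_int (exponent_vec A $ i)"
            using t(2)[OF 1] by (simp add: le_divide_eq)
          then show ?thesis using 1 unfolding p vector_minus_component vector_add_component a
            by (simp add: neg_part_def)
        next
          case 2
          then show ?thesis using neg[OF 2] unfolding p vector_minus_component vector_add_component a
            by (simp add: neg_part_def algebra_simps)
        next
          case 3
          then show ?thesis unfolding p vector_minus_component vector_add_component a
            by (simp add: neg_part_def)
        qed
      qed
      then show ?thesis by (simp add: orthant_def)
    qed
    ultimately show ?thesis by blast
  qed
  have F_seg: "F \<subseteq> closed_segment ?a ?b"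
  proof
    fix v assume v: "v \<in> F"
    then have vN: "v \<in> newton_hull S" and v_min: "\<And>w. w \<in> newton_hull S \<Longrightarrow> k \<bullet> v \<le> k \<bullet> w"
      using k(2) unfolding determines_face_def by auto
    obtain p where p: "p \<in> closed_segment ?a ?b" "v - p \<in> orthant"
      using newton_hull_subset_sum[OF compact_segment convex_closed_segment seg vN] by blast
    have "p \<in> newton_hull S" using p(1) segE det unfolding determines_face_def by blast
    then have "k \<bullet> (v - p) \<le> 0" using v_min by (simp add: inner_diff_right)
    moreover have "0 \<le> k \<bullet> (v - p)" by (rule inner_nonneg_orthant[OF positive_form_orthant[OF k(1)] p(2)])
    ultimately have "v - p = 0" using inner_positive_form_eq_0[OF k(1) p(2)] by simp
    then show "v \<in> closed_segment ?a ?b" using p(1) by simp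
  qed
  then have FE: "F \<subseteq> E" using segE by blast
  have "F \<noteq> {}" using dimF by auto
  have "affine hull F = affine hull E"
  proof (rule affine_dim_equal)
    show "affine hull F \<subseteq> affine hull E" using FE by (rule hull_mono)
  qed (use \<open>F \<noteq> {}\<close> dim dimF in simp_all)
  obtain v0 where v0: "v0 \<in> F" using \<open>F \<noteq> {}\<close> by blast
  have "affine hull F \<subseteq> {v. k \<bullet> v = k \<bullet> v0}"
    using k(2) v0 unfolding determines_face_def
    by (intro hull_minimal affine_hyperplane) (auto intro: antisym)
  then have const: "k \<bullet> v = k \<bullet> v0" if "v \<in> E" for v
    using hull_inc[OF that, of affine] \<open>affine hull F = affine hull E\<close> by auto
  have v0_min: "k \<bullet> v0 \<le> k \<bullet> u" if "u \<in> newton_hull S" for u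
    using v0 k(2) that unfolding determines_face_def by auto
  have "E \<subseteq> F"
  proof
    fix v assume "v \<in> E"
    then have "v \<in> newton_hull S" using det unfolding determines_face_def by auto
    then show "v \<in> F"
      using k(2) const[OF \<open>v \<in> E\<close>] v0_min unfolding determines_face_def by simp
  qed
  then show "F = E" using FE by blast
qed

end

lemma loose_edge_ofI:
  assumes "finite S" "loose_edge (newton_hull S) E"
  obtains l where "loose_edge_of S E l"
proof -
  obtain l where "positive_form l" "determines_face l (newton_hull S) E" "aff_dim E = 1"
    using assms(2) by (auto simp: loose_edge_def compact_edge_def compact_face_def)
  moreover have "aff_dim F < 2" if "compact_face (newton_hull S) F" "E \<subseteq> F" for F
    using assms(2) that unfolding loose_edge_def by (meson not_le)
  ultimately have "loose_edge_of S E l" using assms(1) by unfold_locales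
  then show ?thesis by (rule that)
qed

lemma map_poly_residue_sum_monom:
  "map_poly residue (\<Sum>A\<in>S. monom (c A) (idx A)) = (\<Sum>A\<in>S. monom (residue (c A)) (idx A))"
  by (rule poly_eqI) (simp add: coeff_map_poly coeff_sum residue_sum if_distrib[of residue] cong: if_cong)

lemma newton_polyhedron_eq: "newton_polyhedron x f = newton_hull (Poly_Mapping.keys (expansion x f))"
  by (simp add: newton_polyhedron_def newton_hull_def)

theorem corollary1p3:
  fixes x :: "'n::finite \<Rightarrow> 'a::local_ring" and f :: 'a and E :: "(real ^ 'n) set"
  assumes "regular_local_ring TYPE('a)"
    and "regular_system_of_parameters x"
    and "loose_edge (newton_polyhedron x f) E"
    and "irreducible (to_completion f)"
  shows "(\<forall>F. compact_edge (newton_polyhedron x f) F \<longleftrightarrow> F = E) \<and>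
    (\<exists>(\<epsilon> :: 'a residue_field) (P :: ('n, 'a residue_field) mpoly) (k :: nat).
       \<epsilon> \<noteq> 0 \<and> irreducible P \<and> k \<ge> 1 \<and>
       initial_form x f E = Poly_Mapping.single 0 \<epsilon> * P ^ k) \<and>
    (algebraically_closed TYPE('a residue_field) \<longrightarrow>
      (\<exists>(\<epsilon> :: 'a residue_field) (P :: ('n, 'a residue_field) mpoly) (k :: nat)
          (c :: 'a residue_field) (\<alpha> :: 'n \<Rightarrow>\<^sub>0 nat) (\<beta> :: 'n \<Rightarrow>\<^sub>0 nat).
         \<epsilon> \<noteq> 0 \<and> irreducible P \<and> k \<ge> 1 \<and>
         initial_form x f E = Poly_Mapping.single 0 \<epsilon> * P ^ k \<and>
         c \<noteq> 0 \<and> P = Poly_Mapping.single \<alpha> 1 + Poly_Mapping.single \<beta> c \<and>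
         primitive_vector (exponent_diff \<alpha> \<beta>)))"
proof -
  have noeth: "noetherian TYPE('a)" using assms(1) by (simp add: regular_local_ring_def)
  have gen: "is_ideal hull (range x) = max_ideal"
    using assms(2) by (simp add: regular_system_of_parameters_def)
  define \<rho> where "\<rho> = expansion x f"
  define S where "S = Poly_Mapping.keys \<rho>"
  let ?c = "Poly_Mapping.lookup \<rho>"
  have expansion: "is_expansion x f \<rho>"
    unfolding \<rho>_def by (rule is_expansion_expansion[OF noeth gen])
  have fin: "finite S" by (simp add: S_def)
  have N: "newton_polyhedron x f = newton_hull S"
    by (simp add: newton_polyhedron_eq S_def \<rho>_def)
  have unit: "residue (?c A) \<noteq> 0" if "A \<in> S" for A
  proof -
    have "?c A dvd 1" using expansion that unfolding is_expansion_def S_def in_keys_iff by blast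
    then show ?thesis using unit_iff_notin_max_ideal[OF noeth] residue_eq_0_iff by blast
  qed
  obtain l where "loose_edge_of S E l"
    using loose_edge_ofI[OF fin] assms(3) unfolding N by blast
  then interpret loose_edge_of S E l .
  obtain w A0 A1 d idx where w: "primitive_vector w" "\<exists>i. 0 < w $ i" "\<exists>i. w $ i < 0"
    and A01: "A0 \<in> S" "real_point A0 \<in> E" "A1 \<in> S" "real_point A1 \<in> E"
    and d: "d \<ge> 1" "idx A0 = 0" "idx A1 = d"
    and idx: "\<And>A. A \<in> S \<Longrightarrow> real_point A \<in> E \<Longrightarrow> exponent_vec A = exponent_vec A0 + int (idx A) *s w"
      "\<And>A. A \<in> S \<Longrightarrow> real_point A \<in> E \<Longrightarrow> idx A \<le> d"
    and ge: "\<And>c A. nonneg c \<Longrightarrow> form c w = 0 \<Longrightarrow> A \<in> S \<Longrightarrow>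
      form c (exponent_vec A0) \<le> form c (exponent_vec A)"
    and eq: "\<And>c A. (\<And>i. 0 < c $ i) \<Longrightarrow> form c w = 0 \<Longrightarrow> A \<in> S \<Longrightarrow>
      form c (exponent_vec A) = form c (exponent_vec A0) \<Longrightarrow> real_point A \<in> E"
    by (rule lattice_points) blast
  interpret direction x w by unfold_locales (rule gen, rule w(2), rule w(3))
  define T where "T = {A \<in> S. real_point A \<in> E}"
  have T: "finite T" "T \<subseteq> S" "A0 \<in> T" "A1 \<in> T" using fin A01 by (auto simp: T_def)
  have pts: "exponent_vec A = exponent_vec A0 + int (idx A) *s w" "idx A \<le> d" if "A \<in> T" for A
    using idx that by (auto simp: T_def)
  have inj: "inj_on idx T" by (rule inj_onI) (metis exponent_vec_inject pts(1))
  \<comment> \<open>The dehomogenized initial form, before reduction: its variable stands for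
    \<open>X^w\<close>, counted from \<open>A0\<close>. Both ends of the edge belong to the support,
    so the residue \<open>Q\<close> has degree exactly \<open>d\<close> and a nonzero constant
    term.\<close>
  define q where "q = (\<Sum>A\<in>T. monom (?c A) (idx A))"
  define Q where "Q = map_poly residue q"
  have Q_eq: "Q = (\<Sum>A\<in>T. monom (residue (?c A)) (idx A))"
    unfolding Q_def q_def by (rule map_poly_residue_sum_monom)
  have Q0: "coeff Q 0 \<noteq> 0"
    using coeff_sum_monom[OF T(1) inj T(3), of "\<lambda>A. residue (?c A)"] unit[OF A01(1)] d(2) by (simp add: Q_eq)
  have deg_q: "degree q \<le> d"
    unfolding q_def by (rule degree_sum_le[OF T(1)]) (use pts(2) degree_monom_le order_trans in blast)
  have deg_Q: "degree Q = d"
  proof (rule antisym)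
    show "degree Q \<le> d"
      unfolding Q_eq by (rule degree_sum_le[OF T(1)]) (use pts(2) degree_monom_le order_trans in blast)
    have "coeff Q d \<noteq> 0"
      using coeff_sum_monom[OF T(1) inj T(4), of "\<lambda>A. residue (?c A)"] unit[OF A01(3)] d(3) by (simp add: Q_eq)
    then show "d \<le> degree Q" by (rule le_degree)
  qed
  let ?z = "exponent_vec A0"
  \<comment> \<open>A support point on the level of \<open>A0\<close> lies on the edge by
    \<open>eq\<close>. All others are strictly higher, and since levels are integers, higher by at
    least 1.\<close>
  have f: "f - ev ?z q \<in> above_ideal ?z (level ?z + 1)"
  proof -
    have "f = (\<Sum>A\<in>S. ?c A * int_monomial x (exponent_vec A))"
      using expansion by (simp add: is_expansion_def S_def int_monomial_exponent_vec)
    also have "\<dots> = (\<Sum>A\<in>S - T. ?c A * int_monomial x (exponent_vec A)) +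
        (\<Sum>A\<in>T. ?c A * int_monomial x (exponent_vec A))"
      by (rule sum.subset_diff[OF T(2) fin])
    also have "(\<Sum>A\<in>T. ?c A * int_monomial x (exponent_vec A)) = ev ?z q"
      unfolding q_def
      by (rule line_sum_of_support[of T idx "\<lambda>r. r", OF T(1) inj refl pts(1), symmetric])
    finally have "f - ev ?z q = (\<Sum>A\<in>S - T. ?c A * int_monomial x (exponent_vec A))" by simp
    also have "\<dots> \<in> above_ideal ?z (level ?z + 1)"
    proof (rule ideal_sum_mem[OF is_ideal_above_ideal])
      fix A assume A: "A \<in> S - T"
      have "level ?z \<le> level (exponent_vec A)"
        using ge[OF _ level_direction] A level_form_pos by (simp add: nonneg_def less_imp_le)
      moreover have "level (exponent_vec A) \<noteq> level ?z"
        using eq[OF level_form_pos level_direction] A by (auto simp: T_def)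
      moreover have "exponent_vec A \<in> above ?z"
        using ge A by (simp add: above_def nonneg_exponent_vec)
      ultimately have "int_monomial x (exponent_vec A) \<in> above_ideal ?z (level ?z + 1)"
        by (intro int_monomial_mem_above_ideal) auto
      then show "?c A * int_monomial x (exponent_vec A) \<in> above_ideal ?z (level ?z + 1)"
        by (rule ideal_mult_mem[OF is_ideal_above_ideal])
    qed
    finally show ?thesis .
  qed
  \<comment> \<open>This is the componentwise minimum of the exponents of \<open>A0\<close> and
    \<open>A1\<close>, the exponent of the largest monomial dividing the initial form.\<close>
  define \<gamma> where "\<gamma> = ?z - int d *s neg_part w"
  have \<gamma>: "nonneg \<gamma>"
    unfolding nonneg_def
  proof
    fix i
    have "exponent_vec A1 $ i = ?z $ i + int d * w $ i" unfolding pts(1)[OF T(4)] d(3) by simp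
    moreover have "0 \<le> exponent_vec A1 $ i" "0 \<le> ?z $ i" by simp_all
    ultimately have "0 \<le> ?z $ i + int d * w $ i" "0 \<le> ?z $ i" by linarith+
    then show "0 \<le> \<gamma> $ i"
      by (cases "0 \<le> w $ i") (simp_all add: \<gamma>_def neg_part_def)
  qed
  have factors: "\<gamma> = 0 \<and> degree g = 0 \<or> degree h = 0" if gh: "Q = g * h" "comaximal g h" for g h
  proof (rule ccontr)
    assume nontrivial: "\<not> ?thesis"
    have ne: "g \<noteq> 0" "h \<noteq> 0" using gh Q0 by auto
    have deg: "degree g + degree h = d" using deg_Q unfolding gh(1) by (simp add: degree_mult_eq ne)
    have h0: "coeff h 0 \<noteq> 0" using Q0 unfolding gh(1) by (simp add: coeff_mult)
    have z: "(\<gamma> + int (degree g) *s neg_part w) + int (degree h) *s neg_part w = ?z"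
      by (simp add: \<gamma>_def vec_eq_iff algebra_simps flip: deg)
    have "\<not> irreducible (to_completion f)"
    proof (rule not_irreducible_if_initial_factors[OF \<gamma> gh(2) h0])
      show "map_poly residue q = g * h" using gh(1) by (simp add: Q_def)
      show "degree q \<le> degree g + degree h" using deg_q deg by simp
    qed (use f nontrivial in \<open>auto simp only: z\<close>)
    then show False using assms(4) by blast
  qed
  \<comment> \<open>The trivial factorization is already informative: for
    \<open>\<gamma> \<noteq> 0\<close> it would split \<open>f\<close> into factors with initial
    forms \<open>X^\<gamma>\<close> and a binary form of degree \<open>d\<close>.\<close>
  have "Q = 1 * Q" by simp
  from factors[OF this comaximal_one_left] have "\<gamma> = 0" using deg_Q d(1) by simp
  then have z: "?z = int d *s neg_part w" by (simp add: \<gamma>_def)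
  have "degree Q > 0" using deg_Q d(1) by simp
  moreover have "degree g = 0 \<or> degree h = 0" if "Q = g * h" "comaximal g h" for g h
    using factors[OF that] by auto
  ultimately obtain \<epsilon> p k where p: "\<epsilon> \<noteq> 0" "irreducible p" "lead_coeff p = 1" "k \<ge> 1" "Q = smult \<epsilon> (p ^ k)"
    by (rule power_irreducible_or_comaximal_factors) blast+
  have p0: "coeff p 0 \<noteq> 0"
  proof
    assume "coeff p 0 = 0"
    then have "coeff Q 0 = 0" using p(4) unfolding p(5) by (simp add: coeff_0_power)
    then show False using Q0 by simp
  qed
  obtain j where j: "w $ j < 0" using w(3) by blast
  let ?P = "homogenization w p"
  have irred: "irreducible ?P" by (rule irreducible_homogenization[OF p(2) p0 w(1) j])
  have init: "initial_form x f E = Poly_Mapping.single 0 \<epsilon> * ?P ^ k"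
  proof -
    have "p \<noteq> 0" using p(2) by auto
    have "initial_form x f E = (\<Sum>A\<in>T. Poly_Mapping.single A (residue (?c A)))"
      by (simp add: initial_form_def T_def S_def \<rho>_def)
    also have "\<dots> = (\<Sum>A\<in>T. Poly_Mapping.single 0 (residue (?c A)) * vec_monomial (exponent_vec A))"
      by (simp add: vec_monomial_def mult_single vec_exponent_inverse)
    also have "\<dots> = line_poly w ?z Q"
      unfolding Q_eq
      by (rule line_sum_of_support[of T idx "Poly_Mapping.single 0", OF T(1) inj single_zero pts(1), symmetric])
    also have "\<dots> = homogenization w Q" by (simp add: homogenization_def deg_Q z)
    also have "Q = [:\<epsilon>:] * p ^ k" using p(5) by simp
    also have "homogenization w \<dots> = homogenization w [:\<epsilon>:] * ?P ^ k"
      using p(1) \<open>p \<noteq> 0\<close> by (subst homogenization_mult) (simp_all add: homogenization_power)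
    finally show ?thesis by (simp add: homogenization_const)
  qed
  have "compact_edge (newton_polyhedron x f) F \<longleftrightarrow> F = E" for F
    unfolding N
    by (rule only_compact_edge[OF A01 d(1) z pts(1)[OF T(4), unfolded d(3)] w(2,3) ge])
  moreover have "\<exists>c \<alpha> \<beta>. c \<noteq> 0 \<and> ?P = Poly_Mapping.single \<alpha> 1 + Poly_Mapping.single \<beta> c \<and>
      primitive_vector (exponent_diff \<alpha> \<beta>)" if closed: "algebraically_closed TYPE('a residue_field)"
  proof -
    obtain c where c: "p = [:c, 1:]" by (rule irreducible_algebraically_closed[OF p(2,3) closed])
    have "neg_part w + w = pos_part w"
      using pos_part_minus_neg_part[of w] by (simp add: algebra_simps)
    then have "?P = Poly_Mapping.single (vec_exponent (pos_part w)) 1 + Poly_Mapping.single (vec_exponent (neg_part w)) c"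
      by (simp add: homogenization_def line_poly_eq c atMost_Suc add.commute)
    moreover have "exponent_diff (vec_exponent (pos_part w)) (vec_exponent (neg_part w)) = w"
      by (auto simp: exponent_diff_def vec_eq_iff pos_part_def neg_part_def)
    moreover have "c \<noteq> 0" using p0 by (simp add: c)
    ultimately show ?thesis using w(1) by metis
  qed
  ultimately show ?thesis using p(1,4) irred init by blast
qed

end
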